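(* Let $d\geq 1$ and $\theta>0$. For each $n$, consider the complete graph $K_n$ whose edges $\{i,j\}$ are assigned lengths $l_{i,j}=(nX_{i,j})^{1/d}$, where the $X_{i,j}$ are independent exponential random variables with mean $1$. Let $M_n(\theta)$ be the total length of the edges belonging to the optimum diluted matching of $K_n$ with parameter $\theta$. Then there is a number $\beta_\theta(d)$ such that $$\frac{M_n(\theta)}{n}\to\beta_\theta(d)\quad\text{in probability as } n\to\infty.$$
   Context: A partial matching of a graph is a set of edges no two of which share a vertex. The diluted matching problem with parameter $\theta$ asks for the partial matching minimizing the sum of the lengths of its edges plus $\theta/2$ times the number of vertices not covered by the matching; the optimum diluted matching is a minimizer of this cost (almost surely unique here since edge lengths have a continuous distribution). *)

theory Defs
  imports "HOL-Probability.Probability"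
begin

definition edges :: "nat \<Rightarrow> (nat \<times> nat) set" where
  "edges n = {(i, j). i < j \<and> j < n}"

definition verts :: "nat \<times> nat \<Rightarrow> nat set" where
  "verts e = {fst e, snd e}"

definition partial_matching :: "nat \<Rightarrow> (nat \<times> nat) set \<Rightarrow> bool" where
  "partial_matching n M \<longleftrightarrow> M \<subseteq> edges n \<and>
     (\<forall>e\<in>M. \<forall>f\<in>M. e \<noteq> f \<longrightarrow> verts e \<inter> verts f = {})"

definition edge_space :: "nat \<Rightarrow> ((nat \<times> nat) \<Rightarrow> real) measure" where
  "edge_space n = PiM (edges n) (\<lambda>_. density lborel (exponential_density 1))"

definition edge_len :: "real \<Rightarrow> nat \<Rightarrow> ((nat \<times> nat) \<Rightarrow> real) \<Rightarrow> nat \<times> nat \<Rightarrow> real" where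
  "edge_len d n X e = (real n * X e) powr (1 / d)"

definition diluted_cost ::
  "real \<Rightarrow> real \<Rightarrow> nat \<Rightarrow> ((nat \<times> nat) \<Rightarrow> real) \<Rightarrow> (nat \<times> nat) set \<Rightarrow> real" where
  "diluted_cost d \<theta> n X M =
     (\<Sum>e\<in>M. edge_len d n X e) + \<theta> / 2 * real (card ({0..<n} - \<Union>(verts ` M)))"

definition optimal_diluted ::
  "real \<Rightarrow> real \<Rightarrow> nat \<Rightarrow> ((nat \<times> nat) \<Rightarrow> real) \<Rightarrow> (nat \<times> nat) set \<Rightarrow> bool" where
  "optimal_diluted d \<theta> n X M \<longleftrightarrow> partial_matching n M \<and>
     (\<forall>M'. partial_matching n M' \<longrightarrow> diluted_cost d \<theta> n X M \<le> diluted_cost d \<theta> n X M')"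

text \<open>M_n(theta): total length of the edges of the optimum diluted matching.
  The optimum is almost surely unique; on the null event of ties we set the value to 0.\<close>
definition M_len :: "real \<Rightarrow> real \<Rightarrow> nat \<Rightarrow> ((nat \<times> nat) \<Rightarrow> real) \<Rightarrow> real" where
  "M_len d \<theta> n X =
     (if \<exists>!M. optimal_diluted d \<theta> n X M
      then (\<Sum>e\<in>(THE M. optimal_diluted d \<theta> n X M). edge_len d n X e)
      else 0)"

end

theory Submission
  imports Defs
begin

text \<open>Write \<open>a = \<theta> / 2\<close>, let \<open>opt S\<close> be the optimal cost on the vertex set \<open>S\<close>, and
  \<open>marg S v = opt S - opt (S - {v})\<close>. Conditioning on the partner of \<open>v\<close> gives
  \<open>marg S v = min (a, min\<^sub>i (l\<^sub>v\<^sub>i - marg (S - {v}) i))\<close>, so truncating this recursion after \<open>k\<close> steps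
  bounds \<open>marg\<close> from above for even \<open>k\<close> and from below for odd \<open>k\<close>. The lengths \<open>l\<^sub>v\<^sub>i\<close> are independent of
  \<open>S - {v}\<close> and \<open>P(l \<ge> t) = exp (- t\<^sup>d / n)\<close>, hence the tail of the \<open>(k + 1)\<close>-st truncation is
  the mean of \<open>exp (- (\<Sum>i. (x + \<phi>\<^sub>i)\<^sup>d / n))\<close>, the sum running over the \<open>k\<close>-th truncations \<open>\<phi>\<^sub>i\<close>
  with \<open>x + \<phi>\<^sub>i > 0\<close>. Two vertices influence each other only with probability \<open>O(1/n)\<close>, so by a second
  moment argument the empirical tails converge to \<open>r\<^sub>k\<close>, where \<open>r\<^sub>0 = 1\<close> and \<open>r\<^sub>k\<^sub>+\<^sub>1 = V r\<^sub>k\<close> for an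
  order-reversing operator \<open>V\<close>. Even and odd iterates converge to a 2-cycle \<open>p = V q\<close>, \<open>q = V p\<close>. A symmetry
  of the kernel of \<open>V\<close> (this uses \<open>d \<ge> 1\<close>) forces \<open>p a = q a\<close>. Hence the fraction of free vertices,
  which are those with \<open>marg = a\<close>, converges in \<open>L\<^sup>1\<close> for every \<open>\<theta>\<close>. That fraction is the derivative in
  \<open>a\<close> of the concave optimal cost per vertex, so this cost converges as well, and the length of the
  optimum is the cost minus \<open>a\<close> times the number of free vertices.\<close>

subsection \<open>Recursion for the marginal cost of a vertex\<close>

text \<open>The proof does not exclude 2-cycles of \<open>V\<close> with \<open>p\<close> and
  \<open>q\<close> distinct, but free vertices see only the tail at \<open>a\<close>. There the
  reason is an identity. Formally, with \<open>K s = d * s powr (d - 1)\<close> and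
  \<open>p = exp (- A)\<close>, where \<open>A x\<close> integrates \<open>K (x + t) * q t\<close>
  over \<open>t\<close> in \<open>[-a, a]\<close>, one has \<open>p (- a) = 1\<close> and
  \<open>- p' = p * A'\<close>. So \<open>1 - p a\<close> is the double integral of
  \<open>p x * K' (x + t) * q t\<close>, which does not change when \<open>p\<close> and
  \<open>q\<close> are swapped. For \<open>d \<ge> 1\<close> the kernel \<open>K\<close> is monotone
  and locally bounded, which controls the difference quotients that stand in for \<open>K'\<close>.
  The obstacle to independence is that the recursion at \<open>v\<close> runs on
  \<open>S - {v}\<close> and the one at \<open>w\<close> on \<open>S - {w}\<close>. Both are moved
  to the common set \<open>S - {v, w}\<close>, where an exact product formula holds. The move is
  cheap because only edges shorter than \<open>2 * a\<close> matter, and each edge is that short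
  with probability \<open>O(1/n)\<close>. Every level of the recursion thus costs two vertices, so
  convergence is proved uniformly over all \<open>S\<close> that miss at most \<open>m\<close>
  vertices.\<close>

definition matching_in :: "nat set \<Rightarrow> (nat \<times> nat) set \<Rightarrow> bool" where
  "matching_in S M \<longleftrightarrow> M \<subseteq> {(i, j). i < j \<and> i \<in> S \<and> j \<in> S} \<and>
     (\<forall>e\<in>M. \<forall>f\<in>M. e \<noteq> f \<longrightarrow> verts e \<inter> verts f = {})"

definition matching_cost :: "(nat \<times> nat \<Rightarrow> real) \<Rightarrow> real \<Rightarrow> nat set \<Rightarrow> (nat \<times> nat) set \<Rightarrow> real" where
  "matching_cost l a S M = (\<Sum>e\<in>M. l e) + a * real (card (S - \<Union>(verts ` M)))"

definition opt :: "(nat \<times> nat \<Rightarrow> real) \<Rightarrow> real \<Rightarrow> nat set \<Rightarrow> real" where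
  "opt l a S = Min (matching_cost l a S ` {M. matching_in S M})"

definition uedge :: "nat \<Rightarrow> nat \<Rightarrow> nat \<times> nat" where
  "uedge v i = (min v i, max v i)"

definition marg :: "(nat \<times> nat \<Rightarrow> real) \<Rightarrow> real \<Rightarrow> nat set \<Rightarrow> nat \<Rightarrow> real" where
  "marg l a S v = opt l a S - opt l a (S - {v})"

text \<open>Only \<open>S - {v}\<close> enters the value, so \<open>v\<close> may lie inside or
  outside \<open>S\<close>. Later two vertices outside \<open>H\<close> are compared through the
  same set \<open>H\<close>.\<close>

primrec approx :: "(nat \<times> nat \<Rightarrow> real) \<Rightarrow> real \<Rightarrow> nat \<Rightarrow> nat set \<Rightarrow> nat \<Rightarrow> real" where
  "approx l a 0 S v = a"
| "approx l a (Suc k) S v =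
     Min (insert a ((\<lambda>i. l (uedge v i) - approx l a k (S - {v}) i) ` (S - {v})))"

lemma verts_uedge [simp]: "verts (uedge v i) = {v, i}"
  by (auto simp: verts_def uedge_def min_def max_def)

lemma finite_matching_in: "finite S \<Longrightarrow> matching_in S M \<Longrightarrow> finite M"
  unfolding matching_in_def
  by (rule finite_subset[where B = "S \<times> S"]) auto

lemma finite_matchings: "finite S \<Longrightarrow> finite {M. matching_in S M}"
  unfolding matching_in_def
  by (rule finite_subset[where B = "Pow (S \<times> S)"]) auto

lemma matching_in_empty: "matching_in S {}"
  by (simp add: matching_in_def)

lemma opt_le: "finite S \<Longrightarrow> matching_in S M \<Longrightarrow> opt l a S \<le> matching_cost l a S M"
  unfolding opt_def by (intro Min_le) (auto simp: finite_matchings)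

lemma opt_attained:
  assumes "finite S"
  obtains M where "matching_in S M" "opt l a S = matching_cost l a S M"
proof -
  have "opt l a S \<in> matching_cost l a S ` {M. matching_in S M}"
    unfolding opt_def using assms matching_in_empty
    by (intro Min_in) (auto simp: finite_matchings)
  then show ?thesis using that by auto
qed

lemma verts_matching_in: "matching_in S M \<Longrightarrow> \<Union>(verts ` M) \<subseteq> S"
  by (auto simp: matching_in_def verts_def)

lemma matching_in_mono: "matching_in S M \<Longrightarrow> S \<subseteq> T \<Longrightarrow> matching_in T M"
  unfolding matching_in_def by auto

lemma matching_in_restrict:
  assumes "matching_in S M" "M' \<subseteq> M" "\<Union>(verts ` M') \<subseteq> T"
  shows "matching_in T M'"
  unfolding matching_in_def
proof (intro conjI ballI impI subsetI)
  fix e assume e: "e \<in> M'"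
  then have "verts e \<subseteq> T" "e \<in> M" using assms by auto
  then show "e \<in> {(i, j). i < j \<and> i \<in> T \<and> j \<in> T}"
    using assms(1) by (auto simp: matching_in_def verts_def)
next
  fix e f assume "e \<in> M'" "f \<in> M'" "e \<noteq> f"
  then show "verts e \<inter> verts f = {}"
    using assms(1,2) unfolding matching_in_def by blast
qed

lemma matching_cost_add_vertex:
  assumes "finite S" "v \<in> S" "v \<notin> \<Union>(verts ` M)"
  shows "matching_cost l a S M = a + matching_cost l a (S - {v}) M"
proof -
  have "S - \<Union>(verts ` M) = insert v (S - {v} - \<Union>(verts ` M))"
    using assms by auto
  then have "card (S - \<Union>(verts ` M)) = Suc (card (S - {v} - \<Union>(verts ` M)))"
    using assms by (simp add: card_insert_disjoint)
  then show ?thesis by (simp add: matching_cost_def algebra_simps)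
qed

lemma matching_cost_insert_edge:
  assumes "finite M" "e \<notin> M" "verts e \<inter> \<Union>(verts ` M) = {}"
  shows "matching_cost l a S (insert e M) = l e + matching_cost l a (S - verts e) M"
proof -
  have "S - \<Union>(verts ` insert e M) = S - verts e - \<Union>(verts ` M)" by auto
  then show ?thesis using assms by (simp add: matching_cost_def)
qed

section \<open>Effect of one vertex on the optimal cost\<close>

lemma opt_le_unmatched:
  assumes "finite S" "v \<in> S"
  shows "opt l a S \<le> a + opt l a (S - {v})"
proof -
  obtain M where M: "matching_in (S - {v}) M"
    "opt l a (S - {v}) = matching_cost l a (S - {v}) M"
    using assms opt_attained[of "S - {v}"] by auto
  have "v \<notin> \<Union>(verts ` M)" using verts_matching_in[OF M(1)] by auto
  then have "matching_cost l a S M = a + opt l a (S - {v})"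
    using assms M by (simp add: matching_cost_add_vertex)
  moreover have "matching_in S M" using M(1) by (rule matching_in_mono) auto
  ultimately show ?thesis using opt_le[OF assms(1)] by metis
qed

lemma opt_le_matched:
  assumes "finite S" "v \<in> S" "i \<in> S - {v}"
  shows "opt l a S \<le> l (uedge v i) + opt l a (S - {v} - {i})"
proof -
  obtain M where M: "matching_in (S - {v} - {i}) M"
    "opt l a (S - {v} - {i}) = matching_cost l a (S - {v} - {i}) M"
    using assms opt_attained[of "S - {v} - {i}"] by auto
  have V: "\<Union>(verts ` M) \<subseteq> S - {v} - {i}" by (rule verts_matching_in[OF M(1)])
  have fin: "finite M" using finite_matching_in[OF _ M(1)] assms by auto
  have disj: "verts (uedge v i) \<inter> \<Union>(verts ` M) = {}" using V by auto
  then have notin: "uedge v i \<notin> M" by fastforce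
  have S': "S - {v, i} = S - {v} - {i}" by auto
  have "matching_in S (insert (uedge v i) M)"
    unfolding matching_in_def
  proof (intro conjI ballI impI)
    show "insert (uedge v i) M \<subseteq> {(i, j). i < j \<and> i \<in> S \<and> j \<in> S}"
      using matching_in_mono[OF M(1), of S] assms
      by (auto simp: matching_in_def uedge_def min_def max_def)
  next
    fix e f assume "e \<in> insert (uedge v i) M" "f \<in> insert (uedge v i) M" "e \<noteq> f"
    then show "verts e \<inter> verts f = {}"
      using M(1) disj unfolding matching_in_def by blast
  qed
  then have "opt l a S \<le> matching_cost l a S (insert (uedge v i) M)"
    by (rule opt_le[OF assms(1)])
  then show ?thesis
    using matching_cost_insert_edge[OF fin notin disj] M(2) by (simp add: S')
qed

text \<open>Cut \<open>v\<close>, or the edge at \<open>v\<close>, out of an optimal matching: what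
  remains is a matching of the smaller vertex set. With the two preceding inequalities this makes
  the conditioning on the partner of \<open>v\<close> exact.\<close>

lemma opt_cases:
  assumes "finite S" "v \<in> S"
  shows "opt l a S = a + opt l a (S - {v}) \<or>
         (\<exists>i\<in>S - {v}. opt l a S = l (uedge v i) + opt l a (S - {v} - {i}))"
proof -
  obtain M where M: "matching_in S M" "opt l a S = matching_cost l a S M"
    using assms opt_attained by metis
  show ?thesis
  proof (cases "v \<in> \<Union>(verts ` M)")
    case False
    then have "matching_in (S - {v}) M"
      using verts_matching_in[OF M(1)] by (intro matching_in_restrict[OF M(1)]) auto
    then have "opt l a (S - {v}) \<le> matching_cost l a (S - {v}) M"
      using assms by (intro opt_le) auto
    then have "a + opt l a (S - {v}) \<le> opt l a S"
      using matching_cost_add_vertex[OF assms False] M(2) by auto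
    then show ?thesis using opt_le_unmatched[OF assms, of l a] by simp
  next
    case True
    then obtain e where e: "e \<in> M" "v \<in> verts e" by auto
    obtain i where i: "i \<in> S - {v}" "e = uedge v i"
    proof -
      obtain x y where xy: "e = (x, y)" by force
      then have "x < y" "x \<in> S" "y \<in> S" using M(1) e(1) by (auto simp: matching_in_def)
      moreover have "v = x \<or> v = y" using e(2) xy by (auto simp: verts_def)
      ultimately show ?thesis
        using that[of x] that[of y] xy by (auto simp: uedge_def)
    qed
    define M' where "M' = M - {e}"
    have ins: "M = insert e M'" "e \<notin> M'" using e by (auto simp: M'_def)
    have fin: "finite M'" using finite_matching_in[OF assms(1) M(1)] by (simp add: M'_def)
    have disj: "verts e \<inter> \<Union>(verts ` M') = {}"
      using M(1) e(1) unfolding matching_in_def M'_def by fastforce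
    have S': "S - verts e = S - {v} - {i}" using i by auto
    have "matching_in (S - {v} - {i}) M'"
      using verts_matching_in[OF M(1)] disj i(2)
      by (intro matching_in_restrict[OF M(1)]) (auto simp: M'_def)
    then have "opt l a (S - {v} - {i}) \<le> matching_cost l a (S - {v} - {i}) M'"
      using assms by (intro opt_le) auto
    then have "l e + opt l a (S - {v} - {i}) \<le> opt l a S"
      using matching_cost_insert_edge[OF fin ins(2) disj, of l a S] M(2) ins(1) S' by simp
    then show ?thesis using opt_le_matched[OF assms i(1), of l a] i by force
  qed
qed

text \<open>Subtract \<open>opt l a (S - {v})\<close> from every alternative. For a partner
  \<open>i\<close> this leaves \<open>l (uedge v i)\<close> minus the cost of adding
  \<open>i\<close> back to \<open>S - {v} - {i}\<close>, and that cost is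
  \<open>marg l a (S - {v}) i\<close>.\<close>

lemma marg_rec:
  assumes "finite S" "v \<in> S"
  shows "marg l a S v =
    Min (insert a ((\<lambda>i. l (uedge v i) - marg l a (S - {v}) i) ` (S - {v})))"
proof (rule sym, rule Min_eqI)
  show "finite (insert a ((\<lambda>i. l (uedge v i) - marg l a (S - {v}) i) ` (S - {v})))"
    using assms by auto
next
  fix y assume "y \<in> insert a ((\<lambda>i. l (uedge v i) - marg l a (S - {v}) i) ` (S - {v}))"
  then show "marg l a S v \<le> y"
    using opt_le_unmatched[OF assms, of l a] opt_le_matched[OF assms, of _ l a]
    by (force simp: marg_def)
next
  show "marg l a S v \<in> insert a ((\<lambda>i. l (uedge v i) - marg l a (S - {v}) i) ` (S - {v}))"
    using opt_cases[OF assms, of l a] by (force simp: marg_def image_iff)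
qed

text \<open>One level of the recursion reverses inequalities; hence truncations bound
  \<open>marg\<close> alternately from above and below.\<close>

lemma Min_insert_diff_antimono:
  fixes f g h :: "'b \<Rightarrow> real"
  assumes "finite T" "\<And>i. i \<in> T \<Longrightarrow> f i \<le> g i"
  shows "Min (insert a ((\<lambda>i. h i - g i) ` T)) \<le> Min (insert a ((\<lambda>i. h i - f i) ` T))"
proof (subst Min_ge_iff)
  show "\<forall>y\<in>insert a ((\<lambda>i. h i - f i) ` T). Min (insert a ((\<lambda>i. h i - g i) ` T)) \<le> y"
  proof
    fix y assume "y \<in> insert a ((\<lambda>i. h i - f i) ` T)"
    then consider "y = a" | i where "i \<in> T" "y = h i - f i" by auto
    then show "Min (insert a ((\<lambda>i. h i - g i) ` T)) \<le> y"
    proof cases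
      case 1 then show ?thesis using assms by simp
    next
      case 2
      have "Min (insert a ((\<lambda>i. h i - g i) ` T)) \<le> h i - g i"
        using assms(1) 2 by (intro Min_le) auto
      then show ?thesis using assms(2)[of i] 2 by simp
    qed
  qed
qed (use assms in auto)

lemma approx_marg:
  assumes "finite S" "v \<in> S"
  shows "(even k \<longrightarrow> marg l a S v \<le> approx l a k S v) \<and>
         (odd k \<longrightarrow> approx l a k S v \<le> marg l a S v)"
  using assms
proof (induction k arbitrary: S v)
  case 0
  have "marg l a S v \<le> a"
    unfolding marg_rec[OF 0] using 0 by (intro Min_le) auto
  then show ?case by simp
next
  case (Suc k)
  have IH: "(even k \<longrightarrow> marg l a (S - {v}) i \<le> approx l a k (S - {v}) i) \<and>
            (odd k \<longrightarrow> approx l a k (S - {v}) i \<le> marg l a (S - {v}) i)"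
    if "i \<in> S - {v}" for i
    using Suc.IH[of "S - {v}" i] Suc.prems that by blast
  have fin: "finite (S - {v})" using Suc.prems by simp
  show ?case
  proof (intro conjI impI)
    assume "even (Suc k)"
    then show "marg l a S v \<le> approx l a (Suc k) S v"
      unfolding approx.simps marg_rec[OF Suc.prems]
      by (intro Min_insert_diff_antimono fin) (simp add: IH)
  next
    assume "odd (Suc k)"
    then show "approx l a (Suc k) S v \<le> marg l a S v"
      unfolding approx.simps marg_rec[OF Suc.prems]
      by (intro Min_insert_diff_antimono fin) (simp add: IH)
  qed
qed

text \<open>A lower bound on a minimum splits into one condition per edge at \<open>v\<close>, with
  thresholds that read no edge at \<open>v\<close>. This is why conditional tails become
  products.\<close>

lemma approx_Suc_ge_iff:
  "finite S \<Longrightarrow> x \<le> approx l a (Suc k) S v \<longleftrightarrow>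
     x \<le> a \<and> (\<forall>i\<in>S - {v}. x + approx l a k (S - {v}) i \<le> l (uedge v i))"
  by (simp add: Min_ge_iff) (auto simp: algebra_simps)

section \<open>Range, locality and stability of the truncations\<close>

lemma approx_le: "finite S \<Longrightarrow> approx l a k S v \<le> a"
  by (cases k) auto

text \<open>The subtracted values are at most \<open>a\<close> and lengths are nonnegative. So all
  truncations live in \<open>[-a, a]\<close>, the interval that carries
  \<open>Icc_measure a\<close>.\<close>

lemma approx_ge:
  assumes "finite S" "a \<ge> 0" "\<And>e. l e \<ge> 0"
  shows "- a \<le> approx l a k S v"
proof (cases k)
  case (Suc k')
  have "approx l a k' (S - {v}) i \<le> l (uedge v i) + a" for i
    using approx_le[of "S - {v}" l a k' i] assms(1) assms(3)[of "uedge v i"] by simp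
  then show ?thesis unfolding Suc using assms
    by (subst approx_Suc_ge_iff) (auto simp: algebra_simps)
qed (use assms in simp)

text \<open>Only edges with both ends in \<open>insert v S\<close> are read; independence from the
  edges at other vertices rests on this.\<close>

lemma approx_cong:
  assumes "finite S" "\<And>i j. i \<in> insert v S \<Longrightarrow> j \<in> insert v S \<Longrightarrow> i \<noteq> j \<Longrightarrow> l (uedge i j) = l' (uedge i j)"
  shows "approx l a k S v = approx l' a k S v"
  using assms
proof (induction k arbitrary: S v)
  case (Suc k)
  have "l (uedge v i) - approx l a k (S - {v}) i = l' (uedge v i) - approx l' a k (S - {v}) i"
    if "i \<in> S - {v}" for i
  proof -
    have "approx l a k (S - {v}) i = approx l' a k (S - {v}) i"
      using Suc.prems that by (intro Suc.IH) auto
    moreover have "l (uedge v i) = l' (uedge v i)"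
      using that by (intro Suc.prems(2)) auto
    ultimately show ?thesis by simp
  qed
  then show ?case by (auto intro!: arg_cong[where f = Min] image_cong)
qed simp

text \<open>An edge of length at least \<open>2 * a\<close> is never better than leaving both its ends unmatched.\<close>

lemma approx_remove_vertex:
  assumes "finite S" "v \<noteq> w" "2 * a \<le> l (uedge v w)"
    and "\<And>i. i \<in> S - {v, w} \<Longrightarrow> l (uedge v i) < 2 * a \<Longrightarrow>
               approx l a k (S - {v}) i = approx l a k (S - {w} - {v}) i"
  shows "approx l a (Suc k) S v = approx l a (Suc k) (S - {w}) v"
proof -
  have iff: "x \<le> approx l a (Suc k) S v \<longleftrightarrow> x \<le> approx l a (Suc k) (S - {w}) v" for x
  proof -
    have "(\<forall>i\<in>S - {v}. x + approx l a k (S - {v}) i \<le> l (uedge v i)) \<longleftrightarrow>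
          (\<forall>i\<in>S - {w} - {v}. x + approx l a k (S - {w} - {v}) i \<le> l (uedge v i))"
      if x: "x \<le> a"
    proof -
      \<comment> \<open>Both left sides are at most \<open>2 * a\<close>, so a long edge imposes no
        condition, whatever the value at its far end.\<close>
      have *: "x + approx l a k (S - {v}) i \<le> l (uedge v i)
        \<and> x + approx l a k (S - {w} - {v}) i \<le> l (uedge v i)" if "2 * a \<le> l (uedge v i)" for i
        using approx_le[of "S - {v}" l a k i] approx_le[of "S - {w} - {v}" l a k i] assms(1) x that
        by auto
      show ?thesis
      proof (rule iffI; rule ballI)
        fix i assume 1: "\<forall>i\<in>S - {v}. x + approx l a k (S - {v}) i \<le> l (uedge v i)"
          and i: "i \<in> S - {w} - {v}"
        show "x + approx l a k (S - {w} - {v}) i \<le> l (uedge v i)"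
        proof (cases "2 * a \<le> l (uedge v i)")
          case True then show ?thesis using * by blast
        next
          case False
          then have "approx l a k (S - {v}) i = approx l a k (S - {w} - {v}) i"
            using i by (intro assms(4)) auto
          moreover have "x + approx l a k (S - {v}) i \<le> l (uedge v i)" using 1 i by blast
          ultimately show ?thesis by metis
        qed
      next
        fix i assume 1: "\<forall>i\<in>S - {w} - {v}. x + approx l a k (S - {w} - {v}) i \<le> l (uedge v i)"
          and i: "i \<in> S - {v}"
        show "x + approx l a k (S - {v}) i \<le> l (uedge v i)"
        proof (cases "2 * a \<le> l (uedge v i)")
          case True then show ?thesis using * by blast
        next
          case False
          then have "i \<noteq> w" using assms(3) by blast
          then have "approx l a k (S - {v}) i = approx l a k (S - {w} - {v}) i"
            using i False by (intro assms(4)) auto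
          moreover have "x + approx l a k (S - {w} - {v}) i \<le> l (uedge v i)"
            using 1 i \<open>i \<noteq> w\<close> by blast
          ultimately show ?thesis by metis
        qed
      qed
    qed
    then show ?thesis
      using assms(1) by (simp only: approx_Suc_ge_iff finite_Diff) blast
  qed
  show ?thesis by (rule antisym) (use iff in blast)+
qed

text \<open>If \<open>v\<close> is uncovered, deleting it saves exactly \<open>a\<close> on
  \<open>M\<close>. Conversely, when \<open>marg\<close> reaches \<open>a\<close>, an optimum of
  \<open>S - {v}\<close> with \<open>v\<close> left free is optimal for \<open>S\<close>, hence
  equal to \<open>M\<close> by uniqueness.\<close>

lemma uncovered_iff_marg:
  assumes "finite S" "v \<in> S"
    and M: "matching_in S M" "matching_cost l a S M = opt l a S"
    and unique: "\<And>M'. matching_in S M' \<Longrightarrow> matching_cost l a S M' = opt l a S \<Longrightarrow> M' = M"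
  shows "v \<notin> \<Union>(verts ` M) \<longleftrightarrow> a \<le> marg l a S v"
proof
  assume v: "v \<notin> \<Union>(verts ` M)"
  then have "matching_in (S - {v}) M"
    using verts_matching_in[OF M(1)] by (intro matching_in_restrict[OF M(1)]) auto
  then have "opt l a (S - {v}) \<le> matching_cost l a (S - {v}) M"
    using assms(1) by (intro opt_le) auto
  then show "a \<le> marg l a S v"
    using matching_cost_add_vertex[OF assms(1,2) v, of l a] M(2) by (simp add: marg_def)
next
  assume a: "a \<le> marg l a S v"
  obtain M' where M': "matching_in (S - {v}) M'"
    "opt l a (S - {v}) = matching_cost l a (S - {v}) M'"
    using assms(1) opt_attained[of "S - {v}"] by auto
  have v: "v \<notin> \<Union>(verts ` M')" using verts_matching_in[OF M'(1)] by auto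
  have "matching_in S M'" using M'(1) by (rule matching_in_mono) auto
  moreover from this have "matching_cost l a S M' = opt l a S"
    using matching_cost_add_vertex[OF assms(1,2) v, of l a] M'(2) a
      opt_le[OF assms(1), of M' l a] by (simp add: marg_def)
  ultimately show "v \<notin> \<Union>(verts ` M)" using unique v by metis
qed

subsection \<open>Limiting tail operator\<close>

text \<open>The derivative of \<open>max 0 s powr d\<close>, which to first order is
  \<open>n\<close> times the probability that a given edge is shorter than \<open>s\<close>. For
  \<open>d = 1\<close> it jumps at \<open>0\<close>.\<close>

definition edge_kernel :: "real \<Rightarrow> real \<Rightarrow> real" where
  "edge_kernel d s = (if 0 < s then d * s powr (d - 1) else 0)"

text \<open>Lebesgue measure on the range of the truncations; being finite, it makes bounded
  measurable functions integrable.\<close>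

definition Icc_measure :: "real \<Rightarrow> real measure" where
  "Icc_measure a = restrict_space lborel {- a..a}"

text \<open>If lengths form a Poisson process with intensity \<open>edge_kernel d\<close> and carry independent
  marks in \<open>[-a, a]\<close> with tail \<open>f\<close>, then the least difference of a length and its mark has tail
  \<open>tail_op d a f\<close>, at arguments up to \<open>a\<close>.\<close>

definition tail_op :: "real \<Rightarrow> real \<Rightarrow> (real \<Rightarrow> real) \<Rightarrow> real \<Rightarrow> real" where
  "tail_op d a f x = exp (- (\<integral>t. edge_kernel d (x + t) * f t \<partial>Icc_measure a))"

text \<open>The start is the tail of the constant \<open>a\<close>, at arguments up to
  \<open>a\<close>. Beyond \<open>a\<close> the iterates simply continue the same formula instead of
  dropping to \<open>0\<close>; the difference quotients in \<open>tail_op_defect\<close> look past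
  \<open>a\<close>.\<close>

primrec limit_tail :: "real \<Rightarrow> real \<Rightarrow> nat \<Rightarrow> real \<Rightarrow> real" where
  "limit_tail d a 0 = (\<lambda>_. 1)"
| "limit_tail d a (Suc k) = tail_op d a (limit_tail d a k)"

text \<open>Here \<open>a\<close> is a parameter and not tied to one \<open>\<theta>\<close>: the
  convergence of the free fraction is needed at every smaller parameter as well.\<close>

locale diluted =
  fixes d a :: real
  assumes d_ge_1: "1 \<le> d" and a_pos: "0 < a"
begin

section \<open>The kernel and integration over \<open>[-a, a]\<close>\<close>

lemma edge_kernel_nonneg: "0 \<le> edge_kernel d s"
  using d_ge_1 by (simp add: edge_kernel_def)

lemma edge_kernel_mono: "s \<le> t \<Longrightarrow> edge_kernel d s \<le> edge_kernel d t"
  using d_ge_1 by (auto simp: edge_kernel_def intro!: mult_left_mono powr_mono2)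

lemma edge_kernel_nonpos: "s \<le> 0 \<Longrightarrow> edge_kernel d s = 0"
  by (simp add: edge_kernel_def)

lemma edge_kernel_measurable [measurable]: "edge_kernel d \<in> borel_measurable borel"
  unfolding edge_kernel_def by measurable

lemma space_Icc_measure [simp]: "space (Icc_measure a) = {- a..a}"
  by (simp add: Icc_measure_def space_restrict_space)

lemma ident_measurable_Icc [measurable]: "(\<lambda>t. t) \<in> borel_measurable (Icc_measure a)"
  unfolding Icc_measure_def by (intro measurable_restrict_space1) simp

lemma measurable_Icc:
  assumes [measurable]: "f \<in> borel_measurable borel"
  shows "f \<in> borel_measurable (Icc_measure a)"
  by measurable

lemma measure_Icc: "measure (Icc_measure a) {- a..a} = 2 * a"
  using a_pos by (simp add: Icc_measure_def measure_restrict_space)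

sublocale Icc: finite_measure "Icc_measure a"
  by standard (simp add: Icc_measure_def emeasure_restrict_space emeasure_lborel_Icc_eq)

lemma integrable_Icc:
  fixes f :: "real \<Rightarrow> real"
  assumes "f \<in> borel_measurable (Icc_measure a)" "\<And>t. t \<in> {- a..a} \<Longrightarrow> \<bar>f t\<bar> \<le> B"
  shows "integrable (Icc_measure a) f"
  using assms by (intro Icc.integrable_const_bound[where B = B]) auto

lemma integral_Icc_const: "(\<integral>t. c \<partial>Icc_measure a) = 2 * a * (c::real)"
  using measure_Icc by simp

lemma integral_Icc_mono:
  fixes f g :: "real \<Rightarrow> real"
  assumes "integrable (Icc_measure a) f" "integrable (Icc_measure a) g"
    and "\<And>t. t \<in> {- a..a} \<Longrightarrow> f t \<le> g t"
  shows "(\<integral>t. f t \<partial>Icc_measure a) \<le> (\<integral>t. g t \<partial>Icc_measure a)"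
  using assms by (intro integral_mono) auto

lemma integral_Icc_abs_le:
  fixes f :: "real \<Rightarrow> real"
  assumes "\<And>t. t \<in> {- a..a} \<Longrightarrow> \<bar>f t\<bar> \<le> B"
  shows "\<bar>\<integral>t. f t \<partial>Icc_measure a\<bar> \<le> 2 * a * B"
proof (cases "integrable (Icc_measure a) f")
  case True
  have "\<bar>\<integral>t. f t \<partial>Icc_measure a\<bar> \<le> (\<integral>t. \<bar>f t\<bar> \<partial>Icc_measure a)"
    by (rule integral_abs_bound)
  also have "\<dots> \<le> (\<integral>t. B \<partial>Icc_measure a)"
    using assms True by (intro integral_Icc_mono) auto
  finally show ?thesis unfolding integral_Icc_const .
next
  case False
  have "0 \<le> B" using assms[of 0] a_pos by auto
  then show ?thesis using False a_pos by (simp add: not_integrable_integral_eq)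
qed

text \<open>Bridge to the gauge integral, in which intervals are shifted and split and the
  fundamental theorem is applied.\<close>

lemma integral_Icc_eq_HK:
  fixes f :: "real \<Rightarrow> real"
  assumes [measurable]: "f \<in> borel_measurable borel"
    and "\<And>t. t \<in> {u..v} \<Longrightarrow> \<bar>f t\<bar> \<le> B"
  shows "f integrable_on {u..v}"
    and "u = - a \<Longrightarrow> v = a \<Longrightarrow> (\<integral>t. f t \<partial>Icc_measure a) = integral {u..v} f"
proof -
  have *: "set_integrable lborel {u..v} f"
    unfolding set_integrable_def
    by (rule integrableI_bounded_set_indicator[where B = B]) (auto intro!: AE_I2 assms(2) simp: emeasure_lborel_Icc_eq)
  show "f integrable_on {u..v}" by (rule set_borel_integral_eq_integral[OF *])
  assume "u = - a" "v = a"
  then show "(\<integral>t. f t \<partial>Icc_measure a) = integral {u..v} f"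
    using set_borel_integral_eq_integral(2)[OF *]
    by (simp add: Icc_measure_def integral_restrict_space set_lebesgue_integral_def)
qed

text \<open>The intervals \<open>[-a + h, a + h]\<close> and \<open>[-a, a]\<close> overlap, so only
  the two end pieces survive: a discrete fundamental theorem. As \<open>h \<le> 1\<close>, arguments
  stay below \<open>a + 1\<close>.\<close>

lemma integral_Icc_shift:
  fixes f :: "real \<Rightarrow> real"
  assumes [measurable]: "f \<in> borel_measurable borel"
    and B: "\<And>t. t \<le> a + 1 \<Longrightarrow> \<bar>f t\<bar> \<le> B" and h: "0 < h" "h \<le> 1"
  shows "(\<integral>t. f (t + h) \<partial>Icc_measure a) - (\<integral>t. f t \<partial>Icc_measure a) =
     integral {a..a + h} f - integral {- a..- a + h} f"
proof -
  have int: "f integrable_on {u..v}" if "v \<le> a + 1" for u v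
    using that by (intro integral_Icc_eq_HK[where B = B] B) auto
  have "(\<integral>t. f (t + h) \<partial>Icc_measure a) = integral {- a..a} (\<lambda>t. f (t + h))"
    using h by (intro integral_Icc_eq_HK(2)[where B = B] B) auto
  also have "\<dots> = integral {- a..a} (f \<circ> (+) h)"
    by (simp add: o_def add.commute)
  also have "\<dots> = integral {- a + h..a + h} f" by (rule integral_shift_Icc_real)
  finally have 1: "(\<integral>t. f (t + h) \<partial>Icc_measure a) = integral {- a + h..a + h} f" .
  have 2: "(\<integral>t. f t \<partial>Icc_measure a) = integral {- a..a} f"
    by (intro integral_Icc_eq_HK(2)[where B = B] B) auto
  have 3: "integral {- a..- a + h} f + integral {- a + h..a + h} f = integral {- a..a + h} f"
    using h a_pos by (intro Henstock_Kurzweil_Integration.integral_combine int) auto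
  have 4: "integral {- a..a} f + integral {a..a + h} f = integral {- a..a + h} f"
    using h a_pos by (intro Henstock_Kurzweil_Integration.integral_combine int) auto
  show ?thesis using 1 2 3 4 by linarith
qed

text \<open>Integrating the kernel against the tail of a point mass at \<open>y\<close> restores the
  power \<open>(x + y) powr d\<close>. Summed over vertices this expresses the exponent of a
  conditional tail through the empirical tail.\<close>

lemma edge_kernel_integral:
  assumes x: "x \<in> {- a..a}" and y: "y \<in> {- a..a}"
  shows "(\<integral>t. edge_kernel d (x + t) * of_bool (t \<le> y) \<partial>Icc_measure a) = max 0 (x + y) powr d"
proof -
  have "(\<integral>t. edge_kernel d (x + t) * of_bool (t \<le> y) \<partial>Icc_measure a) =
        integral {- a..a} (\<lambda>t. edge_kernel d (x + t) * of_bool (t \<le> y))"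
  proof (rule integral_Icc_eq_HK(2)[where B = "edge_kernel d (2 * a)"])
    fix t assume "t \<in> {- a..a}"
    then show "\<bar>edge_kernel d (x + t) * of_bool (t \<le> y)\<bar> \<le> edge_kernel d (2 * a)"
      using x edge_kernel_mono[of "x + t" "2 * a"] edge_kernel_nonneg by (auto simp: of_bool_def)
  qed auto
  also have "\<dots> = max 0 (x + y) powr d"
  proof (cases "0 < x + y")
    case False
    then have zero: "(\<lambda>t. edge_kernel d (x + t) * of_bool (t \<le> y)) = (\<lambda>_. 0)"
      by (auto simp: edge_kernel_def)
    show ?thesis unfolding zero using False by simp
  next
    case True
    \<comment> \<open>Differentiability is used in the interior only, since the kernel may jump at
      \<open>t = - x\<close>. Below \<open>- x\<close> it vanishes.\<close>
    have "((\<lambda>t. edge_kernel d (x + t)) has_integral ((x + y) powr d - (x + (- x)) powr d)) {- x..y}"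
    proof (rule fundamental_theorem_of_calculus_interior)
      show "- x \<le> y" using True by simp
      show "continuous_on {- x..y} (\<lambda>t. (x + t) powr d)"
        using d_ge_1 by (intro continuous_on_powr' continuous_intros) auto
      fix t assume t: "t \<in> {- x<..<y}"
      then have "((\<lambda>t. (x + t) powr d) has_real_derivative d * (x + t) powr (d - 1) * 1) (at t)"
        by (intro derivative_eq_intros | simp)+
      then show "((\<lambda>t. (x + t) powr d) has_vector_derivative edge_kernel d (x + t)) (at t)"
        using t by (simp add: edge_kernel_def has_real_derivative_iff_has_vector_derivative)
    qed
    then have *: "((\<lambda>t. edge_kernel d (x + t)) has_integral (x + y) powr d) {- x..y}"
      by simp
    have "((\<lambda>t. if t \<in> {- x..y} then edge_kernel d (x + t) else 0) has_integral (x + y) powr d) {- a..a}"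
      using * has_integral_restrict[of "{- x..y}" "{- a..a}" "\<lambda>t. edge_kernel d (x + t)"] x y by simp
    moreover have "(if t \<in> {- x..y} then edge_kernel d (x + t) else 0) = edge_kernel d (x + t) * of_bool (t \<le> y)" for t
      by (auto simp: edge_kernel_def)
    ultimately show ?thesis using True by (simp add: integral_unique)
  qed
  finally show ?thesis .
qed

section \<open>Order reversal and continuity of \<open>tail_op\<close>\<close>

lemma tail_op_measurable [measurable]:
  assumes [measurable]: "f \<in> borel_measurable borel"
  shows "tail_op d a f \<in> borel_measurable borel"
  unfolding tail_op_def by measurable

lemma integrable_edge_kernel:
  assumes [measurable]: "f \<in> borel_measurable borel" and f: "\<And>t. 0 \<le> f t" "\<And>t. f t \<le> 1"
  shows "integrable (Icc_measure a) (\<lambda>t. edge_kernel d (x + t) * f t)"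
proof (rule integrable_Icc)
  fix t assume "t \<in> {- a..a}"
  then have "edge_kernel d (x + t) * f t \<le> edge_kernel d (x + a) * 1"
    using f[of t] by (intro mult_mono edge_kernel_mono edge_kernel_nonneg) auto
  then show "\<bar>edge_kernel d (x + t) * f t\<bar> \<le> edge_kernel d (x + a)"
    using f[of t] edge_kernel_nonneg by simp
qed measurable

lemma tail_op_bounds:
  assumes "\<And>t. 0 \<le> f t"
  shows "0 \<le> tail_op d a f x" "tail_op d a f x \<le> 1"
  using assms edge_kernel_nonneg
  by (auto simp: tail_op_def intro!: Bochner_Integration.integral_nonneg)

lemma tail_op_antimono:
  assumes "f \<in> borel_measurable borel" "\<And>t. 0 \<le> f t" "\<And>t. f t \<le> 1"
    and "g \<in> borel_measurable borel" "\<And>t. 0 \<le> g t" "\<And>t. g t \<le> 1"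
    and "\<And>t. f t \<le> g t"
  shows "tail_op d a g x \<le> tail_op d a f x"
  using assms edge_kernel_nonneg
  by (auto simp: tail_op_def intro!: integral_Icc_mono integrable_edge_kernel mult_left_mono)

lemma limit_tail_measurable [measurable]: "limit_tail d a k \<in> borel_measurable borel"
  by (induction k) (auto intro: tail_op_measurable)

lemma limit_tail_bounds: "0 \<le> limit_tail d a k x" "limit_tail d a k x \<le> 1"
proof -
  have "0 \<le> limit_tail d a k x \<and> limit_tail d a k x \<le> 1"
    by (induction k arbitrary: x) (auto intro: tail_op_bounds)
  then show "0 \<le> limit_tail d a k x" "limit_tail d a k x \<le> 1" by auto
qed

text \<open>The start \<open>1\<close> is the largest possible tail, so the second iterate lies
  below it. Applying the order-reversing operator again and again makes even iterates decrease and
  odd ones increase.\<close>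

lemma limit_tail_alternating:
  "limit_tail d a (2 * j + 2) x \<le> limit_tail d a (2 * j) x \<and>
   limit_tail d a (2 * j + 1) x \<le> limit_tail d a (2 * j + 3) x"
proof (induction j arbitrary: x)
  case 0
  have *: "limit_tail d a 2 x \<le> limit_tail d a 0 x" for x
    using limit_tail_bounds(2)[of 2 x] by simp
  have "tail_op d a (limit_tail d a 0) x \<le> tail_op d a (limit_tail d a 2) x"
    by (intro tail_op_antimono limit_tail_bounds limit_tail_measurable *)
  then have "limit_tail d a (Suc 0) x \<le> limit_tail d a (Suc 2) x"
    by (simp only: limit_tail.simps)
  then show ?case using *[of x] by (simp add: numeral_eq_Suc)
next
  case (Suc j)
  have A: "limit_tail d a (2 * j + 4) x \<le> limit_tail d a (2 * j + 2) x" for x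
  proof -
    have "tail_op d a (limit_tail d a (2 * j + 3)) x \<le> tail_op d a (limit_tail d a (2 * j + 1)) x"
      using Suc.IH by (intro tail_op_antimono limit_tail_bounds limit_tail_measurable) auto
    then have "limit_tail d a (Suc (2 * j + 3)) x \<le> limit_tail d a (Suc (2 * j + 1)) x"
      by (simp only: limit_tail.simps)
    then show ?thesis by (simp add: numeral_eq_Suc)
  qed
  have "tail_op d a (limit_tail d a (2 * j + 2)) x \<le> tail_op d a (limit_tail d a (2 * j + 4)) x"
    by (intro tail_op_antimono limit_tail_bounds limit_tail_measurable A)
  then have "limit_tail d a (Suc (2 * j + 2)) x \<le> limit_tail d a (Suc (2 * j + 4)) x"
    by (simp only: limit_tail.simps)
  then show ?case using A[of x] by (simp add: numeral_eq_Suc)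
qed

lemma tail_op_tendsto:
  assumes "\<And>j. f j \<in> borel_measurable borel" "\<And>j t. 0 \<le> f j t" "\<And>j t. f j t \<le> 1"
    and "\<And>t. (\<lambda>j. f j t) \<longlonglongrightarrow> g t" "g \<in> borel_measurable borel"
  shows "(\<lambda>j. tail_op d a (f j) x) \<longlonglongrightarrow> tail_op d a g x"
  unfolding tail_op_def
proof (intro tendsto_exp tendsto_minus
    integral_dominated_convergence[where w = "\<lambda>_. edge_kernel d (x + a)"])
  note [measurable] = assms(1,5)
  show "(\<lambda>t. edge_kernel d (x + t) * g t) \<in> borel_measurable (Icc_measure a)" by measurable
  show "(\<lambda>t. edge_kernel d (x + t) * f j t) \<in> borel_measurable (Icc_measure a)" for j by measurable
  show "integrable (Icc_measure a) (\<lambda>_. edge_kernel d (x + a))" by simp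
  show "AE t in Icc_measure a. (\<lambda>j. edge_kernel d (x + t) * f j t) \<longlonglongrightarrow> edge_kernel d (x + t) * g t"
    by (intro AE_I2 tendsto_intros assms)
  show "AE t in Icc_measure a. norm (edge_kernel d (x + t) * f j t) \<le> edge_kernel d (x + a)" for j
  proof (rule AE_I2)
    fix t assume "t \<in> space (Icc_measure a)"
    then have "edge_kernel d (x + t) * f j t \<le> edge_kernel d (x + a) * 1"
      using assms(2,3)[of j t] by (intro mult_mono edge_kernel_mono edge_kernel_nonneg) auto
    then show "norm (edge_kernel d (x + t) * f j t) \<le> edge_kernel d (x + a)"
      using assms(2)[of j t] edge_kernel_nonneg by simp
  qed
qed

text \<open>The kernel may jump, yet its integral is Lipschitz. Monotonicity makes the kernel
  increments nonnegative, so \<open>q\<close> may be replaced by \<open>1\<close>; the shift then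
  leaves at most the end piece \<open>[a, a + h]\<close>, where
  \<open>x + t \<le> 2 * a + 1\<close>.\<close>

lemma edge_kernel_integral_increment:
  assumes [measurable]: "q \<in> borel_measurable borel"
    and q: "\<And>t. 0 \<le> q t" "\<And>t. q t \<le> 1"
    and x: "x \<in> {- a..a}" and h: "0 < h" "h \<le> 1"
  defines "A \<equiv> \<lambda>x. \<integral>t. edge_kernel d (x + t) * q t \<partial>Icc_measure a"
  shows "0 \<le> A (x + h) - A x" "A (x + h) - A x \<le> h * edge_kernel d (2 * a + 1)"
proof -
  have diff: "A (x + h) - A x = (\<integral>t. (edge_kernel d (x + h + t) - edge_kernel d (x + t)) * q t \<partial>Icc_measure a)"
    unfolding A_def using integrable_edge_kernel[of q x] integrable_edge_kernel[of q "x + h"] q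
    by (subst Bochner_Integration.integral_diff[symmetric]) (simp_all add: left_diff_distrib)
  have pos: "0 \<le> edge_kernel d (x + h + t) - edge_kernel d (x + t)" for t
    using edge_kernel_mono[of "x + t" "x + h + t"] h by simp
  show "0 \<le> A (x + h) - A x"
    unfolding diff using pos q by (intro Bochner_Integration.integral_nonneg mult_nonneg_nonneg)
  have i: "integrable (Icc_measure a) (\<lambda>t. edge_kernel d (y + t))" for y
    using integrable_edge_kernel[of "\<lambda>_. 1" y] by simp
  have i': "integrable (Icc_measure a) (\<lambda>t. edge_kernel d (y + t) * q t)" for y
    using integrable_edge_kernel[of q y] q by simp
  have i'': "integrable (Icc_measure a) (\<lambda>t. (edge_kernel d (x + h + t) - edge_kernel d (x + t)) * q t)"
    using Bochner_Integration.integrable_diff[OF i'[of "x + h"] i'[of x]]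
    by (simp add: left_diff_distrib)
  have "A (x + h) - A x \<le> (\<integral>t. edge_kernel d (x + h + t) - edge_kernel d (x + t) \<partial>Icc_measure a)"
    unfolding diff using i'' i pos q by (intro integral_Icc_mono) (auto intro!: mult_left_le)
  also have "\<dots> = (\<integral>t. edge_kernel d (x + (t + h)) \<partial>Icc_measure a) - (\<integral>t. edge_kernel d (x + t) \<partial>Icc_measure a)"
    using i[of "x + h"] i[of x] by (subst Bochner_Integration.integral_diff) (auto simp: algebra_simps)
  also have "\<dots> = integral {a..a + h} (\<lambda>t. edge_kernel d (x + t)) - integral {- a..- a + h} (\<lambda>t. edge_kernel d (x + t))"
    using edge_kernel_nonneg x h
    by (intro integral_Icc_shift[where B = "edge_kernel d (2 * a + 1)"]) (auto intro!: edge_kernel_mono)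
  also have "\<dots> \<le> integral {a..a + h} (\<lambda>t. edge_kernel d (x + t))"
  proof -
    have "0 \<le> integral {- a..- a + h} (\<lambda>t. edge_kernel d (x + t))"
      using edge_kernel_nonneg by (intro integral_nonneg integral_Icc_eq_HK(1)[where B = "edge_kernel d (2 * a + 1)"])
        (use x h a_pos in \<open>auto intro!: edge_kernel_mono\<close>)
    then show ?thesis by simp
  qed
  also have "\<dots> \<le> integral {a..a + h} (\<lambda>t. edge_kernel d (2 * a + 1))"
    using edge_kernel_nonneg x h
    by (intro integral_le integral_Icc_eq_HK(1)[where B = "edge_kernel d (2 * a + 1)"])
       (auto intro!: edge_kernel_mono)
  also have "\<dots> = h * edge_kernel d (2 * a + 1)" using h by simp
  finally show "A (x + h) - A x \<le> h * edge_kernel d (2 * a + 1)" .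
qed

text \<open>All kernel arguments are nonpositive at \<open>- a\<close>. This is the boundary value
  in the symmetry argument, and it later lets a joint tail at \<open>- a\<close> reduce to the tail
  of a single vertex.\<close>

lemma tail_op_at_minus_a: "tail_op d a f (- a) = 1"
proof -
  have "(\<integral>t. edge_kernel d (- a + t) * f t \<partial>Icc_measure a) = (\<integral>t. 0 \<partial>Icc_measure a)"
    by (intro Bochner_Integration.integral_cong) (auto simp: edge_kernel_nonpos)
  then show ?thesis by (simp add: tail_op_def)
qed

section \<open>The symmetry that determines the value at \<open>a\<close>\<close>

lemma exp_minus_quadratic:
  fixes y :: real assumes "0 \<le> y"
  shows "\<bar>(1 - exp (- y)) - y\<bar> \<le> y\<^sup>2"
proof -
  have "1 - exp (- y) \<le> y" using exp_ge_add_one_self[of "- y"] by simp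
  moreover have "y - y\<^sup>2 \<le> 1 - exp (- y)"
  proof (cases "y \<le> 1")
    case True
    have "exp (- y) \<le> 1 - y + y\<^sup>2"
    proof -
      have "1 + y \<le> exp y" by (rule exp_ge_add_one_self)
      then have "exp (- y) \<le> 1 / (1 + y)" using assms by (simp add: exp_minus field_simps)
      also have "\<dots> \<le> 1 - y + y\<^sup>2"
        using assms by (simp add: field_simps power2_eq_square)
      finally show ?thesis .
    qed
    then show ?thesis by simp
  next
    case False
    then have "y - y\<^sup>2 \<le> 0" by (simp add: power2_eq_square)
    moreover have "exp (- y) \<le> 1" using assms by simp
    ultimately show ?thesis by linarith
  qed
  ultimately show ?thesis by (simp add: abs_le_iff)
qed

text \<open>Discrete form of integrating \<open>- p' = p * A'\<close>. Pointwise
  \<open>p x - p (x + h)\<close> is \<open>p x * (A (x + h) - A x)\<close> up to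
  \<open>(h * L)\<^sup>2\<close>, which integrates to the term with
  \<open>2 * a * L\<^sup>2\<close>. On the other side the shift leaves end pieces close to
  \<open>h\<close> and \<open>h * p a\<close>; their two errors give \<open>2 * L\<close>.\<close>

lemma tail_op_defect:
  assumes [measurable]: "q \<in> borel_measurable borel"
    and q: "\<And>t. 0 \<le> q t" "\<And>t. q t \<le> 1"
    and h: "0 < h" "h \<le> 1"
  defines "A \<equiv> \<lambda>x. \<integral>t. edge_kernel d (x + t) * q t \<partial>Icc_measure a"
    and "p \<equiv> tail_op d a q" and "L \<equiv> edge_kernel d (2 * a + 1)"
  shows "\<bar>h * (1 - p a) - (\<integral>x. p x * (A (x + h) - A x) \<partial>Icc_measure a)\<bar> \<le> (2 * L + 2 * a * L\<^sup>2) * h\<^sup>2"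
proof -
  have pA: "p x = exp (- A x)" for x by (simp add: p_def tail_op_def A_def)
  have [measurable]: "p \<in> borel_measurable borel" by (simp add: p_def)
  have [measurable]: "A \<in> borel_measurable borel" unfolding A_def by measurable
  have p01: "0 \<le> p x" "p x \<le> 1" for x
    using tail_op_bounds[of q x] q by (auto simp: p_def)
  have L: "0 \<le> L" by (simp add: L_def edge_kernel_nonneg)
  have inc: "0 \<le> A (x + s) - A x" "A (x + s) - A x \<le> s * L"
    if "x \<in> {- a..a}" "0 < s" "s \<le> 1" for x s
    using edge_kernel_integral_increment[OF assms(1) q that] by (auto simp: A_def L_def)
  have i1: "integrable (Icc_measure a) (\<lambda>x. p x)" and i2: "integrable (Icc_measure a) (\<lambda>x. p (x + h))"
    using p01 by (auto intro!: integrable_Icc[where B = 1])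
  have i3: "integrable (Icc_measure a) (\<lambda>x. p x * (A (x + h) - A x))"
  proof (rule integrable_Icc[where B = "h * L"])
    fix t assume t: "t \<in> {- a..a}"
    have "p t * (A (t + h) - A t) \<le> 1 * (h * L)"
      using inc[OF t h] p01 L h by (intro mult_mono) auto
    then show "\<bar>p t * (A (t + h) - A t)\<bar> \<le> h * L" using inc[OF t h] p01 by simp
  qed measurable
  have "\<bar>\<integral>x. (p x - p (x + h)) - p x * (A (x + h) - A x) \<partial>Icc_measure a\<bar> \<le> 2 * a * (h * L)\<^sup>2"
  proof (rule integral_Icc_abs_le)
    fix x assume x: "x \<in> {- a..a}"
    let ?y = "A (x + h) - A x"
    have "(p x - p (x + h)) - p x * ?y = p x * ((1 - exp (- ?y)) - ?y)"
      by (simp add: pA algebra_simps exp_add[symmetric] exp_diff exp_minus field_simps)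
    then have "\<bar>(p x - p (x + h)) - p x * ?y\<bar> = p x * \<bar>(1 - exp (- ?y)) - ?y\<bar>"
      using p01 by (simp add: abs_mult)
    also have "\<dots> \<le> 1 * ?y\<^sup>2"
      using exp_minus_quadratic[of ?y] inc[OF x h] p01[of x] by (intro mult_mono) auto
    also have "\<dots> \<le> (h * L)\<^sup>2" using inc[OF x h] by (simp add: power_mono)
    finally show "\<bar>(p x - p (x + h)) - p x * ?y\<bar> \<le> (h * L)\<^sup>2" .
  qed
  then have 1: "\<bar>((\<integral>x. p x \<partial>Icc_measure a) - (\<integral>x. p (x + h) \<partial>Icc_measure a))
       - (\<integral>x. p x * (A (x + h) - A x) \<partial>Icc_measure a)\<bar> \<le> 2 * a * (h * L)\<^sup>2"
    using i1 i2 i3 by (simp add: Bochner_Integration.integral_diff)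
  have 2: "(\<integral>t. p (t + h) \<partial>Icc_measure a) - (\<integral>t. p t \<partial>Icc_measure a) =
     integral {a..a + h} p - integral {- a..- a + h} p"
    using p01 h by (intro integral_Icc_shift[where B = 1]) auto
  \<comment> \<open>On an interval of length \<open>h\<close> the function \<open>p\<close> falls by
    at most \<open>h * L\<close>, so an end piece is \<open>h\<close> times its left value up to
    \<open>h * (h * L)\<close>.\<close>
  have near: "\<bar>integral {x..x + h} p - h * p x\<bar> \<le> h * (h * L)" if x: "x \<in> {- a..a}" for x
  proof -
    have pl: "p x - h * L \<le> p t \<and> p t \<le> p x" if t: "t \<in> {x..x + h}" for t
    proof (cases "t = x")
      case True then show ?thesis using L h by simp
    next
      case False
      define s where "s = t - x"
      have s: "0 < s" "s \<le> h" "t = x + s" using t False by (auto simp: s_def)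
      have y: "0 \<le> A t - A x" "A t - A x \<le> s * L" using inc[OF x s(1)] s h by auto
      have "s * L \<le> h * L" using s L by (intro mult_right_mono) auto
      moreover have "p t = p x * exp (- (A t - A x))" by (simp add: pA exp_add[symmetric])
      moreover have "1 - (A t - A x) \<le> exp (- (A t - A x))"
        using exp_ge_add_one_self[of "- (A t - A x)"] by linarith
      moreover have "p x * (1 - (A t - A x)) \<le> p x * exp (- (A t - A x))"
        using calculation(3) p01 by (intro mult_left_mono) auto
      moreover have "p x * (A t - A x) \<le> 1 * (A t - A x)"
        using p01[of x] y by (intro mult_right_mono) auto
      moreover have "p x * exp (- (A t - A x)) \<le> p x * 1"
        using p01[of x] y by (intro mult_left_mono) auto
      ultimately show ?thesis using y by (auto simp: algebra_simps)
    qed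
    have ip: "p integrable_on {x..x + h}"
      using p01 by (intro integral_Icc_eq_HK(1)[where B = 1]) auto
    have "integral {x..x + h} p \<le> integral {x..x + h} (\<lambda>_. p x)"
      using pl ip by (intro integral_le) auto
    moreover have "integral {x..x + h} (\<lambda>_. p x - h * L) \<le> integral {x..x + h} p"
      using pl ip by (intro integral_le) auto
    ultimately show ?thesis using h by (simp add: algebra_simps abs_le_iff)
  qed
  have "p (- a) = 1" by (simp add: p_def tail_op_at_minus_a)
  then have 3: "\<bar>integral {- a..- a + h} p - h\<bar> \<le> h * (h * L)" using near[of "- a"] a_pos by simp
  have 4: "\<bar>integral {a..a + h} p - h * p a\<bar> \<le> h * (h * L)" using near[of a] a_pos by simp
  have "\<bar>h * (1 - p a) - (\<integral>x. p x * (A (x + h) - A x) \<partial>Icc_measure a)\<bar>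
      \<le> 2 * a * (h * L)\<^sup>2 + h * (h * L) + h * (h * L)"
    using 1 2 3 4 unfolding right_diff_distrib by linarith
  also have "\<dots> = (2 * L + 2 * a * L\<^sup>2) * h\<^sup>2" by (simp add: algebra_simps power2_eq_square)
  finally show ?thesis .
qed

text \<open>The kernel depends on \<open>x\<close> and \<open>t\<close> only through
  \<open>x + h + t\<close>, so Fubini exchanges the roles of \<open>p\<close> and
  \<open>q\<close>.\<close>

lemma pairing_symmetric:
  assumes [measurable]: "p \<in> borel_measurable borel" "q \<in> borel_measurable borel"
    and p: "\<And>t. 0 \<le> p t" "\<And>t. p t \<le> 1" and q: "\<And>t. 0 \<le> q t" "\<And>t. q t \<le> 1"
  shows "(\<integral>x. p x * (\<integral>t. edge_kernel d (x + h + t) * q t \<partial>Icc_measure a) \<partial>Icc_measure a) =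
         (\<integral>x. q x * (\<integral>t. edge_kernel d (x + h + t) * p t \<partial>Icc_measure a) \<partial>Icc_measure a)"
proof -
  interpret P: pair_sigma_finite "Icc_measure a" "Icc_measure a" ..
  interpret PF: finite_measure "Icc_measure a \<Otimes>\<^sub>M Icc_measure a"
    by (rule finite_measure_pair_measure) unfold_locales
  have "integrable (Icc_measure a \<Otimes>\<^sub>M Icc_measure a) (\<lambda>(x, t). p x * (edge_kernel d (x + h + t) * q t))"
  proof (rule PF.integrable_const_bound[where B = "edge_kernel d (a + h + a)"])
    show "AE z in Icc_measure a \<Otimes>\<^sub>M Icc_measure a.
        norm (case z of (x, t) \<Rightarrow> p x * (edge_kernel d (x + h + t) * q t)) \<le> edge_kernel d (a + h + a)"
    proof (rule AE_I2)
      fix z assume "z \<in> space (Icc_measure a \<Otimes>\<^sub>M Icc_measure a)"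
      then obtain x t where z: "z = (x, t)" "- a \<le> x" "x \<le> a" "- a \<le> t" "t \<le> a"
        by (auto simp: space_pair_measure)
      then have "edge_kernel d (x + h + t) * q t \<le> edge_kernel d (a + h + a) * 1"
        using q by (intro mult_mono edge_kernel_mono edge_kernel_nonneg) auto
      moreover have "p x * (edge_kernel d (x + h + t) * q t) \<le> 1 * (edge_kernel d (x + h + t) * q t)"
        using p q edge_kernel_nonneg by (intro mult_right_mono) auto
      ultimately show "norm (case z of (x, t) \<Rightarrow> p x * (edge_kernel d (x + h + t) * q t)) \<le> edge_kernel d (a + h + a)"
        using p q edge_kernel_nonneg by (simp add: abs_mult z(1))
    qed
  qed measurable
  then have "(\<integral>t. (\<integral>x. p x * (edge_kernel d (x + h + t) * q t) \<partial>Icc_measure a) \<partial>Icc_measure a) =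
        (\<integral>x. (\<integral>t. p x * (edge_kernel d (x + h + t) * q t) \<partial>Icc_measure a) \<partial>Icc_measure a)"
    by (rule P.Fubini_integral)
  also have "(\<lambda>t. \<integral>x. p x * (edge_kernel d (x + h + t) * q t) \<partial>Icc_measure a) =
        (\<lambda>t. q t * (\<integral>x. edge_kernel d (t + h + x) * p x \<partial>Icc_measure a))"
    by (intro ext, subst integral_mult_right_zero[symmetric]) (simp add: algebra_simps)
  also have "(\<lambda>x. \<integral>t. p x * (edge_kernel d (x + h + t) * q t) \<partial>Icc_measure a) =
        (\<lambda>x. p x * (\<integral>t. edge_kernel d (x + h + t) * q t \<partial>Icc_measure a))"
    by simp
  finally show ?thesis by simp
qed

text \<open>Integrating \<open>- p' = p \<cdot> A'\<close> over \<open>[-a, a]\<close>, with \<open>A'\<close> a symmetric kernel operator applied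
  to \<open>q\<close>, gives the same value for \<open>p\<close> and \<open>q\<close>. Difference quotients replace the derivatives,
  since the kernel is not differentiable at \<open>0\<close> for small \<open>d\<close>.\<close>

lemma tail_op_cycle_at_a:
  assumes mp [measurable]: "p \<in> borel_measurable borel" and mq [measurable]: "q \<in> borel_measurable borel"
    and p: "\<And>t. 0 \<le> p t" "\<And>t. p t \<le> 1" and q: "\<And>t. 0 \<le> q t" "\<And>t. q t \<le> 1"
    and pq: "p = tail_op d a q" and qp: "q = tail_op d a p"
  shows "p a = q a"
proof -
  define A where "A = (\<lambda>x. \<integral>t. edge_kernel d (x + t) * q t \<partial>Icc_measure a)"
  define B where "B = (\<lambda>x. \<integral>t. edge_kernel d (x + t) * p t \<partial>Icc_measure a)"
  define L where "L = edge_kernel d (2 * a + 1)"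
  define C where "C = 2 * L + 2 * a * L\<^sup>2"
  have L: "0 \<le> L" by (simp add: L_def edge_kernel_nonneg)
  \<comment> \<open>The defects of \<open>p\<close> and \<open>q\<close> compare
    \<open>h * (1 - p a)\<close> and \<open>h * (1 - q a)\<close> with one and the same number, each
    up to \<open>C * h\<^sup>2\<close>. Subtract and divide by \<open>h\<close>; afterwards
    \<open>h\<close> tends to \<open>0\<close>.\<close>
  have bnd: "\<bar>p a - q a\<bar> \<le> 2 * C * h" if h: "0 < h" "h \<le> 1" for h
  proof -
    have int: "integrable (Icc_measure a)
        (\<lambda>x. f x * (\<integral>t. edge_kernel d (x + s + t) * g t \<partial>Icc_measure a))"
      if [measurable]: "f \<in> borel_measurable borel" "g \<in> borel_measurable borel"
        and f: "\<And>t. 0 \<le> f t" "\<And>t. f t \<le> 1" and g: "\<And>t. 0 \<le> g t" "\<And>t. g t \<le> 1" for f g :: "real \<Rightarrow> real" and s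
    proof (rule integrable_Icc[where B = "2 * a * edge_kernel d (2 * a + s)"])
      fix x assume x: "x \<in> {- a..a}"
      have *: "\<bar>\<integral>t. edge_kernel d (x + s + t) * g t \<partial>Icc_measure a\<bar> \<le> 2 * a * edge_kernel d (2 * a + s)"
      proof (rule integral_Icc_abs_le)
        fix t assume "t \<in> {- a..a}"
        then have "edge_kernel d (x + s + t) * g t \<le> edge_kernel d (2 * a + s) * 1"
          using x g by (intro mult_mono edge_kernel_mono edge_kernel_nonneg) auto
        then show "\<bar>edge_kernel d (x + s + t) * g t\<bar> \<le> edge_kernel d (2 * a + s)"
          using g edge_kernel_nonneg by simp
      qed
      have "\<bar>f x\<bar> * \<bar>\<integral>t. edge_kernel d (x + s + t) * g t \<partial>Icc_measure a\<bar> \<le> 1 * (2 * a * edge_kernel d (2 * a + s))"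
        using * f by (intro mult_mono) auto
      then show "\<bar>f x * (\<integral>t. edge_kernel d (x + s + t) * g t \<partial>Icc_measure a)\<bar> \<le> 2 * a * edge_kernel d (2 * a + s)"
        by (simp add: abs_mult)
    qed measurable
    \<comment> \<open>Symmetry at shift \<open>h\<close> minus symmetry at shift \<open>0\<close> is
      symmetry for the increments.\<close>
    have "(\<integral>x. p x * A (x + s) \<partial>Icc_measure a) = (\<integral>x. q x * B (x + s) \<partial>Icc_measure a)" for s
      unfolding A_def B_def by (rule pairing_symmetric[OF mp mq p q])
    from this[of h] this[of 0] have sym: "(\<integral>x. p x * (A (x + h) - A x) \<partial>Icc_measure a) =
          (\<integral>x. q x * (B (x + h) - B x) \<partial>Icc_measure a)"
      using int[OF mp mq p q, of h] int[OF mp mq p q, of 0] int[OF mq mp q p, of h] int[OF mq mp q p, of 0]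
      unfolding A_def B_def by (simp add: right_diff_distrib Bochner_Integration.integral_diff)
    have "\<bar>h * (1 - p a) - (\<integral>x. p x * (A (x + h) - A x) \<partial>Icc_measure a)\<bar> \<le> C * h\<^sup>2"
      using tail_op_defect[OF mq q h] unfolding A_def C_def L_def pq[symmetric] .
    moreover have "\<bar>h * (1 - q a) - (\<integral>x. q x * (B (x + h) - B x) \<partial>Icc_measure a)\<bar> \<le> C * h\<^sup>2"
      using tail_op_defect[OF mp p h] unfolding B_def C_def L_def qp[symmetric] .
    ultimately have "\<bar>h * (p a - q a)\<bar> \<le> 2 * (C * h\<^sup>2)"
      using sym by (auto simp: abs_le_iff right_diff_distrib)
    moreover have "\<bar>h * (p a - q a)\<bar> = h * \<bar>p a - q a\<bar>"
      using h by (simp only: abs_mult abs_of_pos)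
    moreover have "2 * (C * h\<^sup>2) = h * (2 * C * h)"
      by (simp add: power2_eq_square)
    ultimately have "h * \<bar>p a - q a\<bar> \<le> h * (2 * C * h)" by (simp only:)
    then show ?thesis using h by (simp only: mult_le_cancel_left_pos)
  qed
  have "((\<lambda>h. 2 * C * h) \<longlongrightarrow> 2 * C * 0) (at_right 0)" by (intro tendsto_intros)
  then have "\<bar>p a - q a\<bar> \<le> 2 * C * 0"
  proof (rule tendsto_lowerbound)
    show "\<forall>\<^sub>F h in at_right 0. \<bar>p a - q a\<bar> \<le> 2 * C * h"
      unfolding eventually_at_right_field using bnd by (intro exI[of _ 1]) auto
  qed simp
  then show ?thesis by simp
qed

theorem limit_tail_convergent: "convergent (\<lambda>k. limit_tail d a k a)"
proof -
  have even: "convergent (\<lambda>j. limit_tail d a (2 * j) x)" for x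
  proof -
    have "decseq (\<lambda>j. limit_tail d a (2 * j) x)"
      using limit_tail_alternating by (intro decseq_SucI) simp
    then show ?thesis
      using limit_tail_bounds decseq_convergent[of "\<lambda>j. limit_tail d a (2 * j) x" 0]
      by (metis convergent_def)
  qed
  have odd: "convergent (\<lambda>j. limit_tail d a (2 * j + 1) x)" for x
  proof -
    have "incseq (\<lambda>j. limit_tail d a (2 * j + 1) x)"
      using limit_tail_alternating[of _ x] by (intro incseq_SucI) (simp add: numeral_eq_Suc)
    then show ?thesis
      using limit_tail_bounds incseq_convergent[of "\<lambda>j. limit_tail d a (2 * j + 1) x" 1]
      by (metis convergent_def)
  qed
  define p where "p = (\<lambda>x. lim (\<lambda>j. limit_tail d a (2 * j) x))"
  define q where "q = (\<lambda>x. lim (\<lambda>j. limit_tail d a (2 * j + 1) x))"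
  have p: "(\<lambda>j. limit_tail d a (2 * j) x) \<longlonglongrightarrow> p x" for x
    using even by (simp add: p_def convergent_LIMSEQ_iff)
  have q: "(\<lambda>j. limit_tail d a (2 * j + 1) x) \<longlonglongrightarrow> q x" for x
    using odd by (simp add: q_def convergent_LIMSEQ_iff)
  have mp: "p \<in> borel_measurable borel"
    by (rule borel_measurable_LIMSEQ_real[OF p limit_tail_measurable])
  have mq: "q \<in> borel_measurable borel"
    by (rule borel_measurable_LIMSEQ_real[OF q limit_tail_measurable])
  have p01: "0 \<le> p x" "p x \<le> 1" for x
    using LIMSEQ_le_const[OF p] LIMSEQ_le_const2[OF p] limit_tail_bounds by blast+
  have q01: "0 \<le> q x" "q x \<le> 1" for x
    using LIMSEQ_le_const[OF q] LIMSEQ_le_const2[OF q] limit_tail_bounds by blast+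
  have "q x = tail_op d a p x" for x
  proof (rule LIMSEQ_unique[OF q])
    show "(\<lambda>j. limit_tail d a (2 * j + 1) x) \<longlonglongrightarrow> tail_op d a p x"
      using tail_op_tendsto[of "\<lambda>j. limit_tail d a (2 * j)" p x] p mp limit_tail_bounds by simp
  qed
  moreover have "p x = tail_op d a q x" for x
  proof (rule LIMSEQ_unique[OF LIMSEQ_Suc[OF p]])
    have "limit_tail d a (2 * Suc j) x = tail_op d a (limit_tail d a (2 * j + 1)) x" for j
      by simp
    then show "(\<lambda>j. limit_tail d a (2 * Suc j) x) \<longlonglongrightarrow> tail_op d a q x"
      using tail_op_tendsto[OF limit_tail_measurable limit_tail_bounds q mq]
      by (simp only:)
  qed
  ultimately have "p = tail_op d a q" "q = tail_op d a p" by blast+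
  then have "p a = q a" by (rule tail_op_cycle_at_a[OF mp mq p01 q01])
  \<comment> \<open>Even and odd iterates now share their limit at \<open>a\<close>; agreement
    elsewhere is not claimed.\<close>
  then have "(\<lambda>k. limit_tail d a k a) \<longlonglongrightarrow> p a"
    using limseq_even_odd[of "\<lambda>k. limit_tail d a k a", OF p[of a]] q[of a] by simp
  then show ?thesis by (auto simp: convergent_def)
qed

end

subsection \<open>Conditioning on the edges at a vertex\<close>

abbreviation expo :: "real measure" where
  "expo \<equiv> density lborel (exponential_density 1)"

lemma of_bool_le_measurable:
  fixes f g :: "'b \<Rightarrow> real"
  assumes [measurable]: "f \<in> borel_measurable M" "g \<in> borel_measurable M"
  shows "(\<lambda>x. of_bool (f x \<le> g x) :: real) \<in> borel_measurable M"
    and of_bool_neq_measurable: "(\<lambda>x. of_bool (f x \<noteq> g x) :: real) \<in> borel_measurable M"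
  by measurable

section \<open>The product space of edge lengths\<close>

lemma prob_space_expo: "prob_space expo"
  by (rule prob_space_exponential_density) simp

lemma finite_edges [simp]: "finite (edges n)"
  unfolding edges_def by (rule finite_subset[of _ "{..<n} \<times> {..<n}"]) auto

lemma uedge_in_edges: "v < n \<Longrightarrow> w < n \<Longrightarrow> v \<noteq> w \<Longrightarrow> uedge v w \<in> edges n"
  by (auto simp: edges_def uedge_def min_def max_def)

lemma uedge_eq_iff: "uedge v i = uedge v j \<longleftrightarrow> i = j"
  by (auto simp: uedge_def min_def max_def split: if_splits)

lemma uedge_neq: "w \<noteq> i \<Longrightarrow> w \<noteq> j \<Longrightarrow> uedge i j \<noteq> uedge w v"
  by (auto simp: uedge_def min_def max_def split: if_splits)

lemma prod_of_bool: "finite H \<Longrightarrow> (\<Prod>i\<in>H. of_bool (P i)) = (of_bool (\<forall>i\<in>H. P i) :: real)"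
  by (induction H rule: finite_induct) auto

lemma abs_exp_minus_diff_le:
  fixes x y :: real assumes "0 \<le> x" "0 \<le> y"
  shows "\<bar>exp (- x) - exp (- y)\<bar> \<le> \<bar>x - y\<bar>"
proof -
  have *: "exp (- u) - exp (- v) \<le> v - u" "exp (- v) \<le> exp (- u)" if "0 \<le> u" "u \<le> v" for u v :: real
  proof -
    have "1 - (v - u) \<le> exp (- (v - u))" using exp_ge_add_one_self[of "- (v - u)"] by linarith
    then have "exp (- u) * (1 - exp (- (v - u))) \<le> 1 * (v - u)"
      using that by (intro mult_mono) auto
    then show "exp (- u) - exp (- v) \<le> v - u"
      by (simp add: right_diff_distrib exp_add[symmetric])
    show "exp (- v) \<le> exp (- u)" using that by simp
  qed
  show ?thesis using *[of x y] *[of y x] assms by (cases "x \<le> y") auto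
qed

interpretation edge_prob: prob_space "edge_space n" for n
  unfolding edge_space_def by (intro prob_space_PiM prob_space_expo)

lemma integrable_edge_space:
  fixes f :: "(nat \<times> nat \<Rightarrow> real) \<Rightarrow> real"
  assumes "f \<in> borel_measurable (edge_space n)" "\<And>X. \<bar>f X\<bar> \<le> B"
  shows "integrable (edge_space n) f"
  using assms by (intro edge_prob.integrable_const_bound[where B = B]) auto

lemma edge_len_nonneg: "0 \<le> edge_len d n X e"
  by (simp add: edge_len_def)

lemma edge_len_measurable:
  assumes "e \<in> edges n"
  shows "(\<lambda>X. edge_len d n X e) \<in> borel_measurable (edge_space n)"
proof -
  have "(\<lambda>X. X e) \<in> measurable (edge_space n) expo"
    unfolding edge_space_def using assms by (rule measurable_component_singleton)
  then have [measurable]: "(\<lambda>X. X e) \<in> borel_measurable (edge_space n)"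
    by simp
  show ?thesis unfolding edge_len_def by measurable
qed

lemma approx_measurable:
  assumes "S \<subseteq> {..<n}" "v < n"
  shows "(\<lambda>X. approx (edge_len d n X) a k S v) \<in> borel_measurable (edge_space n)"
  using assms
proof (induction k arbitrary: S v)
  case (Suc k)
  have fin: "finite S" using Suc.prems finite_subset by blast
  have that: "(\<lambda>X. edge_len d n X (uedge v i) - approx (edge_len d n X) a k (S - {v}) i)
      \<in> borel_measurable (edge_space n)" if "i \<in> S - {v}" for i
    using that Suc.prems by (intro borel_measurable_diff Suc.IH edge_len_measurable uedge_in_edges) auto
  have "(\<lambda>X. Min ((\<lambda>i. case i of None \<Rightarrow> a
        | Some i \<Rightarrow> edge_len d n X (uedge v i) - approx (edge_len d n X) a k (S - {v}) i)
        ` insert None (Some ` (S - {v})))) \<in> borel_measurable (edge_space n)"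
  proof (intro borel_measurable_Min)
    fix i assume "i \<in> insert None (Some ` (S - {v}))"
    then show "(\<lambda>X. case i of None \<Rightarrow> a
        | Some i \<Rightarrow> edge_len d n X (uedge v i) - approx (edge_len d n X) a k (S - {v}) i)
        \<in> borel_measurable (edge_space n)"
      using that by (cases i) auto
  qed (use fin in simp)
  then show ?case by (simp add: image_image)
qed simp

text \<open>Independence is expressed as invariance under changing one coordinate: a truncation on a
  set that avoids \<open>w\<close> does not react to edges at \<open>w\<close>.\<close>

lemma approx_ignores:
  assumes "finite S" "w \<notin> insert v S"
  shows "approx (edge_len d n (X(uedge w i := y))) a k S v = approx (edge_len d n X) a k S v"
proof (rule approx_cong[OF assms(1)])
  fix i' j assume "i' \<in> insert v S" "j \<in> insert v S"
  then have "uedge i' j \<noteq> uedge w i" using assms by (intro uedge_neq) auto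
  then show "edge_len d n (X(uedge w i := y)) (uedge i' j) = edge_len d n X (uedge i' j)"
    by (simp add: edge_len_def)
qed

context diluted
begin

section \<open>Integrating out the edges at a vertex\<close>

lemma expo_tail:
  assumes "0 < n"
  shows "measure expo {y. t \<le> (real n * y) powr (1 / d)} = exp (- (max 0 t powr d) / real n)"
proof -
  interpret prob_space expo by (rule prob_space_expo)
  have [measurable]: "{y. t \<le> (real n * y) powr (1 / d)} \<in> sets borel" by measurable
  show ?thesis
  proof (cases "t \<le> 0")
    case True
    then have "{y. t \<le> (real n * y) powr (1 / d)} = UNIV"
      using powr_ge_zero order_trans by blast
    then show ?thesis using True d_ge_1 prob_space by simp
  next
    case False
    define s where "s = t powr d / real n"
    have s: "0 < s" using False assms by (simp add: s_def)
    have iff: "t \<le> (real n * y) powr (1 / d) \<longleftrightarrow> s \<le> y" if "0 < y" for y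
    proof -
      have "t \<le> (real n * y) powr (1 / d) \<longleftrightarrow> t powr d \<le> ((real n * y) powr (1 / d)) powr d"
        using False d_ge_1 powr_mono2[of d t "(real n * y) powr (1 / d)"]
          powr_less_mono2[of d "(real n * y) powr (1 / d)" t]
        by (cases "t \<le> (real n * y) powr (1 / d)") auto
      also have "((real n * y) powr (1 / d)) powr d = real n * y"
        using that assms d_ge_1 by (simp add: powr_powr)
      finally show ?thesis using assms by (simp add: s_def field_simps)
    qed
    \<comment> \<open>The length can be inverted only for \<open>y > 0\<close>: negative
      \<open>y\<close> have density \<open>0\<close>, and the points \<open>0\<close> and
      \<open>s\<close> are null sets.\<close>
    have "AE y in expo. (y \<in> {y. t \<le> (real n * y) powr (1 / d)}) = (y \<in> {y. s < y})"
    proof -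
      have m: "(\<lambda>y. ennreal (exponential_density 1 y)) \<in> borel_measurable lborel" by simp
      show ?thesis
        unfolding AE_density[OF m] using AE_lborel_singleton[of 0] AE_lborel_singleton[of s]
        by eventually_elim (auto simp: exponential_density_def iff split: if_splits)
    qed
    then have "prob {y. t \<le> (real n * y) powr (1 / d)} = prob {y. s < y}"
      by (intro measure_eq_AE) auto
    also have "distributed expo lborel (\<lambda>y. y) (exponential_density 1)"
      by (auto simp: distributed_def intro!: measure_eqI simp: emeasure_distr exponential_density_nonneg)
    then have "prob {y. s < y} = exp (- s * 1)"
      using exponential_distributedD_gt[of "\<lambda>y. y" 1 s] s by simp
    finally show ?thesis using False by (simp add: s_def)
  qed
qed

text \<open>Since \<open>g\<close> and \<open>c\<close> ignore the coordinate \<open>e\<close>,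
  integrating over that coordinate first replaces the indicator by its conditional
  probability.\<close>

lemma integral_replace_edge:
  fixes g c :: "(nat \<times> nat \<Rightarrow> real) \<Rightarrow> real"
  assumes n: "0 < n" and e: "e \<in> edges n"
    and [measurable]: "g \<in> borel_measurable (edge_space n)" "c \<in> borel_measurable (edge_space n)"
    and g: "\<And>X. 0 \<le> g X" "\<And>X. g X \<le> 1"
    and g_ign: "\<And>X y. g (X(e := y)) = g X" and c_ign: "\<And>X y. c (X(e := y)) = c X"
  shows "(\<integral>X. g X * of_bool (c X \<le> edge_len d n X e) \<partial>edge_space n) =
         (\<integral>X. g X * exp (- (max 0 (c X) powr d) / real n) \<partial>edge_space n)"
proof -
  interpret E: prob_space expo by (rule prob_space_expo)
  interpret P: product_prob_space "\<lambda>_. expo" "edges n"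
    by (intro product_prob_spaceI prob_space_expo)
  note [measurable] = edge_len_measurable[OF e, of d]
  let ?I = "edges n - {e}"
  have space: "edge_space n = PiM (insert e ?I) (\<lambda>_. expo)"
    using e by (simp add: edge_space_def insert_absorb)
  have i1: "integrable (edge_space n) (\<lambda>X. g X * of_bool (c X \<le> edge_len d n X e))"
    using g by (intro integrable_edge_space[where B = 1]) (auto simp: of_bool_def)
  have i2: "integrable (edge_space n) (\<lambda>X. g X * exp (- (max 0 (c X) powr d) / real n))"
  proof (intro integrable_edge_space[where B = 1])
    fix X
    have "g X * exp (- (max 0 (c X) powr d) / real n) \<le> 1 * 1"
      using g by (intro mult_mono) auto
    then show "\<bar>g X * exp (- (max 0 (c X) powr d) / real n)\<bar> \<le> 1" using g by simp
  qed measurable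
  have inner: "(\<integral>y. g (X(e := y)) * of_bool (c (X(e := y)) \<le> edge_len d n (X(e := y)) e) \<partial>expo) =
        (\<integral>y. g (X(e := y)) * exp (- (max 0 (c (X(e := y))) powr d) / real n) \<partial>expo)" for X
  proof -
    have "(\<integral>y. g (X(e := y)) * of_bool (c (X(e := y)) \<le> edge_len d n (X(e := y)) e) \<partial>expo) =
          (\<integral>y. g X * indicator {y. c X \<le> (real n * y) powr (1 / d)} y \<partial>expo)"
      by (intro Bochner_Integration.integral_cong)
         (auto simp: g_ign c_ign edge_len_def indicator_def)
    also have "\<dots> = g X * measure expo {y. c X \<le> (real n * y) powr (1 / d)}"
      by simp
    also have "\<dots> = g X * exp (- (max 0 (c X) powr d) / real n)"
      by (simp add: expo_tail[OF n])
    finally show ?thesis using E.prob_space by (simp add: g_ign c_ign)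
  qed
  have I: "finite ?I" "e \<notin> ?I" by auto
  show ?thesis
    unfolding space P.product_integral_insert[OF I i1[unfolded space]]
      P.product_integral_insert[OF I i2[unfolded space]] inner ..
qed

text \<open>The edges from \<open>v\<close> to \<open>H\<close> are distinct coordinates and no
  threshold reads any of them, so they can be integrated out one at a time.\<close>

lemma integral_replace_star:
  fixes g :: "(nat \<times> nat \<Rightarrow> real) \<Rightarrow> real" and c :: "nat \<Rightarrow> (nat \<times> nat \<Rightarrow> real) \<Rightarrow> real"
  assumes n: "0 < n" and v: "v < n" and H: "finite H" "H \<subseteq> {..<n}" "v \<notin> H"
    and "g \<in> borel_measurable (edge_space n)" "\<And>i. i \<in> H \<Longrightarrow> c i \<in> borel_measurable (edge_space n)"
    and "\<And>X. 0 \<le> g X" "\<And>X. g X \<le> 1"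
    and "\<And>X j y. j \<in> H \<Longrightarrow> g (X(uedge v j := y)) = g X"
    and "\<And>X i j y. i \<in> H \<Longrightarrow> j \<in> H \<Longrightarrow> c i (X(uedge v j := y)) = c i X"
  shows "(\<integral>X. g X * (\<Prod>i\<in>H. of_bool (c i X \<le> edge_len d n X (uedge v i))) \<partial>edge_space n) =
         (\<integral>X. g X * (\<Prod>i\<in>H. exp (- (max 0 (c i X) powr d) / real n)) \<partial>edge_space n)"
  using H assms(6-)
proof (induction H arbitrary: g rule: finite_induct)
  case (insert i H)
  have e: "uedge v i \<in> edges n" using insert.prems v by (intro uedge_in_edges) auto
  note [measurable] = edge_len_measurable[OF e, of d]
  have cm: "c j \<in> borel_measurable (edge_space n)" if "j \<in> insert i H" for j
    using insert.prems that by blast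
  have gm: "g \<in> borel_measurable (edge_space n)" by (rule insert.prems)
  let ?b = "\<lambda>j X. of_bool (c j X \<le> edge_len d n X (uedge v j)) :: real"
  let ?x = "\<lambda>j X. exp (- (max 0 (c j X) powr d) / real n)"
  have g01: "0 \<le> g X" "g X \<le> 1" for X by (rule insert.prems)+
  have gi: "g (X(uedge v j := y)) = g X" if "j \<in> insert i H" for X j y
    using insert.prems(7) that by blast
  have ci: "c j (X(uedge v j' := y)) = c j X" if "j \<in> insert i H" "j' \<in> insert i H" for X j j' y
    using insert.prems(8) that by blast
  have "(\<integral>X. g X * (\<Prod>j\<in>insert i H. ?b j X) \<partial>edge_space n) =
        (\<integral>X. (g X * ?b i X) * (\<Prod>j\<in>H. ?b j X) \<partial>edge_space n)"
    using insert.hyps by (simp add: mult.assoc)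
  \<comment> \<open>The indicator of the new edge is absorbed into \<open>g\<close>, which is why
    the induction keeps \<open>g\<close> arbitrary.\<close>
  also have "\<dots> = (\<integral>X. (g X * ?b i X) * (\<Prod>j\<in>H. ?x j X) \<partial>edge_space n)"
  proof (rule insert.IH)
    have "?b i \<in> borel_measurable (edge_space n)"
      using cm by (intro of_bool_le_measurable edge_len_measurable e) simp_all
    then show "(\<lambda>X. g X * ?b i X) \<in> borel_measurable (edge_space n)"
      by (intro borel_measurable_times gm)
    fix X j y assume "j \<in> H"
    then show "g (X(uedge v j := y)) * ?b i (X(uedge v j := y)) = g X * ?b i X"
      using insert.hyps gi[of j X y] ci[of i j X y] by (auto simp: edge_len_def uedge_eq_iff)
  qed (use insert.prems g01 cm ci in \<open>auto simp: of_bool_def\<close>)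
  also have "\<dots> = (\<integral>X. (g X * (\<Prod>j\<in>H. ?x j X)) * ?b i X \<partial>edge_space n)"
    by (simp add: mult_ac)
  also have "\<dots> = (\<integral>X. (g X * (\<Prod>j\<in>H. ?x j X)) * ?x i X \<partial>edge_space n)"
  proof (rule integral_replace_edge[OF n e])
    show "(\<lambda>X. g X * (\<Prod>j\<in>H. ?x j X)) \<in> borel_measurable (edge_space n)"
    proof (intro borel_measurable_times gm borel_measurable_prod)
      fix j assume "j \<in> H"
      then have [measurable]: "c j \<in> borel_measurable (edge_space n)" by (intro cm) simp
      show "?x j \<in> borel_measurable (edge_space n)" by measurable
    qed
    show "c i \<in> borel_measurable (edge_space n)" by (rule cm) simp
    show "0 \<le> g X * (\<Prod>j\<in>H. ?x j X)" for X using g01 by (intro mult_nonneg_nonneg prod_nonneg) auto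
    have "(\<Prod>j\<in>H. ?x j X) \<le> 1" for X by (intro prod_le_1) auto
    then show "g X * (\<Prod>j\<in>H. ?x j X) \<le> 1" for X
      using g01[of X] mult_mono[of "g X" 1 "\<Prod>j\<in>H. ?x j X" 1] by (simp add: prod_nonneg)
    show "g (X(uedge v i := y)) * (\<Prod>j\<in>H. ?x j (X(uedge v i := y))) = g X * (\<Prod>j\<in>H. ?x j X)" for X y
      using ci gi by simp
    show "c i (X(uedge v i := y)) = c i X" for X y using ci by simp
  qed
  also have "\<dots> = (\<integral>X. g X * (\<Prod>j\<in>insert i H. ?x j X) \<partial>edge_space n)"
    using insert.hyps by (simp add: mult_ac)
  finally show ?case .
qed simp

lemma integral_short_edge:
  assumes n: "0 < n" and e: "e \<in> edges n"
    and [measurable]: "g \<in> borel_measurable (edge_space n)"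
    and g: "\<And>X. 0 \<le> g X" "\<And>X. g X \<le> 1" and g_ign: "\<And>X y. g (X(e := y)) = g X"
  shows "(\<integral>X. g X * of_bool (edge_len d n X e < 2 * a) \<partial>edge_space n) \<le>
         (2 * a) powr d / real n * (\<integral>X. g X \<partial>edge_space n)"
proof -
  note [measurable] = edge_len_measurable[OF e, of d]
  let ?q = "(2 * a) powr d / real n"
  have i1: "integrable (edge_space n) g"
    using g by (intro integrable_edge_space[where B = 1]) auto
  have i2: "integrable (edge_space n) (\<lambda>X. g X * of_bool (2 * a \<le> edge_len d n X e))"
    using g by (intro integrable_edge_space[where B = 1]) (auto simp: of_bool_def)
  have "(\<integral>X. g X * of_bool (edge_len d n X e < 2 * a) \<partial>edge_space n) =
        (\<integral>X. g X - g X * of_bool (2 * a \<le> edge_len d n X e) \<partial>edge_space n)"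
    by (intro Bochner_Integration.integral_cong) auto
  also have "\<dots> = (\<integral>X. g X \<partial>edge_space n) - (\<integral>X. g X * of_bool (2 * a \<le> edge_len d n X e) \<partial>edge_space n)"
    using i1 i2 by (rule Bochner_Integration.integral_diff)
  also have "(\<integral>X. g X * of_bool (2 * a \<le> edge_len d n X e) \<partial>edge_space n) =
        exp (- ?q) * (\<integral>X. g X \<partial>edge_space n)"
    using a_pos by (subst integral_replace_edge[OF n e]) (auto simp: g g_ign mult.commute)
  finally have *: "(\<integral>X. g X * of_bool (edge_len d n X e < 2 * a) \<partial>edge_space n) =
      (1 - exp (- ?q)) * (\<integral>X. g X \<partial>edge_space n)" by (simp add: algebra_simps)
  have "1 - exp (- ?q) \<le> ?q" using exp_ge_add_one_self[of "- ?q"] by linarith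
  then show ?thesis unfolding * using g
    by (intro mult_right_mono Bochner_Integration.integral_nonneg) auto
qed

text \<open>By \<open>approx_remove_vertex\<close> the depth \<open>k + 1\<close> values differ only
  if \<open>v w\<close> is short or some short edge \<open>v i\<close> leads to an \<open>i\<close>
  whose depth \<open>k\<close> values differ. With \<open>Q = (2 * a) powr d\<close> the first has
  probability at most \<open>Q / n\<close>, and the second at most
  \<open>n * (Q / n) * (C / n)\<close>. This gives the new constant
  \<open>Q * (1 + C)\<close>.\<close>

lemma approx_remove_vertex_prob:
  "\<exists>C\<ge>0. \<forall>n>0. \<forall>S v w. S \<subseteq> {..<n} \<longrightarrow> v < n \<longrightarrow> w < n \<longrightarrow> v \<noteq> w \<longrightarrow>
     (\<integral>X. of_bool (approx (edge_len d n X) a k S v \<noteq> approx (edge_len d n X) a k (S - {w}) v)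
        \<partial>edge_space n) \<le> C / real n" (is "\<exists>C\<ge>0. ?P k C")
proof (induction k)
  case 0
  show ?case by (intro exI[of _ 0]) simp
next
  case (Suc k)
  obtain C where C: "0 \<le> C" "?P k C" using Suc.IH by (elim exE conjE)
  note IH = C(2)[rule_format]
  let ?Q = "(2 * a) powr d"
  show ?case
  proof (intro exI[of _ "?Q * (1 + C)"] conjI allI impI)
    show "0 \<le> ?Q * (1 + C)" using C by simp
    fix n :: nat and S v w
    assume n: "0 < n" and S: "S \<subseteq> {..<n}" and v: "v < n" and w: "w < n" and vw: "v \<noteq> w"
    have fin: "finite S" using S finite_subset by blast
    let ?F = "\<lambda>X k S v. approx (edge_len d n X) a k S v"
    let ?b = "\<lambda>i X. of_bool (?F X k (S - {v}) i \<noteq> ?F X k (S - {v} - {w}) i) :: real"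
    let ?s = "\<lambda>i X. of_bool (edge_len d n X (uedge v i) < 2 * a) :: real"
    have evi: "uedge v i \<in> edges n" if "i \<in> S - {v, w}" for i
      using that S v by (intro uedge_in_edges) auto
    have evw: "uedge v w \<in> edges n" using v w vw by (intro uedge_in_edges)
    have apm: "(\<lambda>X. ?F X k' S' u) \<in> borel_measurable (edge_space n)" if "S' \<subseteq> S" "u < n" for k' S' u
      using that S by (intro approx_measurable) auto
    have bm: "?b i \<in> borel_measurable (edge_space n)" if "i \<in> S - {v, w}" for i
      using that S by (intro of_bool_neq_measurable apm) auto
    have sm: "?s i \<in> borel_measurable (edge_space n)" if "uedge v i \<in> edges n" for i
    proof -
      note [measurable] = edge_len_measurable[OF that, of d]
      show ?thesis by measurable
    qed
    have int1: "integrable (edge_space n) (\<lambda>X. ?b i X * ?s i X)" if "i \<in> S - {v, w}" for i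
      using bm[OF that] sm[OF evi[OF that]]
      by (intro integrable_edge_space[where B = 1] borel_measurable_times) auto
    have int2: "integrable (edge_space n) (?s w)"
      using sm[OF evw] by (intro integrable_edge_space[where B = 1]) auto
    have "(\<integral>X. of_bool (?F X (Suc k) S v \<noteq> ?F X (Suc k) (S - {w}) v) \<partial>edge_space n) \<le>
          (\<integral>X. ?s w X + (\<Sum>i\<in>S - {v, w}. ?b i X * ?s i X) \<partial>edge_space n)"
    proof (rule integral_mono)
      show "integrable (edge_space n) (\<lambda>X. of_bool (?F X (Suc k) S v \<noteq> ?F X (Suc k) (S - {w}) v) :: real)"
        using v by (intro integrable_edge_space[where B = 1] of_bool_neq_measurable apm) auto
      show "integrable (edge_space n) (\<lambda>X. ?s w X + (\<Sum>i\<in>S - {v, w}. ?b i X * ?s i X))"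
        using int1 int2 by (intro Bochner_Integration.integrable_add Bochner_Integration.integrable_sum) auto
      fix X
      have nn: "0 \<le> (\<Sum>i\<in>S - {v, w}. ?b i X * ?s i X)" by (intro sum_nonneg) auto
      show "of_bool (?F X (Suc k) S v \<noteq> ?F X (Suc k) (S - {w}) v) \<le>
            ?s w X + (\<Sum>i\<in>S - {v, w}. ?b i X * ?s i X)"
      proof (cases "?F X (Suc k) S v = ?F X (Suc k) (S - {w}) v \<or> edge_len d n X (uedge v w) < 2 * a")
        case True then show ?thesis using nn by (auto simp del: approx.simps)
      next
        case False
        then obtain i where i: "i \<in> S - {v, w}" "edge_len d n X (uedge v i) < 2 * a"
          "?F X k (S - {v}) i \<noteq> ?F X k (S - {w} - {v}) i"
          using approx_remove_vertex[OF fin vw, of a "edge_len d n X" k] by force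
        have "S - {w} - {v} = S - {v} - {w}" by blast
        then have "1 = ?b i X * ?s i X" using i by simp
        also have "\<dots> \<le> (\<Sum>i\<in>S - {v, w}. ?b i X * ?s i X)"
          using i(1) fin by (intro member_le_sum) auto
        finally show ?thesis by (simp add: of_bool_def del: approx.simps)
      qed
    qed
    also have "\<dots> = (\<integral>X. ?s w X \<partial>edge_space n) + (\<Sum>i\<in>S - {v, w}. \<integral>X. ?b i X * ?s i X \<partial>edge_space n)"
      by (simp only: Bochner_Integration.integral_add[OF int2 Bochner_Integration.integrable_sum[OF int1]]
          Bochner_Integration.integral_sum[OF int1])
    also have "(\<integral>X. ?s w X \<partial>edge_space n) \<le> ?Q / real n"
      using integral_short_edge[OF n evw, of "\<lambda>_. 1"] by (simp add: edge_prob.prob_space)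
    also have "(\<Sum>i\<in>S - {v, w}. \<integral>X. ?b i X * ?s i X \<partial>edge_space n) \<le>
        (\<Sum>i\<in>S - {v, w}. ?Q / real n * (C / real n))"
    proof (rule sum_mono)
      fix i assume i: "i \<in> S - {v, w}"
      \<comment> \<open>The values at \<open>i\<close> read no edge at \<open>v\<close>, so the
        shortness of \<open>v i\<close> contributes an independent factor.\<close>
      have "(\<integral>X. ?b i X * ?s i X \<partial>edge_space n) \<le> ?Q / real n * (\<integral>X. ?b i X \<partial>edge_space n)"
        using i fin by (intro integral_short_edge n evi bm) (auto simp: approx_ignores)
      also have "\<dots> \<le> ?Q / real n * (C / real n)"
        using i S w by (intro mult_left_mono IH n) auto
      finally show "(\<integral>X. ?b i X * ?s i X \<partial>edge_space n) \<le> ?Q / real n * (C / real n)" .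
    qed
    also have "\<dots> = real (card (S - {v, w})) * (?Q / real n * (C / real n))" by simp
    also have "\<dots> \<le> real n * (?Q / real n * (C / real n))"
    proof (rule mult_right_mono)
      have "card (S - {v, w}) \<le> card {..<n}" using S by (intro card_mono) auto
      then show "real (card (S - {v, w})) \<le> real n" by simp
    qed (use C in auto)
    finally show "(\<integral>X. of_bool (?F X (Suc k) S v \<noteq> ?F X (Suc k) (S - {w}) v) \<partial>edge_space n)
        \<le> ?Q * (1 + C) / real n" using n by (simp add: field_simps)
  qed
qed

text \<open>For \<open>x \<le> a\<close>, minus the logarithm of the conditional probability, given
  the edges inside \<open>H\<close>, that truncation \<open>k + 1\<close> at a vertex outside
  \<open>H\<close> is at least \<open>x\<close>.\<close>

definition branching_sum :: "nat \<Rightarrow> nat \<Rightarrow> nat set \<Rightarrow> real \<Rightarrow> (nat \<times> nat \<Rightarrow> real) \<Rightarrow> real" where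
  "branching_sum n k H x X = (\<Sum>i\<in>H. max 0 (x + approx (edge_len d n X) a k H i) powr d / real n)"

lemma branching_sum_nonneg: "0 \<le> branching_sum n k H x X"
  by (simp add: branching_sum_def sum_nonneg)

lemma branching_sum_measurable:
  assumes "H \<subseteq> {..<n}"
  shows "branching_sum n k H x \<in> borel_measurable (edge_space n)"
  unfolding branching_sum_def[abs_def]
proof (intro borel_measurable_sum)
  fix i assume "i \<in> H"
  then have [measurable]: "(\<lambda>X. approx (edge_len d n X) a k H i) \<in> borel_measurable (edge_space n)"
    using assms by (intro approx_measurable) auto
  show "(\<lambda>X. max 0 (x + approx (edge_len d n X) a k H i) powr d / real n) \<in> borel_measurable (edge_space n)"
    by measurable
qed

text \<open>Both vertices lie outside \<open>H\<close>, so they see the same values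
  \<open>approx\<close> at depth \<open>k\<close>, which depend on edges inside \<open>H\<close>
  only. The stars from \<open>v\<close> and from \<open>w\<close> to \<open>H\<close> are disjoint,
  hence conditionally independent.\<close>

lemma approx_joint_tail:
  assumes n: "0 < n" and H: "H \<subseteq> {..<n}" and v: "v < n" "v \<notin> H" and w: "w < n" "w \<notin> H"
    and vw: "v \<noteq> w" and x: "x \<le> a" and y: "y \<le> a"
  shows "(\<integral>X. of_bool (x \<le> approx (edge_len d n X) a (Suc k) H v) *
              of_bool (y \<le> approx (edge_len d n X) a (Suc k) H w) \<partial>edge_space n) =
         (\<integral>X. exp (- (branching_sum n k H x X + branching_sum n k H y X)) \<partial>edge_space n)"
proof -
  have fin: "finite H" using H finite_subset by blast
  let ?F = "\<lambda>X i. approx (edge_len d n X) a k H i"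
  have tail: "of_bool (z \<le> approx (edge_len d n X) a (Suc k) H u) =
      (\<Prod>i\<in>H. of_bool (z + ?F X i \<le> edge_len d n X (uedge u i)) :: real)"
    if "z \<le> a" "u \<notin> H" for z u X
    using that fin by (simp add: approx_Suc_ge_iff prod_of_bool del: approx.simps)
  have ex: "exp (- branching_sum n k H z X) =
      (\<Prod>i\<in>H. exp (- (max 0 (z + ?F X i) powr d) / real n))" for z X
    using fin by (simp add: branching_sum_def exp_sum[symmetric] sum_negf[symmetric])
  have Fm: "(\<lambda>X. z + ?F X i) \<in> borel_measurable (edge_space n)" if "i \<in> H" for z i
    using that H by (intro borel_measurable_add approx_measurable) auto
  have [measurable]: "(\<lambda>X. approx (edge_len d n X) a (Suc k) H w) \<in> borel_measurable (edge_space n)"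
    using w H by (intro approx_measurable)
  have ign: "z + ?F (X(uedge u j := t)) i = z + ?F X i" if "u \<notin> H" "i \<in> H" for z X u j t i
    using that fin by (subst approx_ignores) auto
  have "(\<integral>X. of_bool (y \<le> approx (edge_len d n X) a (Suc k) H w) *
        (\<Prod>i\<in>H. of_bool (x + ?F X i \<le> edge_len d n X (uedge v i))) \<partial>edge_space n) =
      (\<integral>X. of_bool (y \<le> approx (edge_len d n X) a (Suc k) H w) *
        (\<Prod>i\<in>H. exp (- (max 0 (x + ?F X i) powr d) / real n)) \<partial>edge_space n)"
  proof (rule integral_replace_star[OF n v(1) fin H v(2)])
    show "(\<lambda>X. of_bool (y \<le> approx (edge_len d n X) a (Suc k) H w) :: real) \<in> borel_measurable (edge_space n)"
      by measurable
    show "of_bool (y \<le> approx (edge_len d n (X(uedge v j := t))) a (Suc k) H w) =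
      (of_bool (y \<le> approx (edge_len d n X) a (Suc k) H w) :: real)" for X j t
      using v vw fin by (subst approx_ignores) auto
  qed (use Fm ign v in \<open>auto simp del: approx.simps\<close>)
  also have "\<dots> = (\<integral>X. exp (- branching_sum n k H x X) *
        (\<Prod>i\<in>H. of_bool (y + ?F X i \<le> edge_len d n X (uedge w i))) \<partial>edge_space n)"
    unfolding tail[OF y w(2)] ex by (simp only: mult.commute)
  \<comment> \<open>The factor of \<open>v\<close> now reads only edges inside \<open>H\<close>, so
    the star at \<open>w\<close> can be integrated out in turn.\<close>
  also have "\<dots> = (\<integral>X. exp (- branching_sum n k H x X) *
        (\<Prod>i\<in>H. exp (- (max 0 (y + ?F X i) powr d) / real n)) \<partial>edge_space n)"
  proof (rule integral_replace_star[OF n w(1) fin H w(2)])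
    show "(\<lambda>X. exp (- branching_sum n k H x X)) \<in> borel_measurable (edge_space n)"
      using branching_sum_measurable[OF H] by measurable
    show "exp (- branching_sum n k H x (X(uedge w j := t))) = exp (- branching_sum n k H x X)" for X j t
      unfolding branching_sum_def using ign[of w] w by simp
  qed (use Fm ign w branching_sum_nonneg in auto)
  finally show ?thesis
    unfolding tail[OF x v(2)] ex[symmetric] by (simp add: exp_add[symmetric] mult.commute)
qed

end

subsection \<open>Convergence of the empirical tails\<close>

context diluted
begin

text \<open>Divided by \<open>n\<close> rather than \<open>card S\<close>, to match the factor
  \<open>1 / n\<close> in \<open>branching_sum\<close>; \<open>S\<close> will miss only boundedly
  many vertices.\<close>

definition tail_frac :: "nat \<Rightarrow> nat \<Rightarrow> nat set \<Rightarrow> real \<Rightarrow> (nat \<times> nat \<Rightarrow> real) \<Rightarrow> real" where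
  "tail_frac n k S t X = (\<Sum>i\<in>S. of_bool (t \<le> approx (edge_len d n X) a k S i)) / real n"

definition limit_sum :: "nat \<Rightarrow> real \<Rightarrow> real" where
  "limit_sum k x = (\<integral>t. edge_kernel d (x + t) * limit_tail d a k t \<partial>Icc_measure a)"

lemma limit_tail_Suc: "limit_tail d a (Suc k) x = exp (- limit_sum k x)"
  by (simp add: limit_sum_def tail_op_def)

lemma limit_sum_nonneg: "0 \<le> limit_sum k x"
  unfolding limit_sum_def using edge_kernel_nonneg limit_tail_bounds
  by (intro Bochner_Integration.integral_nonneg) simp

lemma tail_frac_nonneg: "0 \<le> tail_frac n k S t X"
  by (auto simp: tail_frac_def intro!: divide_nonneg_nonneg sum_nonneg)

lemma tail_frac_le_1:
  assumes "S \<subseteq> {..<n}" shows "tail_frac n k S t X \<le> 1"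
proof -
  have "(\<Sum>i\<in>S. of_bool (t \<le> approx (edge_len d n X) a k S i)) \<le> (\<Sum>i\<in>S. 1 :: real)"
    by (intro sum_mono) auto
  also have "\<dots> \<le> real n" using card_mono[OF _ assms] by simp
  finally show ?thesis by (cases "n = 0") (simp_all add: tail_frac_def divide_le_eq_1)
qed

lemma tail_frac_measurable_pair:
  assumes "S \<subseteq> {..<n}"
  shows "(\<lambda>z. tail_frac n k S (snd z) (fst z)) \<in> borel_measurable (edge_space n \<Otimes>\<^sub>M Icc_measure a)"
  unfolding tail_frac_def
proof (intro borel_measurable_divide borel_measurable_sum of_bool_le_measurable borel_measurable_const)
  show "snd \<in> borel_measurable (edge_space n \<Otimes>\<^sub>M Icc_measure a)"
    using measurable_compose[OF measurable_snd ident_measurable_Icc] by simp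
  fix i assume "i \<in> S"
  then have "(\<lambda>X. approx (edge_len d n X) a k S i) \<in> borel_measurable (edge_space n)"
    using assms by (intro approx_measurable) auto
  then show "(\<lambda>z. approx (edge_len d n (fst z)) a k S i) \<in> borel_measurable (edge_space n \<Otimes>\<^sub>M Icc_measure a)"
    by (rule measurable_compose[OF measurable_fst])
qed

lemma tail_frac_measurable:
  assumes "S \<subseteq> {..<n}"
  shows "tail_frac n k S t \<in> borel_measurable (edge_space n)"
  unfolding tail_frac_def[abs_def]
proof (intro borel_measurable_divide borel_measurable_sum of_bool_le_measurable borel_measurable_const)
  fix i assume "i \<in> S"
  then show "(\<lambda>X. approx (edge_len d n X) a k S i) \<in> borel_measurable (edge_space n)"
    using assms by (intro approx_measurable) auto
qed

text \<open>Layer-cake formula: each power is the kernel integrated against one indicator, so the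
  exponent is linear in the empirical tail and inherits its convergence.\<close>

lemma branching_sum_eq:
  assumes "finite H" and x: "x \<in> {- a..a}"
  shows "branching_sum n k H x X = (\<integral>t. edge_kernel d (x + t) * tail_frac n k H t X \<partial>Icc_measure a)"
proof -
  let ?F = "\<lambda>i. approx (edge_len d n X) a k H i"
  have F: "?F i \<in> {- a..a}" for i
    using approx_le[OF assms(1)] approx_ge[OF assms(1)] a_pos edge_len_nonneg by simp
  have int: "integrable (Icc_measure a) (\<lambda>t. edge_kernel d (x + t) * of_bool (t \<le> ?F i))" for i
    by (rule integrable_edge_kernel) auto
  have "(\<integral>t. edge_kernel d (x + t) * tail_frac n k H t X \<partial>Icc_measure a) =
        (\<integral>t. (\<Sum>i\<in>H. edge_kernel d (x + t) * of_bool (t \<le> ?F i)) / real n \<partial>Icc_measure a)"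
    by (simp add: tail_frac_def sum_distrib_left)
  also have "\<dots> = (\<Sum>i\<in>H. \<integral>t. edge_kernel d (x + t) * of_bool (t \<le> ?F i) \<partial>Icc_measure a) / real n"
    using int by (simp add: Bochner_Integration.integral_sum)
  also have "\<dots> = branching_sum n k H x X"
    using edge_kernel_integral[OF x F] by (simp add: branching_sum_def sum_divide_distrib)
  finally show ?thesis ..
qed

lemma branching_sum_L1:
  assumes H: "H \<subseteq> {..<n}" and x: "x \<in> {- a..a}"
  shows "(\<integral>X. \<bar>branching_sum n k H x X - limit_sum k x\<bar> \<partial>edge_space n) \<le>
    (\<integral>t. edge_kernel d (x + t) *
       (\<integral>X. \<bar>tail_frac n k H t X - limit_tail d a k t\<bar> \<partial>edge_space n) \<partial>Icc_measure a)"
    and "(\<lambda>t. \<integral>X. \<bar>tail_frac n k H t X - limit_tail d a k t\<bar> \<partial>edge_space n)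
       \<in> borel_measurable (Icc_measure a)"
proof -
  have fin: "finite H" using H finite_subset by blast
  interpret P: pair_sigma_finite "edge_space n" "Icc_measure a" ..
  interpret PF: finite_measure "edge_space n \<Otimes>\<^sub>M Icc_measure a"
    by (rule finite_measure_pair_measure) unfold_locales
  let ?D = "\<lambda>X t. \<bar>tail_frac n k H t X - limit_tail d a k t\<bar>"
  have D1: "?D X t \<le> 1" for X t
    using tail_frac_nonneg[of n k H t X] tail_frac_le_1[OF H, of k t X] limit_tail_bounds[of k t]
    by (simp add: abs_le_iff)
  have sndm: "(\<lambda>z. snd z) \<in> borel_measurable (edge_space n \<Otimes>\<^sub>M Icc_measure a)"
    using measurable_compose[OF measurable_snd ident_measurable_Icc] by simp
  have lt: "(\<lambda>z. limit_tail d a k (snd z)) \<in> borel_measurable (edge_space n \<Otimes>\<^sub>M Icc_measure a)"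
    by (rule measurable_compose[OF sndm limit_tail_measurable])
  have Dm: "(\<lambda>z. ?D (fst z) (snd z)) \<in> borel_measurable (edge_space n \<Otimes>\<^sub>M Icc_measure a)"
    by (intro borel_measurable_abs borel_measurable_diff lt tail_frac_measurable_pair H)
  have "(\<lambda>z. edge_kernel d (x + snd z)) \<in> borel_measurable (edge_space n \<Otimes>\<^sub>M Icc_measure a)"
    by (rule measurable_compose[OF _ edge_kernel_measurable]) (intro borel_measurable_add sndm borel_measurable_const)
  then have KDm: "(\<lambda>z. edge_kernel d (x + snd z) * ?D (fst z) (snd z)) \<in> borel_measurable (edge_space n \<Otimes>\<^sub>M Icc_measure a)"
    using Dm by (rule borel_measurable_times)
  have int: "integrable (edge_space n \<Otimes>\<^sub>M Icc_measure a) (\<lambda>(X, t). edge_kernel d (x + t) * ?D X t)"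
  proof (rule PF.integrable_const_bound[where B = "edge_kernel d (2 * a)"])
    show "AE z in edge_space n \<Otimes>\<^sub>M Icc_measure a.
        norm (case z of (X, t) \<Rightarrow> edge_kernel d (x + t) * ?D X t) \<le> edge_kernel d (2 * a)"
    proof (rule AE_I2)
      fix z assume "z \<in> space (edge_space n \<Otimes>\<^sub>M Icc_measure a)"
      then obtain X t where z: "z = (X, t)" "t \<le> a" by (auto simp: space_pair_measure)
      have "edge_kernel d (x + t) * ?D X t \<le> edge_kernel d (2 * a) * 1"
        using x z D1 by (intro mult_mono edge_kernel_mono edge_kernel_nonneg) auto
      then show "norm (case z of (X, t) \<Rightarrow> edge_kernel d (x + t) * ?D X t) \<le> edge_kernel d (2 * a)"
        using edge_kernel_nonneg by (simp add: z(1) abs_mult)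
    qed
  qed (use KDm in \<open>simp add: case_prod_beta'\<close>)
  have TF: "(\<lambda>t. tail_frac n k H t X) \<in> borel_measurable borel" for X
    unfolding tail_frac_def by measurable
  have int1: "integrable (Icc_measure a) (\<lambda>t. edge_kernel d (x + t) * tail_frac n k H t X)" for X
    using TF tail_frac_nonneg tail_frac_le_1[OF H] by (intro integrable_edge_kernel) auto
  have int2: "integrable (Icc_measure a) (\<lambda>t. edge_kernel d (x + t) * limit_tail d a k t)"
    using limit_tail_bounds by (intro integrable_edge_kernel) auto
  have pt: "\<bar>branching_sum n k H x X - limit_sum k x\<bar> \<le> (\<integral>t. edge_kernel d (x + t) * ?D X t \<partial>Icc_measure a)" for X
  proof -
    have "branching_sum n k H x X - limit_sum k x =
        (\<integral>t. edge_kernel d (x + t) * (tail_frac n k H t X - limit_tail d a k t) \<partial>Icc_measure a)"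
      unfolding branching_sum_eq[OF fin x] limit_sum_def right_diff_distrib
      by (rule Bochner_Integration.integral_diff[OF int1 int2, symmetric])
    also have "\<bar>\<dots>\<bar> \<le> (\<integral>t. \<bar>edge_kernel d (x + t) * (tail_frac n k H t X - limit_tail d a k t)\<bar> \<partial>Icc_measure a)"
      by (rule integral_abs_bound)
    finally show ?thesis using edge_kernel_nonneg by (simp add: abs_mult)
  qed
  have "(\<integral>X. \<bar>branching_sum n k H x X - limit_sum k x\<bar> \<partial>edge_space n) \<le>
      (\<integral>X. (\<integral>t. edge_kernel d (x + t) * ?D X t \<partial>Icc_measure a) \<partial>edge_space n)"
  proof (rule integral_mono'[OF _ pt])
    show "integrable (edge_space n) (\<lambda>X. \<integral>t. edge_kernel d (x + t) * ?D X t \<partial>Icc_measure a)"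
      using P.integrable_fst[OF int] by simp
  qed (intro Bochner_Integration.integral_nonneg mult_nonneg_nonneg edge_kernel_nonneg abs_ge_zero)
  also have "\<dots> = (\<integral>t. (\<integral>X. edge_kernel d (x + t) * ?D X t \<partial>edge_space n) \<partial>Icc_measure a)"
    by (rule P.Fubini_integral[OF int, symmetric])
  finally show "(\<integral>X. \<bar>branching_sum n k H x X - limit_sum k x\<bar> \<partial>edge_space n) \<le>
    (\<integral>t. edge_kernel d (x + t) * (\<integral>X. ?D X t \<partial>edge_space n) \<partial>Icc_measure a)"
    by simp
  have "(\<lambda>z. ?D (snd z) (fst z)) \<in> borel_measurable (Icc_measure a \<Otimes>\<^sub>M edge_space n)"
    using measurable_compose[OF measurable_pair_swap' Dm] by (simp add: case_prod_beta')
  then show "(\<lambda>t. \<integral>X. ?D X t \<partial>edge_space n) \<in> borel_measurable (Icc_measure a)"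
    using edge_prob.borel_measurable_lebesgue_integral[where N = "Icc_measure a" and f = "\<lambda>t X. ?D X t"]
    by (simp add: case_prod_beta')
qed

text \<open>The hypothesis gives a rate for each \<open>t\<close> separately, while one rate for all
  \<open>H\<close> is wanted. Choosing the worst of the finitely many \<open>H\<close> for each
  \<open>n\<close> turns this into one sequence. Dominated convergence in \<open>t\<close> applies
  to the actual errors along it, which are measurable in \<open>t\<close>.\<close>

lemma branching_sum_tendsto:
  assumes IH: "\<And>t. t \<in> {- a..a} \<Longrightarrow> \<exists>\<zeta>. \<zeta> \<longlonglongrightarrow> 0 \<and> (\<forall>n S. S \<subseteq> {..<n} \<longrightarrow> n \<le> card S + m \<longrightarrow>
      (\<integral>X. \<bar>tail_frac n k S t X - limit_tail d a k t\<bar> \<partial>edge_space n) \<le> \<zeta> n)"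
    and x: "x \<in> {- a..a}"
  shows "\<exists>\<zeta>. \<zeta> \<longlonglongrightarrow> 0 \<and> (\<forall>n H. H \<subseteq> {..<n} \<longrightarrow> n \<le> card H + m \<longrightarrow>
      (\<integral>X. \<bar>branching_sum n k H x X - limit_sum k x\<bar> \<partial>edge_space n) \<le> \<zeta> n)"
proof -
  define G where "G = (\<lambda>n. {H. H \<subseteq> {..<n} \<and> n \<le> card H + m})"
  define f where "f = (\<lambda>n H. \<integral>X. \<bar>branching_sum n k H x X - limit_sum k x\<bar> \<partial>edge_space n)"
  have G: "finite (G n)" "{..<n} \<in> G n" for n
    by (auto simp: G_def intro: finite_subset[of _ "Pow {..<n}"])
  have "\<exists>H. H \<in> G n \<and> f n H = Max (f n ` G n)" for n
  proof -
    have "Max (f n ` G n) \<in> f n ` G n" using G[of n] by (intro Max_in) auto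
    then show ?thesis by (metis imageE)
  qed
  then obtain H where H: "\<And>n. H n \<in> G n" "\<And>n. f n (H n) = Max (f n ` G n)" by metis
  have Hs: "H n \<subseteq> {..<n}" "n \<le> card (H n) + m" for n using H(1)[of n] by (auto simp: G_def)
  let ?e = "\<lambda>n t. \<integral>X. \<bar>tail_frac n k (H n) t X - limit_tail d a k t\<bar> \<partial>edge_space n"
  have e0: "0 \<le> ?e n t" for n t by (intro Bochner_Integration.integral_nonneg) simp
  have e1: "?e n t \<le> 1" for n t
  proof -
    have "?e n t \<le> (\<integral>X. 1 \<partial>edge_space n)"
    proof (rule integral_mono')
      show "\<bar>tail_frac n k (H n) t X - limit_tail d a k t\<bar> \<le> 1" for X
        using tail_frac_nonneg[of n k "H n" t X] tail_frac_le_1[OF Hs(1), of n k t X] limit_tail_bounds[of k t]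
        by (simp add: abs_le_iff)
    qed simp_all
    then show ?thesis by (simp add: edge_prob.prob_space)
  qed
  have e_lim: "(\<lambda>n. ?e n t) \<longlonglongrightarrow> 0" if t: "t \<in> {- a..a}" for t
  proof -
    obtain \<zeta> where z: "\<zeta> \<longlonglongrightarrow> 0" "\<forall>n S. S \<subseteq> {..<n} \<longrightarrow> n \<le> card S + m \<longrightarrow>
      (\<integral>X. \<bar>tail_frac n k S t X - limit_tail d a k t\<bar> \<partial>edge_space n) \<le> \<zeta> n"
      using IH[OF t] by (elim exE conjE)
    show ?thesis
      by (rule real_tendsto_sandwich[OF _ _ tendsto_const z(1)])
         (auto intro!: always_eventually e0 z(2)[rule_format] Hs)
  qed
  have m: "(\<lambda>t. ?e n t) \<in> borel_measurable (Icc_measure a)" for n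
    by (rule branching_sum_L1(2)[OF Hs(1) x])
  have km: "(\<lambda>t. edge_kernel d (x + t)) \<in> borel_measurable (Icc_measure a)"
    by (intro measurable_Icc) measurable
  have "(\<lambda>n. \<integral>t. edge_kernel d (x + t) * ?e n t \<partial>Icc_measure a) \<longlonglongrightarrow> (\<integral>t. 0 \<partial>Icc_measure a)"
  proof (rule integral_dominated_convergence[where w = "\<lambda>_. edge_kernel d (2 * a)"])
    show "(\<lambda>t. edge_kernel d (x + t) * ?e n t) \<in> borel_measurable (Icc_measure a)" for n
      by (intro borel_measurable_times km m)
    show "AE t in Icc_measure a. (\<lambda>n. edge_kernel d (x + t) * ?e n t) \<longlonglongrightarrow> 0"
      by (intro AE_I2 tendsto_mult_right_zero e_lim) simp
    show "AE t in Icc_measure a. norm (edge_kernel d (x + t) * ?e n t) \<le> edge_kernel d (2 * a)" for n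
    proof (rule AE_I2)
      fix t assume "t \<in> space (Icc_measure a)"
      then have "edge_kernel d (x + t) * ?e n t \<le> edge_kernel d (2 * a) * 1"
        using x e0 e1 by (intro mult_mono edge_kernel_mono edge_kernel_nonneg) auto
      then show "norm (edge_kernel d (x + t) * ?e n t) \<le> edge_kernel d (2 * a)"
        using edge_kernel_nonneg e0 by simp
    qed
  qed simp_all
  then have lim: "(\<lambda>n. \<integral>t. edge_kernel d (x + t) * ?e n t \<partial>Icc_measure a) \<longlonglongrightarrow> 0" by simp
  show ?thesis
  proof (intro exI conjI allI impI)
    show "(\<lambda>n. \<integral>t. edge_kernel d (x + t) * ?e n t \<partial>Icc_measure a) \<longlonglongrightarrow> 0" by (rule lim)
    fix n H' assume "H' \<subseteq> {..<n}" "n \<le> card H' + m"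
    then have "f n H' \<le> f n (H n)"
      unfolding H(2) using G[of n] by (intro Max_ge) (auto simp: G_def)
    also have "\<dots> \<le> (\<integral>t. edge_kernel d (x + t) * ?e n t \<partial>Icc_measure a)"
      unfolding f_def by (rule branching_sum_L1(1)[OF Hs(1) x])
    finally show "(\<integral>X. \<bar>branching_sum n k H' x X - limit_sum k x\<bar> \<partial>edge_space n) \<le>
       (\<integral>t. edge_kernel d (x + t) * ?e n t \<partial>Icc_measure a)" by (simp add: f_def)
  qed
qed

section \<open>Second moments of the empirical tail\<close>

lemma integrable_branching_sum:
  assumes "H \<subseteq> {..<n}" and x: "x \<in> {- a..a}"
  shows "integrable (edge_space n) (\<lambda>X. \<bar>branching_sum n k H x X - c\<bar>)"
proof -
  have fin: "finite H" using assms finite_subset by blast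
  have "integrable (edge_space n) (branching_sum n k H x)"
  proof (rule integrable_edge_space)
    fix X
    have "max 0 (x + approx (edge_len d n X) a k H i) powr d \<le> (2 * a) powr d" for i
      using x approx_le[OF fin, of "edge_len d n X" a k i] d_ge_1 a_pos
      by (intro powr_mono2) auto
    then have "branching_sum n k H x X \<le> (\<Sum>i\<in>H. (2 * a) powr d / real n)"
      unfolding branching_sum_def by (intro sum_mono divide_right_mono) auto
    then show "\<bar>branching_sum n k H x X\<bar> \<le> (\<Sum>i\<in>H. (2 * a) powr d / real n)"
      using branching_sum_nonneg by simp
  qed (rule branching_sum_measurable[OF assms(1)])
  then show ?thesis by auto
qed

text \<open>Moving from \<open>S\<close> to \<open>S - {v, w}\<close> costs \<open>C / n\<close> for
  each of the two vertices. There the joint tail is an exact exponential, and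
  \<open>exp (- x)\<close> is 1-Lipschitz for \<open>x \<ge> 0\<close>.\<close>

lemma joint_tail_error:
  "\<exists>C\<ge>0. \<forall>n>0. \<forall>S v w x y. S \<subseteq> {..<n} \<longrightarrow> v \<in> S \<longrightarrow> w \<in> S \<longrightarrow> v \<noteq> w \<longrightarrow>
     x \<in> {- a..a} \<longrightarrow> y \<in> {- a..a} \<longrightarrow>
     \<bar>(\<integral>X. of_bool (x \<le> approx (edge_len d n X) a (Suc k) S v) *
           of_bool (y \<le> approx (edge_len d n X) a (Suc k) S w) \<partial>edge_space n)
        - limit_tail d a (Suc k) x * limit_tail d a (Suc k) y\<bar>
     \<le> C / real n + (\<integral>X. \<bar>branching_sum n k (S - {v, w}) x X - limit_sum k x\<bar> \<partial>edge_space n)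
       + (\<integral>X. \<bar>branching_sum n k (S - {v, w}) y X - limit_sum k y\<bar> \<partial>edge_space n)"
proof -
  let ?F = "\<lambda>n X S v. approx (edge_len d n X) a (Suc k) S v"
  obtain C where C: "0 \<le> C" "\<forall>n>0. \<forall>S v w. S \<subseteq> {..<n} \<longrightarrow> v < n \<longrightarrow> w < n \<longrightarrow> v \<noteq> w \<longrightarrow>
     (\<integral>X. of_bool (?F n X S v \<noteq> ?F n X (S - {w}) v) \<partial>edge_space n) \<le> C / real n"
    using approx_remove_vertex_prob[of "Suc k"] by (elim exE conjE)
  show ?thesis
  proof (intro exI[of _ "2 * C"] conjI allI impI)
    show "0 \<le> 2 * C" using C by simp
    fix n :: nat and S v w x y
    assume n: "0 < n" and S: "S \<subseteq> {..<n}" and v: "v \<in> S" and w: "w \<in> S" and vw: "v \<noteq> w"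
      and x: "x \<in> {- a..a}" and y: "y \<in> {- a..a}"
    have vn: "v < n" and wn: "w < n" using S v w by auto
    define H where "H = S - {v, w}"
    have Hn: "H \<subseteq> {..<n}" using S by (auto simp: H_def)
    \<comment> \<open>The value at \<open>v\<close> depends on the set without \<open>v\<close>, so
      deleting \<open>w\<close> alone already amounts to working on \<open>H\<close>.\<close>
    have Hv: "?F n X (S - {w}) v = ?F n X H v" for X
    proof -
      have "S - {w} - {v} = H - {v}" by (auto simp: H_def)
      then show ?thesis by simp
    qed
    have Hw: "?F n X (S - {v}) w = ?F n X H w" for X
    proof -
      have "S - {v} - {w} = H - {w}" by (auto simp: H_def)
      then show ?thesis by simp
    qed
    have Fm: "(\<lambda>X. ?F n X S' u) \<in> borel_measurable (edge_space n)" if "S' \<subseteq> {..<n}" "u < n" for S' u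
      using that by (rule approx_measurable)
    let ?I = "\<lambda>S X. of_bool (x \<le> ?F n X S v) * of_bool (y \<le> ?F n X S w) :: real"
    let ?N = "\<lambda>v w X. of_bool (?F n X S v \<noteq> ?F n X (S - {w}) v) :: real"
    have intI: "integrable (edge_space n) (?I S')" if "S' \<subseteq> {..<n}" for S'
      using that vn wn
      by (intro integrable_edge_space[where B = 1] borel_measurable_times of_bool_le_measurable
          borel_measurable_const Fm) auto
    have intN: "integrable (edge_space n) (?N u u')" if "u < n" "u' < n" for u u'
      using that S
      by (intro integrable_edge_space[where B = 1] of_bool_neq_measurable Fm) auto
    have "\<bar>(\<integral>X. ?I S X \<partial>edge_space n) - (\<integral>X. ?I H X \<partial>edge_space n)\<bar> =
        \<bar>\<integral>X. ?I S X - ?I H X \<partial>edge_space n\<bar>"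
      by (simp only: Bochner_Integration.integral_diff[OF intI[OF S] intI[OF Hn]])
    also have "\<dots> \<le> (\<integral>X. \<bar>?I S X - ?I H X\<bar> \<partial>edge_space n)"
      by (rule integral_abs_bound)
    also have "\<dots> \<le> (\<integral>X. ?N v w X + ?N w v X \<partial>edge_space n)"
    proof (rule integral_mono')
      show "integrable (edge_space n) (\<lambda>X. ?N v w X + ?N w v X)"
        by (intro Bochner_Integration.integrable_add intN vn wn)
      show "\<bar>?I S X - ?I H X\<bar> \<le> ?N v w X + ?N w v X" for X
        unfolding Hv Hw
        by (cases "?F n X S v = ?F n X H v"; cases "?F n X S w = ?F n X H w")
           (auto simp: of_bool_def simp del: approx.simps)
    qed simp
    also have "\<dots> = (\<integral>X. ?N v w X \<partial>edge_space n) + (\<integral>X. ?N w v X \<partial>edge_space n)"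
      by (intro Bochner_Integration.integral_add intN vn wn)
    also have "\<dots> \<le> C / real n + C / real n"
      using S vn wn vw n by (intro add_mono C(2)[rule_format]) auto
    finally have 1: "\<bar>(\<integral>X. ?I S X \<partial>edge_space n) - (\<integral>X. ?I H X \<partial>edge_space n)\<bar> \<le> 2 * C / real n"
      by simp
    let ?Z = "\<lambda>x X. branching_sum n k H x X"
    have 2: "(\<integral>X. ?I H X \<partial>edge_space n) = (\<integral>X. exp (- (?Z x X + ?Z y X)) \<partial>edge_space n)"
      using n Hn vn wn vw x y by (intro approx_joint_tail) (auto simp: H_def)
    let ?l = "exp (- (limit_sum k x + limit_sum k y))"
    have intZ: "integrable (edge_space n) (\<lambda>X. exp (- (?Z x X + ?Z y X)))"
    proof (intro integrable_edge_space[where B = 1])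
      have [measurable]: "?Z x \<in> borel_measurable (edge_space n)" "?Z y \<in> borel_measurable (edge_space n)"
        by (intro branching_sum_measurable Hn)+
      show "(\<lambda>X. exp (- (?Z x X + ?Z y X))) \<in> borel_measurable (edge_space n)" by measurable
      show "\<bar>exp (- (?Z x X + ?Z y X))\<bar> \<le> 1" for X
        using branching_sum_nonneg[of n k H x X] branching_sum_nonneg[of n k H y X] by simp
    qed
    have "\<bar>(\<integral>X. exp (- (?Z x X + ?Z y X)) \<partial>edge_space n) - ?l\<bar> =
        \<bar>\<integral>X. exp (- (?Z x X + ?Z y X)) - ?l \<partial>edge_space n\<bar>"
      using intZ by (simp add: Bochner_Integration.integral_diff edge_prob.prob_space)
    also have "\<dots> \<le> (\<integral>X. \<bar>exp (- (?Z x X + ?Z y X)) - ?l\<bar> \<partial>edge_space n)"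
      by (rule integral_abs_bound)
    also have "\<dots> \<le> (\<integral>X. \<bar>?Z x X - limit_sum k x\<bar> + \<bar>?Z y X - limit_sum k y\<bar> \<partial>edge_space n)"
    proof (rule integral_mono')
      show "integrable (edge_space n) (\<lambda>X. \<bar>?Z x X - limit_sum k x\<bar> + \<bar>?Z y X - limit_sum k y\<bar>)"
        by (intro Bochner_Integration.integrable_add integrable_branching_sum Hn x y)
      show "\<bar>exp (- (?Z x X + ?Z y X)) - ?l\<bar> \<le> \<bar>?Z x X - limit_sum k x\<bar> + \<bar>?Z y X - limit_sum k y\<bar>" for X
      proof -
        have "\<bar>exp (- (?Z x X + ?Z y X)) - ?l\<bar> \<le> \<bar>(?Z x X + ?Z y X) - (limit_sum k x + limit_sum k y)\<bar>"
          using branching_sum_nonneg limit_sum_nonneg by (intro abs_exp_minus_diff_le add_nonneg_nonneg)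
        then show ?thesis by linarith
      qed
    qed simp
    also have "\<dots> = (\<integral>X. \<bar>?Z x X - limit_sum k x\<bar> \<partial>edge_space n) + (\<integral>X. \<bar>?Z y X - limit_sum k y\<bar> \<partial>edge_space n)"
      by (intro Bochner_Integration.integral_add integrable_branching_sum Hn x y)
    finally have 3: "\<bar>(\<integral>X. exp (- (?Z x X + ?Z y X)) \<partial>edge_space n) - ?l\<bar> \<le>
      (\<integral>X. \<bar>?Z x X - limit_sum k x\<bar> \<partial>edge_space n) + (\<integral>X. \<bar>?Z y X - limit_sum k y\<bar> \<partial>edge_space n)" .
    have 4: "limit_tail d a (Suc k) x * limit_tail d a (Suc k) y = ?l"
      unfolding limit_tail_Suc by (simp add: exp_add[symmetric])
    show "\<bar>(\<integral>X. ?I S X \<partial>edge_space n) - limit_tail d a (Suc k) x * limit_tail d a (Suc k) y\<bar>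
     \<le> 2 * C / real n + (\<integral>X. \<bar>branching_sum n k (S - {v, w}) x X - limit_sum k x\<bar> \<partial>edge_space n)
       + (\<integral>X. \<bar>branching_sum n k (S - {v, w}) y X - limit_sum k y\<bar> \<partial>edge_space n)"
      unfolding H_def[symmetric] 4 using 1 2 3 by linarith
  qed
qed

text \<open>Cauchy-Schwarz on a probability space, read off from the nonnegativity of a
  variance.\<close>

lemma abs_integral_le_sqrt:
  fixes f :: "(nat \<times> nat \<Rightarrow> real) \<Rightarrow> real"
  assumes "f \<in> borel_measurable (edge_space n)" "\<And>X. \<bar>f X\<bar> \<le> B"
  shows "(\<integral>X. \<bar>f X\<bar> \<partial>edge_space n) \<le> sqrt (\<integral>X. (f X)\<^sup>2 \<partial>edge_space n)"
proof (rule real_le_rsqrt)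
  have i1: "integrable (edge_space n) (\<lambda>X. \<bar>f X\<bar>)"
    using assms by (intro integrable_edge_space[where B = B]) auto
  have i2: "integrable (edge_space n) (\<lambda>X. \<bar>f X\<bar>\<^sup>2)"
    using assms power_mono[OF assms(2), of _ 2] by (intro integrable_edge_space[where B = "B\<^sup>2"]) auto
  have "0 \<le> edge_prob.variance n (\<lambda>X. \<bar>f X\<bar>)" by (rule edge_prob.variance_positive)
  then show "(\<integral>X. \<bar>f X\<bar> \<partial>edge_space n)\<^sup>2 \<le> (\<integral>X. (f X)\<^sup>2 \<partial>edge_space n)"
    using edge_prob.variance_eq[OF i1 i2] by simp
qed

text \<open>Second moment bound: given the edges not meeting \<open>v\<close> and \<open>w\<close>, the tail events at \<open>v\<close> and
  at \<open>w\<close> are independent up to \<open>O(1/n)\<close>, with probabilities governed by \<open>branching_sum\<close>.\<close>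

lemma tail_frac_L1_bound:
  assumes x: "x \<in> {- a..a}"
  shows "\<exists>C\<ge>0. \<forall>n>0. \<forall>S \<zeta> \<zeta>'. S \<subseteq> {..<n} \<longrightarrow> n \<le> card S + m \<longrightarrow>
    (\<forall>H. H \<subseteq> {..<n} \<longrightarrow> n \<le> card H + (m + 2) \<longrightarrow>
       (\<integral>X. \<bar>branching_sum n k H x X - limit_sum k x\<bar> \<partial>edge_space n) \<le> \<zeta> \<and>
       (\<integral>X. \<bar>branching_sum n k H (- a) X - limit_sum k (- a)\<bar> \<partial>edge_space n) \<le> \<zeta>') \<longrightarrow>
    (\<integral>X. \<bar>tail_frac n (Suc k) S x X - limit_tail d a (Suc k) x\<bar> \<partial>edge_space n)
      \<le> sqrt (1 / real n + 3 * C / real n + 4 * \<zeta> + 2 * \<zeta>') + real m / real n"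
proof -
  let ?F = "\<lambda>n X S v. approx (edge_len d n X) a (Suc k) S v"
  define \<rho> where "\<rho> = limit_tail d a (Suc k) x"
  have \<rho>: "0 \<le> \<rho>" "\<rho> \<le> 1" unfolding \<rho>_def by (rule limit_tail_bounds)+
  have one: "limit_tail d a (Suc k) (- a) = 1" by (simp add: tail_op_at_minus_a)
  have x': "- a \<in> {- a..a}" using a_pos by simp
  obtain C where C: "0 \<le> C" "\<forall>n>0. \<forall>S v w x y. S \<subseteq> {..<n} \<longrightarrow> v \<in> S \<longrightarrow> w \<in> S \<longrightarrow> v \<noteq> w \<longrightarrow>
     x \<in> {- a..a} \<longrightarrow> y \<in> {- a..a} \<longrightarrow>
     \<bar>(\<integral>X. of_bool (x \<le> ?F n X S v) * of_bool (y \<le> ?F n X S w) \<partial>edge_space n)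
        - limit_tail d a (Suc k) x * limit_tail d a (Suc k) y\<bar>
     \<le> C / real n + (\<integral>X. \<bar>branching_sum n k (S - {v, w}) x X - limit_sum k x\<bar> \<partial>edge_space n)
       + (\<integral>X. \<bar>branching_sum n k (S - {v, w}) y X - limit_sum k y\<bar> \<partial>edge_space n)"
    using joint_tail_error[of k] by (elim exE conjE)
  show ?thesis
  proof (intro exI[of _ C] conjI C(1) allI impI)
    fix n :: nat and S :: "nat set" and \<zeta> \<zeta>' :: real
    assume n: "0 < n" and S: "S \<subseteq> {..<n}" and m: "n \<le> card S + m"
      and \<zeta>: "\<forall>H. H \<subseteq> {..<n} \<longrightarrow> n \<le> card H + (m + 2) \<longrightarrow>
       (\<integral>X. \<bar>branching_sum n k H x X - limit_sum k x\<bar> \<partial>edge_space n) \<le> \<zeta> \<and>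
       (\<integral>X. \<bar>branching_sum n k H (- a) X - limit_sum k (- a)\<bar> \<partial>edge_space n) \<le> \<zeta>'"
    have fin: "finite S" using S finite_subset by blast
    have Sn: "card S \<le> n" using card_mono[OF _ S] by simp
    let ?b = "\<lambda>v X. of_bool (x \<le> ?F n X S v) :: real"
    define \<eta> where "\<eta> = 3 * C / real n + 4 * \<zeta> + 2 * \<zeta>'"
    have z: "0 \<le> \<zeta>" "0 \<le> \<zeta>'"
    proof -
      have nonneg: "0 \<le> (\<integral>X. \<bar>branching_sum n k S y X - limit_sum k y\<bar> \<partial>edge_space n)" for y
        by (intro Bochner_Integration.integral_nonneg) simp
      have "n \<le> card S + (m + 2)" using m by simp
      note le = \<zeta>[rule_format, OF S this]
      show "0 \<le> \<zeta>" by (rule order_trans[OF nonneg conjunct1[OF le]])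
      show "0 \<le> \<zeta>'" by (rule order_trans[OF nonneg conjunct2[OF le]])
    qed
    have \<eta>: "0 \<le> \<eta>" using z C n by (simp add: \<eta>_def)
    have bm: "?b v \<in> borel_measurable (edge_space n)" if "v \<in> S" for v
      using that S by (intro of_bool_le_measurable borel_measurable_const approx_measurable) auto
    have i1: "integrable (edge_space n) (?b v)" if "v \<in> S" for v
      using bm[OF that] by (intro integrable_edge_space[where B = 1]) auto
    have i2: "integrable (edge_space n) (\<lambda>X. ?b v X * ?b w X)" if "v \<in> S" "w \<in> S" for v w
      using bm that by (intro integrable_edge_space[where B = 1] borel_measurable_times) auto
    have ge: "- a \<le> ?F n X S v" for X v
      using fin a_pos edge_len_nonneg by (intro approx_ge) auto
    have card2: "n \<le> card (S - {v, w}) + (m + 2)" if "v \<in> S" "w \<in> S" "v \<noteq> w" for v w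
    proof -
      have "card (S - {v, w}) = card S - card {v, w}"
        using that fin by (intro card_Diff_subset) auto
      then show ?thesis using m that by simp
    qed
    have sub: "S - {v, w} \<subseteq> {..<n}" for v w using S by auto
    have pair: "(\<integral>X. ?b v X * ?b w X \<partial>edge_space n) \<le> \<rho> * \<rho> + C / real n + 2 * \<zeta>"
      if vw: "v \<in> S" "w \<in> S" "v \<noteq> w" for v w
      using C(2)[rule_format, OF n S vw x x] \<zeta>[rule_format, OF sub card2[OF vw]]
      unfolding \<rho>_def by linarith
    \<comment> \<open>The joint estimate with second argument \<open>- a\<close>: that event is
      certain and its limit tail is \<open>1\<close>, so only \<open>v\<close> remains. This is
      where \<open>\<zeta>'\<close> comes from.\<close>
    have single: "\<rho> - (C / real n + \<zeta> + \<zeta>') \<le> (\<integral>X. ?b v X \<partial>edge_space n)"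
      if vw: "v \<in> S" "w \<in> S" "v \<noteq> w" for v w
    proof -
      have "(\<integral>X. ?b v X * of_bool (- a \<le> ?F n X S w) \<partial>edge_space n) = (\<integral>X. ?b v X \<partial>edge_space n)"
        using ge by (simp del: approx.simps)
      then show ?thesis
        using C(2)[rule_format, OF n S vw x x'] \<zeta>[rule_format, OF sub card2[OF vw]]
        unfolding \<rho>_def one by linarith
    qed
    \<comment> \<open>An upper bound is enough, so \<open>pair\<close> is used from above and
      \<open>single\<close> from below. With \<open>\<rho> \<le> 1\<close> the errors
      \<open>C / n + 2 * \<zeta>\<close> and twice \<open>C / n + \<zeta> + \<zeta>'\<close> add up
      to \<open>\<eta>\<close>.\<close>
    have cov: "(\<integral>X. (?b v X - \<rho>) * (?b w X - \<rho>) \<partial>edge_space n) \<le> \<eta>"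
      if vw: "v \<in> S" "w \<in> S" "v \<noteq> w" for v w
    proof -
      have "(\<integral>X. (?b v X - \<rho>) * (?b w X - \<rho>) \<partial>edge_space n) =
          (\<integral>X. ?b v X * ?b w X - \<rho> * ?b v X - \<rho> * ?b w X + \<rho> * \<rho> \<partial>edge_space n)"
        by (simp add: algebra_simps del: approx.simps)
      also have "\<dots> = (\<integral>X. ?b v X * ?b w X \<partial>edge_space n) - \<rho> * (\<integral>X. ?b v X \<partial>edge_space n)
          - \<rho> * (\<integral>X. ?b w X \<partial>edge_space n) + \<rho> * \<rho>"
        using i1[OF vw(1)] i1[OF vw(2)] i2[OF vw(1,2)]
        by (simp add: edge_prob.prob_space del: approx.simps)
      also have "\<dots> \<le> \<rho> * \<rho> + C / real n + 2 * \<zeta> - \<rho> * (\<rho> - (C / real n + \<zeta> + \<zeta>'))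
          - \<rho> * (\<rho> - (C / real n + \<zeta> + \<zeta>')) + \<rho> * \<rho>"
        using pair[OF vw] mult_left_mono[OF single[OF vw] \<rho>(1)]
          mult_left_mono[OF single[OF vw(2,1) vw(3)[symmetric]] \<rho>(1)] by linarith
      also have "\<dots> = C / real n + 2 * \<zeta> + 2 * (\<rho> * (C / real n + \<zeta> + \<zeta>'))"
        by (simp add: algebra_simps)
      also have "\<dots> \<le> C / real n + 2 * \<zeta> + 2 * (1 * (C / real n + \<zeta> + \<zeta>'))"
        using \<rho> z C n by (intro add_left_mono mult_left_mono mult_right_mono) auto
      also have "\<dots> = \<eta>" by (simp add: \<eta>_def)
      finally show ?thesis .
    qed
    have i3: "integrable (edge_space n) (\<lambda>X. (?b v X - \<rho>) * (?b w X - \<rho>))"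
      if "v \<in> S" "w \<in> S" for v w
    proof (intro integrable_edge_space[where B = 1] borel_measurable_times borel_measurable_diff
        borel_measurable_const bm that)
      fix X
      have "\<bar>?b u X - \<rho>\<bar> \<le> 1" for u using \<rho> by (simp add: of_bool_def del: approx.simps)
      then show "\<bar>(?b v X - \<rho>) * (?b w X - \<rho>)\<bar> \<le> 1"
        unfolding abs_mult by (intro mult_le_one) auto
    qed
    let ?Y = "\<lambda>X. (\<Sum>v\<in>S. ?b v X - \<rho>) / real n"
    have Y1: "\<bar>?Y X\<bar> \<le> 1" for X
    proof -
      have "\<bar>\<Sum>v\<in>S. ?b v X - \<rho>\<bar> \<le> (\<Sum>v\<in>S. 1)"
        using \<rho> by (intro order_trans[OF sum_abs] sum_mono) (simp add: of_bool_def del: approx.simps)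
      also have "\<dots> \<le> real n" using Sn by simp
      finally show ?thesis using n by (simp add: divide_le_eq_1 del: approx.simps)
    qed
    have Ym: "?Y \<in> borel_measurable (edge_space n)"
      by (intro borel_measurable_divide borel_measurable_sum borel_measurable_diff
          borel_measurable_const bm)
    have "(\<integral>X. (?Y X)\<^sup>2 \<partial>edge_space n) =
        (\<integral>X. (\<Sum>v\<in>S. \<Sum>w\<in>S. (?b v X - \<rho>) * (?b w X - \<rho>)) / (real n)\<^sup>2 \<partial>edge_space n)"
      by (simp add: power_divide power2_eq_square sum_product del: approx.simps)
    also have "\<dots> = (\<Sum>v\<in>S. \<Sum>w\<in>S. \<integral>X. (?b v X - \<rho>) * (?b w X - \<rho>) \<partial>edge_space n) / (real n)\<^sup>2"
      using i3 by (simp add: Bochner_Integration.integral_sum del: approx.simps)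
    \<comment> \<open>Diagonal terms are at most \<open>1\<close>; there are at most
      \<open>n\<close> of them, so they contribute \<open>1 / n\<close> after division.\<close>
    also have "\<dots> \<le> (\<Sum>v\<in>S. \<Sum>w\<in>S. of_bool (v = w) + \<eta>) / (real n)\<^sup>2"
    proof (intro divide_right_mono sum_mono)
      fix v w assume vw: "v \<in> S" "w \<in> S"
      show "(\<integral>X. (?b v X - \<rho>) * (?b w X - \<rho>) \<partial>edge_space n) \<le> of_bool (v = w) + \<eta>"
      proof (cases "v = w")
        case False then show ?thesis using cov[OF vw] by simp
      next
        case True
        have "(\<integral>X. (?b v X - \<rho>) * (?b w X - \<rho>) \<partial>edge_space n) \<le> (\<integral>X. 1 \<partial>edge_space n)"
        proof (rule integral_mono[OF i3[OF vw]])
          fix X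
          have "\<bar>?b u X - \<rho>\<bar> \<le> 1" for u using \<rho> by (simp add: of_bool_def del: approx.simps)
          then have "\<bar>(?b v X - \<rho>) * (?b w X - \<rho>)\<bar> \<le> 1"
            unfolding abs_mult by (intro mult_le_one) auto
          then show "(?b v X - \<rho>) * (?b w X - \<rho>) \<le> 1" by (rule order_trans[OF abs_ge_self])
        qed simp
        then show ?thesis using True \<eta> by (simp add: edge_prob.prob_space del: approx.simps)
      qed
    qed simp
    also have "\<dots> = (real (card S) + real (card S) * real (card S) * \<eta>) / (real n)\<^sup>2"
      using fin by (simp add: sum.distrib of_bool_def algebra_simps)
    also have "\<dots> \<le> (real n + real n * real n * \<eta>) / (real n)\<^sup>2"
      using Sn \<eta> by (intro divide_right_mono add_mono mult_right_mono mult_mono) auto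
    also have "\<dots> = 1 / real n + \<eta>" using n by (simp add: field_simps power2_eq_square)
    finally have sq: "(\<integral>X. (?Y X)\<^sup>2 \<partial>edge_space n) \<le> 1 / real n + \<eta>" .
    \<comment> \<open>The centred sum has \<open>card S\<close> terms but is divided by
      \<open>n\<close>; the discrepancy is at most \<open>m / n\<close>.\<close>
    have pt: "\<bar>tail_frac n (Suc k) S x X - \<rho>\<bar> \<le> \<bar>?Y X\<bar> + real m / real n" for X
    proof -
      have "tail_frac n (Suc k) S x X - \<rho> = ?Y X - \<rho> * ((real n - real (card S)) / real n)"
        using n by (simp add: tail_frac_def sum_subtractf field_simps del: approx.simps)
      moreover have "\<bar>\<rho> * ((real n - real (card S)) / real n)\<bar> \<le> 1 * (real m / real n)"
        unfolding abs_mult using \<rho> m Sn n by (intro mult_mono) (auto simp: divide_right_mono)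
      ultimately show ?thesis by linarith
    qed
    have "(\<integral>X. \<bar>tail_frac n (Suc k) S x X - \<rho>\<bar> \<partial>edge_space n) \<le> (\<integral>X. \<bar>?Y X\<bar> + real m / real n \<partial>edge_space n)"
    proof (rule integral_mono'[OF _ pt])
      show "integrable (edge_space n) (\<lambda>X. \<bar>?Y X\<bar> + real m / real n)"
        by (intro Bochner_Integration.integrable_add integrable_abs integrable_edge_space[OF Ym Y1]) simp
    qed simp
    also have "\<dots> = (\<integral>X. \<bar>?Y X\<bar> \<partial>edge_space n) + real m / real n"
      by (subst Bochner_Integration.integral_add)
        (intro integrable_abs integrable_edge_space[OF Ym Y1], simp_all add: edge_prob.prob_space del: approx.simps)
    also have "(\<integral>X. \<bar>?Y X\<bar> \<partial>edge_space n) \<le> sqrt (\<integral>X. (?Y X)\<^sup>2 \<partial>edge_space n)"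
      by (rule abs_integral_le_sqrt[OF Ym Y1])
    also have "\<dots> \<le> sqrt (1 / real n + \<eta>)" using sq by simp
    finally show "(\<integral>X. \<bar>tail_frac n (Suc k) S x X - limit_tail d a (Suc k) x\<bar> \<partial>edge_space n)
      \<le> sqrt (1 / real n + 3 * C / real n + 4 * \<zeta> + 2 * \<zeta>') + real m / real n"
      by (simp add: \<rho>_def \<eta>_def add.assoc del: limit_tail.simps)
  qed
qed

text \<open>Induction on \<open>k\<close> with \<open>m\<close> arbitrary: the step for
  \<open>m\<close> uses depth \<open>k\<close> on sets that miss up to \<open>m + 2\<close>
  vertices, because the second moment removes a pair. The rate depends on \<open>n\<close> alone and
  serves all these sets.\<close>

theorem tail_frac_tendsto:
  assumes "t \<in> {- a..a}"
  shows "\<exists>\<zeta>. \<zeta> \<longlonglongrightarrow> 0 \<and> (\<forall>n S. S \<subseteq> {..<n} \<longrightarrow> n \<le> card S + m \<longrightarrow>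
      (\<integral>X. \<bar>tail_frac n k S t X - limit_tail d a k t\<bar> \<partial>edge_space n) \<le> \<zeta> n)"
  using assms
proof (induction k arbitrary: m t)
  case 0
  show ?case
  \<comment> \<open>At \<open>n = 0\<close> the empirical tail is \<open>0 / 0 = 0\<close> and the
    error is \<open>1\<close>; \<open>of_bool\<close> and \<open>max\<close> make the rate cover
    this case.\<close>
  proof (intro exI[of _ "\<lambda>n. (real m + of_bool (n = 0)) / real (max 1 n)"] conjI allI impI)
    show "(\<lambda>n. (real m + of_bool (n = 0)) / real (max 1 n)) \<longlonglongrightarrow> 0"
    proof (rule Lim_transform_eventually[of "\<lambda>n. real m / real n"])
      show "(\<lambda>n. real m / real n) \<longlonglongrightarrow> 0" by real_asymp
      show "\<forall>\<^sub>F n in sequentially. real m / real n = (real m + of_bool (n = 0)) / real (max 1 n)"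
        using eventually_gt_at_top[of 0] by eventually_elim (auto simp: max_def)
    qed
    fix n :: nat and S :: "nat set" assume S: "S \<subseteq> {..<n}" "n \<le> card S + m"
    have "card S \<le> n" using card_mono[OF _ S(1)] by simp
    have tf: "tail_frac n 0 S t X = real (card S) / real n" for X
      using 0 by (simp add: tail_frac_def)
    have "\<bar>tail_frac n 0 S t X - 1\<bar> \<le> (real m + of_bool (n = 0)) / real (max 1 n)" for X
    proof (cases "n = 0")
      case True
      then show ?thesis by (simp add: tail_frac_def)
    next
      case False
      have "tail_frac n 0 S t X - 1 = - ((real n - real (card S)) / real n)"
        using False tf[of X] by (simp add: field_simps)
      then have "\<bar>tail_frac n 0 S t X - 1\<bar> = (real n - real (card S)) / real n"
        using \<open>card S \<le> n\<close> by simp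
      also have "\<dots> \<le> real m / real n" using S(2) by (intro divide_right_mono) auto
      finally show ?thesis using False by (simp add: max_def)
    qed
    then have "(\<integral>X. \<bar>tail_frac n 0 S t X - 1\<bar> \<partial>edge_space n) \<le>
        (\<integral>X. (real m + of_bool (n = 0)) / real (max 1 n) \<partial>edge_space n)"
      by (intro integral_mono') auto
    then show "(\<integral>X. \<bar>tail_frac n 0 S t X - limit_tail d a 0 t\<bar> \<partial>edge_space n) \<le>
        (real m + of_bool (n = 0)) / real (max 1 n)"
      by (simp add: edge_prob.prob_space)
  qed
next
  case (Suc k)
  have a: "- a \<in> {- a..a}" using a_pos by simp
  have ex: "\<exists>\<zeta>. \<zeta> \<longlonglongrightarrow> 0 \<and> (\<forall>n H. H \<subseteq> {..<n} \<longrightarrow> n \<le> card H + (m + 2) \<longrightarrow>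
      (\<integral>X. \<bar>branching_sum n k H x X - limit_sum k x\<bar> \<partial>edge_space n) \<le> \<zeta> n)"
    if "x \<in> {- a..a}" for x
    by (intro branching_sum_tendsto Suc.IH that)
  obtain \<zeta> where z: "\<zeta> \<longlonglongrightarrow> 0" "\<forall>n H. H \<subseteq> {..<n} \<longrightarrow> n \<le> card H + (m + 2) \<longrightarrow>
      (\<integral>X. \<bar>branching_sum n k H t X - limit_sum k t\<bar> \<partial>edge_space n) \<le> \<zeta> n"
    using ex[OF Suc.prems] by (elim exE conjE)
  obtain \<zeta>' where z': "\<zeta>' \<longlonglongrightarrow> 0" "\<forall>n H. H \<subseteq> {..<n} \<longrightarrow> n \<le> card H + (m + 2) \<longrightarrow>
      (\<integral>X. \<bar>branching_sum n k H (- a) X - limit_sum k (- a)\<bar> \<partial>edge_space n) \<le> \<zeta>' n"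
    using ex[OF a] by (elim exE conjE)
  obtain C where C: "\<forall>n>0. \<forall>S \<zeta> \<zeta>'. S \<subseteq> {..<n} \<longrightarrow> n \<le> card S + m \<longrightarrow>
    (\<forall>H. H \<subseteq> {..<n} \<longrightarrow> n \<le> card H + (m + 2) \<longrightarrow>
       (\<integral>X. \<bar>branching_sum n k H t X - limit_sum k t\<bar> \<partial>edge_space n) \<le> \<zeta> \<and>
       (\<integral>X. \<bar>branching_sum n k H (- a) X - limit_sum k (- a)\<bar> \<partial>edge_space n) \<le> \<zeta>') \<longrightarrow>
    (\<integral>X. \<bar>tail_frac n (Suc k) S t X - limit_tail d a (Suc k) t\<bar> \<partial>edge_space n)
      \<le> sqrt (1 / real n + 3 * C / real n + 4 * \<zeta> + 2 * \<zeta>') + real m / real n"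
    using tail_frac_L1_bound[OF Suc.prems, of m k] by (elim exE conjE)
  define g where "g = (\<lambda>n. sqrt (1 / real n + 3 * C / real n + 4 * \<zeta> n + 2 * \<zeta>' n) + real m / real n)"
  have g: "g \<longlonglongrightarrow> 0"
  proof -
    have "(\<lambda>n. 1 / real n) \<longlonglongrightarrow> 0" "(\<lambda>n. 3 * C / real n) \<longlonglongrightarrow> 0" "(\<lambda>n. real m / real n) \<longlonglongrightarrow> 0"
      by real_asymp+
    then have "g \<longlonglongrightarrow> sqrt (0 + 0 + 4 * 0 + 2 * 0) + 0"
      unfolding g_def using z(1) z'(1) by (intro tendsto_intros)
    then show ?thesis by simp
  qed
  show ?case
  proof (intro exI[of _ "\<lambda>n. if n = 0 then 1 else g n"] conjI allI impI)
    show "(\<lambda>n. if n = 0 then 1 else g n) \<longlonglongrightarrow> 0"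
    proof (rule Lim_transform_eventually[OF g])
      show "\<forall>\<^sub>F n in sequentially. g n = (if n = 0 then 1 else g n)"
        using eventually_gt_at_top[of 0] by eventually_elim simp
    qed
    fix n :: nat and S :: "nat set" assume S: "S \<subseteq> {..<n}" "n \<le> card S + m"
    show "(\<integral>X. \<bar>tail_frac n (Suc k) S t X - limit_tail d a (Suc k) t\<bar> \<partial>edge_space n)
        \<le> (if n = 0 then 1 else g n)"
    proof (cases "n = 0")
      case True
      have "\<bar>tail_frac n (Suc k) S t X - limit_tail d a (Suc k) t\<bar> \<le> 1" for X
        using True limit_tail_bounds[of "Suc k" t] by (simp add: tail_frac_def del: limit_tail.simps approx.simps)
      then have "(\<integral>X. \<bar>tail_frac n (Suc k) S t X - limit_tail d a (Suc k) t\<bar> \<partial>edge_space n) \<le> (\<integral>X. 1 \<partial>edge_space n)"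
        by (intro integral_mono') auto
      then show ?thesis using True by (simp add: edge_prob.prob_space del: limit_tail.simps)
    next
      case False
      then show ?thesis
        using C[rule_format, of n S "\<zeta> n" "\<zeta>' n"] S z(2) z'(2) by (simp add: g_def del: limit_tail.simps)
    qed
  qed
qed

end

subsection \<open>Free vertices and optimal cost\<close>

lemma matching_cost_nonneg:
  "(\<And>e. 0 \<le> l e) \<Longrightarrow> 0 \<le> a \<Longrightarrow> 0 \<le> matching_cost l a S M"
  by (simp add: matching_cost_def sum_nonneg)

lemma opt_nonneg:
  assumes "finite S" "\<And>e. 0 \<le> l e" "0 \<le> a"
  shows "0 \<le> opt l a S"
proof -
  obtain M where "opt l a S = matching_cost l a S M"
    using opt_attained[OF assms(1)] by blast
  then show ?thesis using matching_cost_nonneg[of l a S M] assms(2,3) by simp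
qed

lemma opt_le_card: "finite S \<Longrightarrow> opt l a S \<le> a * real (card S)"
  using opt_le[OF _ matching_in_empty, of S l a] by (simp add: matching_cost_def)

definition unique_opt :: "(nat \<times> nat \<Rightarrow> real) \<Rightarrow> real \<Rightarrow> nat set \<Rightarrow> bool" where
  "unique_opt l a S \<longleftrightarrow> (\<exists>!M. matching_in S M \<and> matching_cost l a S M = opt l a S)"

text \<open>Stated through \<open>marg\<close>, not through an optimal matching: this is measurable
  without choosing an optimum and can be compared with the truncations.\<close>

definition free_count :: "(nat \<times> nat \<Rightarrow> real) \<Rightarrow> real \<Rightarrow> nat set \<Rightarrow> real" where
  "free_count l a S = (\<Sum>v\<in>S. of_bool (a \<le> marg l a S v))"

lemma free_count_eq_card:
  assumes S: "finite S" and u: "unique_opt l a S"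
    and M: "matching_in S M" "matching_cost l a S M = opt l a S"
  shows "free_count l a S = real (card (S - \<Union>(verts ` M)))"
proof -
  have "a \<le> marg l a S v \<longleftrightarrow> v \<notin> \<Union>(verts ` M)" if "v \<in> S" for v
    using u M unfolding unique_opt_def by (subst uncovered_iff_marg[OF S that M]) auto
  then have "free_count l a S = (\<Sum>v\<in>S. of_bool (v \<notin> \<Union>(verts ` M)))"
    unfolding free_count_def by (intro sum.cong) auto
  also have "\<dots> = (\<Sum>v\<in>S - \<Union>(verts ` M). 1)"
    using S by (intro sum.mono_neutral_cong_right) auto
  finally show ?thesis by simp
qed

text \<open>The cost of a fixed matching is affine in the parameter, with slope the number of its
  free vertices. Evaluating the optimum for \<open>b\<close> at the parameter \<open>a\<close> gives
  the inequality.\<close>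

lemma opt_supergradient:
  assumes S: "finite S" and u: "unique_opt l b S"
  shows "opt l a S \<le> opt l b S + (a - b) * free_count l b S"
proof -
  obtain M where M: "matching_in S M" "opt l b S = matching_cost l b S M"
    using opt_attained[OF S] by metis
  have "opt l a S \<le> matching_cost l a S M" by (rule opt_le[OF S M(1)])
  also have "\<dots> = opt l b S + (a - b) * free_count l b S"
    using M free_count_eq_card[OF S u M(1) M(2)[symmetric]] by (simp add: matching_cost_def algebra_simps)
  finally show ?thesis .
qed

lemma free_count_bounds:
  "0 \<le> free_count l a S" "free_count l a S \<le> real (card S)"
proof -
  show "0 \<le> free_count l a S" by (simp add: free_count_def sum_nonneg)
  have "free_count l a S \<le> (\<Sum>v\<in>S. 1)" unfolding free_count_def by (intro sum_mono) auto
  then show "free_count l a S \<le> real (card S)" by simp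
qed

text \<open>Supergradients at both ends of a mesh interval squeeze the increment of
  \<open>opt\<close> between \<open>h * U (Suc i)\<close> and \<open>h * U i\<close>. The two
  Riemann sums differ by a telescoping \<open>h * (U 0 - U m)\<close>, and \<open>opt\<close>
  vanishes at parameter \<open>0\<close>.\<close>

lemma opt_riemann_sum:
  assumes S: "finite S" and l: "\<And>e. 0 \<le> l e" and h: "0 \<le> h"
    and u: "\<And>j. j \<in> {1..m} \<Longrightarrow> unique_opt l (real j * h) S"
  shows "\<bar>opt l (real m * h) S - h * (\<Sum>j=1..m. free_count l (real j * h) S)\<bar> \<le> h * real (card S)"
proof -
  \<comment> \<open>Uniqueness is assumed from \<open>j = 1\<close> on; at \<open>j = 0\<close> the
    trivial slope \<open>card S\<close> replaces the free count.\<close>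
  define U where "U = (\<lambda>j::nat. if j = 0 then real (card S) else free_count l (real j * h) S)"
  have U: "0 \<le> U j" for j using free_count_bounds by (simp add: U_def)
  have bounds: "h * (\<Sum>j<i. U (Suc j)) \<le> opt l (real i * h) S \<and> opt l (real i * h) S \<le> h * (\<Sum>j<i. U j)"
    if "i \<le> m" for i
    using that
  proof (induction i)
    case 0
    have "opt l 0 S = 0"
      using opt_nonneg[OF S, of l 0] opt_le_card[OF S, of l 0] l by simp
    then show ?case by simp
  next
    case (Suc i)
    have "opt l (real i * h) S \<le> opt l (real (Suc i) * h) S - h * U (Suc i)"
      using opt_supergradient[OF S u, of "Suc i" "real i * h"] Suc.prems
      by (simp add: U_def algebra_simps)
    moreover have "opt l (real (Suc i) * h) S \<le> opt l (real i * h) S + h * U i"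
    proof (cases "i = 0")
      case True
      then show ?thesis
        using opt_le_card[OF S, of l h] opt_nonneg[OF S, of l 0] l by (simp add: U_def)
    next
      case False
      then show ?thesis
        using opt_supergradient[OF S u, of i "real (Suc i) * h"] Suc.prems
        by (simp add: U_def algebra_simps)
    qed
    ultimately show ?case using Suc by (simp add: distrib_left)
  qed
  have "h * (\<Sum>j<m. U j) - h * (\<Sum>j<m. U (Suc j)) = h * (U 0 - U m)"
    unfolding right_diff_distrib[symmetric] sum_subtractf[symmetric] by (simp add: sum_lessThan_telescope')
  also have "\<dots> \<le> h * real (card S)" using U[of m] h by (intro mult_left_mono) (auto simp: U_def)
  finally have "h * (\<Sum>j<m. U j) - h * (\<Sum>j<m. U (Suc j)) \<le> h * real (card S)" .
  moreover have "(\<Sum>j=1..m. free_count l (real j * h) S) = (\<Sum>j<m. U (Suc j))"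
    by (simp add: sum.atLeast1_atMost_eq U_def)
  ultimately show ?thesis using bounds[of m] h by (simp add: abs_le_iff)
qed

section \<open>Translation of the given notions into \<open>opt\<close> and
  \<open>free_count\<close>\<close>

lemma partial_matching_iff: "partial_matching n M \<longleftrightarrow> matching_in {..<n} M"
proof -
  have "edges n = {(i, j). i < j \<and> i \<in> {..<n} \<and> j \<in> {..<n}}" by (auto simp: edges_def)
  then show ?thesis by (simp add: partial_matching_def matching_in_def)
qed

lemma diluted_cost_eq:
  "diluted_cost d \<theta> n X M = matching_cost (edge_len d n X) (\<theta> / 2) {..<n} M"
  by (simp add: diluted_cost_def matching_cost_def lessThan_atLeast0)

lemma optimal_diluted_iff:
  "optimal_diluted d \<theta> n X M \<longleftrightarrow> matching_in {..<n} M \<and>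
     matching_cost (edge_len d n X) (\<theta> / 2) {..<n} M = opt (edge_len d n X) (\<theta> / 2) {..<n}"
proof -
  let ?c = "matching_cost (edge_len d n X) (\<theta> / 2) {..<n}" and ?o = "opt (edge_len d n X) (\<theta> / 2) {..<n}"
  obtain M0 where M0: "matching_in {..<n} M0" "?o = ?c M0"
    using opt_attained[of "{..<n}"] by blast
  show ?thesis
    unfolding optimal_diluted_def partial_matching_iff diluted_cost_eq
    using M0 opt_le[of "{..<n}" _ "edge_len d n X" "\<theta> / 2"] by (metis antisym finite_lessThan)
qed

lemma M_len_eq:
  assumes u: "unique_opt (edge_len d n X) (\<theta> / 2) {..<n}"
  shows "M_len d \<theta> n X = opt (edge_len d n X) (\<theta> / 2) {..<n}
     - \<theta> / 2 * free_count (edge_len d n X) (\<theta> / 2) {..<n}"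
proof -
  have ex1: "\<exists>!M. optimal_diluted d \<theta> n X M"
    using u by (simp add: unique_opt_def optimal_diluted_iff)
  define M where "M = (THE M. optimal_diluted d \<theta> n X M)"
  have "optimal_diluted d \<theta> n X M" unfolding M_def by (rule theI'[OF ex1])
  then have M: "matching_in {..<n} M"
    "matching_cost (edge_len d n X) (\<theta> / 2) {..<n} M = opt (edge_len d n X) (\<theta> / 2) {..<n}"
    by (simp_all add: optimal_diluted_iff)
  have "M_len d \<theta> n X = (\<Sum>e\<in>M. edge_len d n X e)" using ex1 by (simp add: M_len_def M_def)
  moreover have "free_count (edge_len d n X) (\<theta> / 2) {..<n} = real (card ({..<n} - \<Union>(verts ` M)))"
    by (rule free_count_eq_card[OF finite_lessThan u M])
  ultimately show ?thesis using M(2) by (simp add: matching_cost_def)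
qed

section \<open>Measurability and almost sure uniqueness of the optimum\<close>

lemma matching_cost_measurable:
  assumes "matching_in S M" "S \<subseteq> {..<n}"
  shows "(\<lambda>X. matching_cost (edge_len d n X) a S M) \<in> borel_measurable (edge_space n)"
  unfolding matching_cost_def
proof (intro borel_measurable_add borel_measurable_sum borel_measurable_const edge_len_measurable)
  fix e assume "e \<in> M"
  then show "e \<in> edges n" using assms by (auto simp: matching_in_def edges_def)
qed

lemma opt_measurable:
  assumes "S \<subseteq> {..<n}"
  shows "(\<lambda>X. opt (edge_len d n X) a S) \<in> borel_measurable (edge_space n)"
  unfolding opt_def
  using assms finite_matchings[OF finite_subset[OF assms finite_lessThan]]
  by (intro borel_measurable_Min matching_cost_measurable) auto

lemma free_count_measurable:
  "(\<lambda>X. free_count (edge_len d n X) a {..<n}) \<in> borel_measurable (edge_space n)"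
  unfolding free_count_def marg_def
  by (intro borel_measurable_sum of_bool_le_measurable borel_measurable_diff opt_measurable
      borel_measurable_const) auto

context diluted
begin

text \<open>The probability of a tie is at most the difference of the tail probabilities at
  \<open>c\<close> and at \<open>c + s\<close>. The tail formula is continuous in \<open>s\<close>,
  so this vanishes as \<open>s\<close> decreases to \<open>0\<close>.\<close>

lemma edge_len_no_atom:
  assumes n: "0 < n" and e: "e \<in> edges n" and c: "c \<in> borel_measurable (edge_space n)"
    and c_ign: "\<And>X y. c (X(e := y)) = c X"
  shows "AE X in edge_space n. edge_len d n X e \<noteq> c X"
proof -
  let ?l = "\<lambda>X. edge_len d n X e"
  let ?g = "\<lambda>s X. exp (- (max 0 (c X + s) powr d) / real n)"
  have lm: "?l \<in> borel_measurable (edge_space n)" by (rule edge_len_measurable[OF e])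
  have g01: "0 \<le> ?g s X" "?g s X \<le> 1" for s X by auto
  have gm: "?g s \<in> borel_measurable (edge_space n)" for s using c by measurable
  have ig: "integrable (edge_space n) (?g s)" for s
    using gm by (intro integrable_edge_space[where B = 1]) auto
  have ib: "integrable (edge_space n) (\<lambda>X. of_bool (c X + s \<le> ?l X) :: real)" for s
    using c lm by (intro integrable_edge_space[where B = 1] of_bool_le_measurable borel_measurable_add) auto
  have eqm: "(\<lambda>X. of_bool (?l X \<noteq> c X) :: real) \<in> borel_measurable (edge_space n)"
    using lm c by (rule of_bool_neq_measurable)
  have eqi: "integrable (edge_space n) (\<lambda>X. 1 - of_bool (?l X \<noteq> c X) :: real)"
    using eqm by (intro integrable_edge_space[where B = 1] borel_measurable_diff) auto
  have P: "(\<integral>X. of_bool (c X + s \<le> ?l X) \<partial>edge_space n) = (\<integral>X. ?g s X \<partial>edge_space n)" for s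
    using integral_replace_edge[OF n e, of "\<lambda>_. 1" "\<lambda>X. c X + s"] c c_ign by simp
  have le: "(\<integral>X. (1 :: real) - of_bool (?l X \<noteq> c X) \<partial>edge_space n) \<le> (\<integral>X. ?g 0 X \<partial>edge_space n) - (\<integral>X. ?g s X \<partial>edge_space n)"
    if s: "0 < s" for s
  proof -
    have "(\<integral>X. (1 :: real) - of_bool (?l X \<noteq> c X) \<partial>edge_space n) \<le>
        (\<integral>X. of_bool (c X + 0 \<le> ?l X) - of_bool (c X + s \<le> ?l X) \<partial>edge_space n)"
    proof (rule integral_mono[OF eqi Bochner_Integration.integrable_diff[OF ib ib]])
      show "1 - of_bool (?l X \<noteq> c X) \<le> of_bool (c X + 0 \<le> ?l X) - (of_bool (c X + s \<le> ?l X) :: real)" for X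
        using s by (auto simp: of_bool_def)
    qed
    also have "\<dots> = (\<integral>X. ?g 0 X \<partial>edge_space n) - (\<integral>X. ?g s X \<partial>edge_space n)"
      unfolding Bochner_Integration.integral_diff[OF ib ib] P ..
    finally show ?thesis .
  qed
  have lim: "(\<lambda>j. \<integral>X. ?g (1 / real (Suc j)) X \<partial>edge_space n) \<longlonglongrightarrow> (\<integral>X. ?g 0 X \<partial>edge_space n)"
  proof (rule integral_dominated_convergence[where w = "\<lambda>_. 1"])
    show "AE X in edge_space n. (\<lambda>j. ?g (1 / real (Suc j)) X) \<longlonglongrightarrow> ?g 0 X"
    proof (rule AE_I2)
      fix X
      have "(\<lambda>j. c X + 1 / real (Suc j)) \<longlonglongrightarrow> c X + 0"
        by (intro tendsto_intros LIMSEQ_Suc[OF lim_1_over_n])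
      then show "(\<lambda>j. ?g (1 / real (Suc j)) X) \<longlonglongrightarrow> ?g 0 X"
        using d_ge_1 n
        by (intro tendsto_exp tendsto_minus tendsto_divide tendsto_powr' tendsto_max tendsto_const)
           (auto simp del: of_nat_Suc)
    qed
    show "?g 0 \<in> borel_measurable (edge_space n)" by (rule gm)
    show "?g (1 / real (Suc j)) \<in> borel_measurable (edge_space n)" for j by (rule gm)
  qed (use g01 in auto)
  have "(\<integral>X. (1 :: real) - of_bool (?l X \<noteq> c X) \<partial>edge_space n) \<le> (\<integral>X. ?g 0 X \<partial>edge_space n) - (\<integral>X. ?g 0 X \<partial>edge_space n)"
    by (rule tendsto_lowerbound[OF tendsto_diff[OF tendsto_const lim]])
       (rule always_eventually, rule allI, rule le, simp_all)
  moreover have "0 \<le> (\<integral>X. (1 :: real) - of_bool (?l X \<noteq> c X) \<partial>edge_space n)"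
    by (intro Bochner_Integration.integral_nonneg) simp
  ultimately have "(\<integral>X. (1 :: real) - of_bool (?l X \<noteq> c X) \<partial>edge_space n) = 0" by simp
  then have "AE X in edge_space n. (1 - of_bool (?l X \<noteq> c X) :: real) = 0"
    by (subst (asm) integral_nonneg_eq_0_iff_AE[OF eqi]) auto
  then show ?thesis by eventually_elim (auto simp: of_bool_def split: if_splits)
qed

text \<open>Some edge \<open>e\<close> lies in exactly one of the matchings. Equal costs would force
  its length to equal a quantity that does not involve \<open>e\<close>, a null event.\<close>

lemma AE_matching_cost_neq:
  assumes M: "matching_in {..<n} M" "matching_in {..<n} M'" "M \<noteq> M'"
  shows "AE X in edge_space n. matching_cost (edge_len d n X) b {..<n} M \<noteq> matching_cost (edge_len d n X) b {..<n} M'"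
proof -
  have *: "AE X in edge_space n. matching_cost (edge_len d n X) b {..<n} M \<noteq> matching_cost (edge_len d n X) b {..<n} M'"
    if M: "matching_in {..<n} M" "matching_in {..<n} M'" and e: "e \<in> M" "e \<notin> M'" for M M' e
  proof -
    have fin: "finite M" "finite M'" using finite_matching_in[of "{..<n}"] M by auto
    have en: "e \<in> edges n" using M(1) e(1) by (auto simp: matching_in_def edges_def)
    then have n: "0 < n" by (auto simp: edges_def)
    define c where "c = (\<lambda>X. matching_cost (edge_len d n X) b {..<n} M' - (\<Sum>f\<in>M - {e}. edge_len d n X f)
        - b * real (card ({..<n} - \<Union>(verts ` M))))"
    have "c \<in> borel_measurable (edge_space n)"
      unfolding c_def
    proof (intro borel_measurable_diff matching_cost_measurable M borel_measurable_sum
        edge_len_measurable borel_measurable_const)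
      show "f \<in> edges n" if "f \<in> M - {e}" for f
        using that M(1) by (auto simp: matching_in_def edges_def)
    qed simp
    moreover have "c (X(e := y)) = c X" for X y
    proof -
      have "(\<Sum>f\<in>T. edge_len d n (X(e := y)) f) = (\<Sum>f\<in>T. edge_len d n X f)" if "e \<notin> T" for T
        using that by (intro sum.cong) (auto simp: edge_len_def)
      then show ?thesis using e(2) by (simp add: c_def matching_cost_def)
    qed
    ultimately have "AE X in edge_space n. edge_len d n X e \<noteq> c X"
      by (intro edge_len_no_atom n en)
    then show ?thesis
    proof eventually_elim
      case (elim X)
      then show ?case using sum.remove[OF fin(1) e(1), of "edge_len d n X"]
        by (auto simp: c_def matching_cost_def)
    qed
  qed
  from M(3) consider e where "e \<in> M" "e \<notin> M'" | e where "e \<in> M'" "e \<notin> M" by blast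
  then show ?thesis
  proof cases
    case 1 then show ?thesis using * M by blast
  next
    case 2
    from *[OF M(2,1) 2] show ?thesis by eventually_elim simp
  qed
qed

lemma AE_unique_opt: "AE X in edge_space n. unique_opt (edge_len d n X) b {..<n}"
proof -
  let ?G = "{M. matching_in {..<n} M}"
  have "AE X in edge_space n. \<forall>M\<in>?G. \<forall>M'\<in>?G. M \<noteq> M' \<longrightarrow>
      matching_cost (edge_len d n X) b {..<n} M \<noteq> matching_cost (edge_len d n X) b {..<n} M'"
    by (intro AE_finite_allI finite_matchings finite_lessThan)
       (auto intro: AE_matching_cost_neq)
  then show ?thesis
  proof eventually_elim
    case (elim X)
    obtain M where M: "matching_in {..<n} M" "opt (edge_len d n X) b {..<n} = matching_cost (edge_len d n X) b {..<n} M"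
      using opt_attained[of "{..<n}"] by blast
    show ?case unfolding unique_opt_def
    proof (rule ex1I[of _ M])
      fix M' assume "matching_in {..<n} M' \<and> matching_cost (edge_len d n X) b {..<n} M' = opt (edge_len d n X) b {..<n}"
      then show "M' = M" using elim M by (metis mem_Collect_eq)
    qed (use M in simp)
  qed
qed

section \<open>Convergence of the free fraction and of the optimal cost\<close>

lemma integrable_free_count:
  "integrable (edge_space n) (\<lambda>X. \<bar>free_count (edge_len d n X) b {..<n} / real n - c\<bar>)"
proof -
  have "integrable (edge_space n) (\<lambda>X. free_count (edge_len d n X) b {..<n})"
    using free_count_bounds[of _ b "{..<n}"]
    by (intro integrable_edge_space[where B = "real n"] free_count_measurable) simp
  then show ?thesis by auto
qed

lemma integrable_opt:
  assumes "0 \<le> b"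
  shows "integrable (edge_space n) (\<lambda>X. opt (edge_len d n X) b {..<n} / real n)"
proof -
  have "integrable (edge_space n) (\<lambda>X. opt (edge_len d n X) b {..<n})"
    using opt_nonneg[of "{..<n}"] edge_len_nonneg assms opt_le_card[of "{..<n}" _ b]
    by (intro integrable_edge_space[where B = "b * real n"] opt_measurable) (auto simp: abs_le_iff intro: order_trans)
  then show ?thesis by auto
qed

lemma free_count_sandwich:
  assumes "odd k"
  shows "tail_frac n k {..<n} a X \<le> free_count (edge_len d n X) a {..<n} / real n"
    and "free_count (edge_len d n X) a {..<n} / real n \<le> tail_frac n (Suc k) {..<n} a X"
proof -
  let ?l = "edge_len d n X"
  have le: "approx ?l a k {..<n} v \<le> marg ?l a {..<n} v" "marg ?l a {..<n} v \<le> approx ?l a (Suc k) {..<n} v"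
    if "v < n" for v
    using approx_marg[of "{..<n}" v k ?l a] approx_marg[of "{..<n}" v "Suc k" ?l a] that assms by auto
  show "tail_frac n k {..<n} a X \<le> free_count ?l a {..<n} / real n"
    unfolding tail_frac_def free_count_def
    using le(1) by (intro divide_right_mono sum_mono) (auto simp: of_bool_def intro: order_trans[OF _ le(1)])
  show "free_count ?l a {..<n} / real n \<le> tail_frac n (Suc k) {..<n} a X"
    unfolding tail_frac_def free_count_def
  proof (intro divide_right_mono sum_mono)
    fix v assume "v \<in> {..<n}"
    then show "of_bool (a \<le> marg ?l a {..<n} v) \<le> (of_bool (a \<le> approx ?l a (Suc k) {..<n} v) :: real)"
      using le(2)[of v] by (auto simp: of_bool_def simp del: approx.simps)
  qed simp
qed

text \<open>The free fraction lies between two consecutive empirical tails at \<open>a\<close>, each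
  close to its deterministic limit; both limits approach \<open>u\<close> as the depth
  grows.\<close>

lemma free_count_L1_tendsto:
  "\<exists>u. (\<lambda>n. \<integral>X. \<bar>free_count (edge_len d n X) a {..<n} / real n - u\<bar> \<partial>edge_space n) \<longlonglongrightarrow> 0"
proof -
  obtain u where u: "(\<lambda>k. limit_tail d a k a) \<longlonglongrightarrow> u"
    using limit_tail_convergent by (auto simp: convergent_def)
  let ?r = "\<lambda>k. limit_tail d a k a"
  let ?e = "\<lambda>k n. \<integral>X. \<bar>tail_frac n k {..<n} a X - ?r k\<bar> \<partial>edge_space n"
  have e: "?e k \<longlonglongrightarrow> 0" for k
  proof -
    have "a \<in> {- a..a}" using a_pos by simp
    from tail_frac_tendsto[OF this, of 0 k]
    obtain \<zeta> where z: "\<zeta> \<longlonglongrightarrow> 0" "\<forall>n S. S \<subseteq> {..<n} \<longrightarrow> n \<le> card S + 0 \<longrightarrow>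
      (\<integral>X. \<bar>tail_frac n k S a X - ?r k\<bar> \<partial>edge_space n) \<le> \<zeta> n" by (elim exE conjE)
    have "?e k n \<le> \<zeta> n" for n using z(2)[rule_format, of "{..<n}" n] by simp
    moreover have "0 \<le> ?e k n" for n by (intro Bochner_Integration.integral_nonneg) simp
    ultimately show ?thesis
      using z(1) by (intro real_tendsto_sandwich[OF _ _ tendsto_const z(1)]) (auto intro!: always_eventually)
  qed
  let ?f = "\<lambda>n. \<integral>X. \<bar>free_count (edge_len d n X) a {..<n} / real n - u\<bar> \<partial>edge_space n"
  have f_le: "?f n \<le> ?e k n + ?e (Suc k) n + (\<bar>?r k - u\<bar> + \<bar>?r (Suc k) - u\<bar>)" if k: "odd k" for n k
  proof -
    have int: "integrable (edge_space n) (\<lambda>X. \<bar>tail_frac n k' {..<n} a X - ?r k'\<bar>)" for k'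
    proof -
      have "integrable (edge_space n) (tail_frac n k' {..<n} a)"
        using tail_frac_nonneg tail_frac_le_1
        by (intro integrable_edge_space[where B = 1] tail_frac_measurable) auto
      then show ?thesis by auto
    qed
    have "?f n \<le> (\<integral>X. (\<bar>tail_frac n k {..<n} a X - ?r k\<bar> + \<bar>tail_frac n (Suc k) {..<n} a X - ?r (Suc k)\<bar>)
        + (\<bar>?r k - u\<bar> + \<bar>?r (Suc k) - u\<bar>) \<partial>edge_space n)"
    proof (rule integral_mono[OF integrable_free_count])
      fix X
      show "\<bar>free_count (edge_len d n X) a {..<n} / real n - u\<bar> \<le>
        (\<bar>tail_frac n k {..<n} a X - ?r k\<bar> + \<bar>tail_frac n (Suc k) {..<n} a X - ?r (Suc k)\<bar>)
        + (\<bar>?r k - u\<bar> + \<bar>?r (Suc k) - u\<bar>)"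
        using free_count_sandwich[OF k, of n X] by linarith
    qed (intro Bochner_Integration.integrable_add int edge_prob.integrable_const)
    also have "\<dots> = ?e k n + ?e (Suc k) n + (\<bar>?r k - u\<bar> + \<bar>?r (Suc k) - u\<bar>)"
      using int[of k] int[of "Suc k"]
      by (simp add: Bochner_Integration.integral_add edge_prob.prob_space del: limit_tail.simps)
    finally show ?thesis .
  qed
  have "?f \<longlonglongrightarrow> 0"
  proof (rule LIMSEQ_I)
    fix \<epsilon> :: real assume \<epsilon>: "0 < \<epsilon>"
    obtain K where K: "\<And>k. K \<le> k \<Longrightarrow> \<bar>?r k - u\<bar> < \<epsilon> / 4"
      using LIMSEQ_D[OF u, of "\<epsilon> / 4"] \<epsilon> by auto
    \<comment> \<open>Odd, so that depth \<open>k\<close> bounds from below and \<open>Suc k\<close>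
      from above, and at least \<open>K\<close>, so that both limits are near
      \<open>u\<close>.\<close>
    define k where "k = 2 * K + 1"
    have k: "odd k" "K \<le> k" by (auto simp: k_def)
    obtain N where N: "\<And>n. N \<le> n \<Longrightarrow> \<bar>?e k n\<bar> < \<epsilon> / 4"
      using LIMSEQ_D[OF e[of k], of "\<epsilon> / 4"] \<epsilon> by auto
    obtain N' where N': "\<And>n. N' \<le> n \<Longrightarrow> \<bar>?e (Suc k) n\<bar> < \<epsilon> / 4"
      using LIMSEQ_D[OF e[of "Suc k"], of "\<epsilon> / 4"] \<epsilon> by auto
    show "\<exists>no. \<forall>n\<ge>no. norm (?f n - 0) < \<epsilon>"
    proof (intro exI allI impI)
      fix n assume "max N N' \<le> n"
      then have "\<bar>?e k n\<bar> < \<epsilon> / 4" "\<bar>?e (Suc k) n\<bar> < \<epsilon> / 4" using N N' by auto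
      moreover have "\<bar>?r k - u\<bar> < \<epsilon> / 4" "\<bar>?r (Suc k) - u\<bar> < \<epsilon> / 4"
        using K[of k] K[of "Suc k"] k by auto
      moreover have "0 \<le> ?f n" by (intro Bochner_Integration.integral_nonneg) simp
      ultimately show "norm (?f n - 0) < \<epsilon>" using f_le[OF k(1), of n] by simp
    qed
  qed
  then show ?thesis by blast
qed

lemma opt_riemann_L1:
  assumes m: "0 < m"
  shows "(\<integral>X. \<bar>opt (edge_len d n X) a {..<n} / real n - a / real m * (\<Sum>j=1..m. u j)\<bar> \<partial>edge_space n) \<le>
    a / real m + a / real m * (\<Sum>j=1..m.
      \<integral>X. \<bar>free_count (edge_len d n X) (real j * (a / real m)) {..<n} / real n - u j\<bar> \<partial>edge_space n)"
proof -
  define h where "h = a / real m"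
  have h: "0 < h" "real m * h = a" using m a_pos by (auto simp: h_def)
  let ?l = "\<lambda>X. edge_len d n X"
  let ?D = "\<lambda>j X. \<bar>free_count (?l X) (real j * h) {..<n} / real n - u j\<bar>"
  \<comment> \<open>Only finitely many mesh points occur, so one null set serves them all.\<close>
  have AE: "AE X in edge_space n. \<forall>j\<in>{1..m}. unique_opt (?l X) (real j * h) {..<n}"
    by (intro AE_finite_allI AE_unique_opt) simp
  have ae: "AE X in edge_space n. \<bar>opt (?l X) a {..<n} / real n - h * (\<Sum>j=1..m. u j)\<bar> \<le> h + h * (\<Sum>j=1..m. ?D j X)"
    using AE
  proof eventually_elim
    case (elim X)
    let ?U = "\<lambda>j. free_count (?l X) (real j * h) {..<n}"
    have "\<bar>opt (?l X) a {..<n} - h * (\<Sum>j=1..m. ?U j)\<bar> \<le> h * real n"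
      using opt_riemann_sum[of "{..<n}" "?l X" h m] elim h edge_len_nonneg by simp
    then have "\<bar>opt (?l X) a {..<n} - h * (\<Sum>j=1..m. ?U j)\<bar> / real n \<le> h"
      using h by (cases "n = 0") (auto simp: divide_le_eq)
    moreover have "opt (?l X) a {..<n} / real n - h * (\<Sum>j=1..m. ?U j / real n) =
        (opt (?l X) a {..<n} - h * (\<Sum>j=1..m. ?U j)) / real n"
      by (simp add: diff_divide_distrib sum_divide_distrib[symmetric])
    ultimately have 1: "\<bar>opt (?l X) a {..<n} / real n - h * (\<Sum>j=1..m. ?U j / real n)\<bar> \<le> h"
      by (simp only: abs_divide abs_of_nat)
    have "\<bar>h * (\<Sum>j=1..m. ?U j / real n) - h * (\<Sum>j=1..m. u j)\<bar> = h * \<bar>\<Sum>j=1..m. ?U j / real n - u j\<bar>"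
      using h by (simp add: right_diff_distrib[symmetric] sum_subtractf abs_mult)
    also have "\<dots> \<le> h * (\<Sum>j=1..m. ?D j X)" using h by (intro mult_left_mono sum_abs) auto
    finally show ?case using 1 by linarith
  qed
  have intD: "integrable (edge_space n) (?D j)" for j by (rule integrable_free_count)
  have intO: "integrable (edge_space n) (\<lambda>X. \<bar>opt (?l X) a {..<n} / real n - c\<bar>)" for c
    using integrable_opt[of a n] a_pos by auto
  have "(\<integral>X. \<bar>opt (?l X) a {..<n} / real n - h * (\<Sum>j=1..m. u j)\<bar> \<partial>edge_space n) \<le>
      (\<integral>X. h + h * (\<Sum>j=1..m. ?D j X) \<partial>edge_space n)"
    using intD by (intro integral_mono_AE intO ae) auto
  also have "\<dots> = h + h * (\<Sum>j=1..m. \<integral>X. ?D j X \<partial>edge_space n)"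
    using intD by (simp add: Bochner_Integration.integral_add edge_prob.prob_space)
  finally show ?thesis by (simp add: h_def)
qed

text \<open>For each mesh \<open>a / m\<close> the cost per vertex is eventually within
  \<open>2 * (a / m)\<close> in mean of the number \<open>\<rho> m\<close>: one \<open>a / m\<close>
  for the Riemann sum and one for the free fractions. The limit arises as the Cauchy limit of the
  means, so no integral of \<open>u\<close> over the parameter has to be formed.\<close>

lemma opt_L1_tendsto:
  "\<exists>c. (\<lambda>n. \<integral>X. \<bar>opt (edge_len d n X) a {..<n} / real n - c\<bar> \<partial>edge_space n) \<longlonglongrightarrow> 0"
proof -
  have ex: "\<exists>u. (\<lambda>n. \<integral>X. \<bar>free_count (edge_len d n X) b {..<n} / real n - u\<bar> \<partial>edge_space n) \<longlonglongrightarrow> 0"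
    if "0 < b" for b
  proof -
    interpret b: diluted d b using d_ge_1 that by unfold_locales
    show ?thesis by (rule b.free_count_L1_tendsto)
  qed
  define u where "u = (\<lambda>b. SOME u.
      (\<lambda>n. \<integral>X. \<bar>free_count (edge_len d n X) b {..<n} / real n - u\<bar> \<partial>edge_space n) \<longlonglongrightarrow> 0)"
  have u: "(\<lambda>n. \<integral>X. \<bar>free_count (edge_len d n X) b {..<n} / real n - u b\<bar> \<partial>edge_space n) \<longlonglongrightarrow> 0"
    if "0 < b" for b
    unfolding u_def by (rule someI_ex[OF ex[OF that]])
  let ?Y = "\<lambda>n X. opt (edge_len d n X) a {..<n} / real n"
  define \<rho> where "\<rho> = (\<lambda>m. a / real m * (\<Sum>j=1..m. u (real j * (a / real m))))"
  have iY: "integrable (edge_space n) (?Y n)" for n using integrable_opt[of a n] a_pos by simp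
  have intO: "integrable (edge_space n) (\<lambda>X. \<bar>?Y n X - c\<bar>)" for c n using iY[of n] by auto
  have near: "\<forall>\<^sub>F n in sequentially. (\<integral>X. \<bar>?Y n X - \<rho> m\<bar> \<partial>edge_space n) \<le> 2 * (a / real m)"
    if m: "0 < m" for m
  proof -
    let ?E = "\<lambda>n. a / real m * (\<Sum>j=1..m.
      \<integral>X. \<bar>free_count (edge_len d n X) (real j * (a / real m)) {..<n} / real n - u (real j * (a / real m))\<bar> \<partial>edge_space n)"
    have "?E \<longlonglongrightarrow> a / real m * (\<Sum>j=1..m. 0)"
      using m a_pos by (intro tendsto_intros u) auto
    then have "?E \<longlonglongrightarrow> 0" by simp
    moreover have "0 < a / real m" using m a_pos by simp
    ultimately have "\<forall>\<^sub>F n in sequentially. ?E n < a / real m" by (rule order_tendstoD)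
    then show ?thesis
    proof eventually_elim
      case (elim n)
      then show ?case
        using opt_riemann_L1[OF m, of n "\<lambda>j. u (real j * (a / real m))"] unfolding \<rho>_def by linarith
    qed
  qed
  \<comment> \<open>Deterministic proxies: whatever number the cost is close to in mean, its
    expectation is close to as well.\<close>
  define y where "y = (\<lambda>n. \<integral>X. ?Y n X \<partial>edge_space n)"
  have y_near: "\<bar>y n - c\<bar> \<le> (\<integral>X. \<bar>?Y n X - c\<bar> \<partial>edge_space n)" for n c
  proof -
    have "y n - c = (\<integral>X. ?Y n X - c \<partial>edge_space n)"
      using iY[of n] by (simp add: y_def Bochner_Integration.integral_diff edge_prob.prob_space)
    then show ?thesis using integral_abs_bound[of "edge_space n" "\<lambda>X. ?Y n X - c"] by simp
  qed
  have small: "\<exists>m>0. a / real m < \<epsilon>" if "0 < \<epsilon>" for \<epsilon> :: real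
  proof -
    obtain m :: nat where "a / \<epsilon> < real m" using reals_Archimedean2 by blast
    moreover from this have "0 < real m" using that a_pos by (meson divide_pos_pos less_trans)
    ultimately show ?thesis using that by (intro exI[of _ m]) (auto simp: field_simps)
  qed
  have "Cauchy y"
  proof (rule metric_CauchyI)
    fix \<epsilon> :: real assume "0 < \<epsilon>"
    \<comment> \<open>Two means lie within \<open>2 * (a / m)\<close> of \<open>\<rho> m\<close>
      each, so their distance is at most \<open>4 * (a / m)\<close>.\<close>
    then obtain m where m: "0 < m" "a / real m < \<epsilon> / 5" using small[of "\<epsilon> / 5"] by auto
    obtain N where N: "\<And>n. N \<le> n \<Longrightarrow> (\<integral>X. \<bar>?Y n X - \<rho> m\<bar> \<partial>edge_space n) \<le> 2 * (a / real m)"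
      using near[OF m(1)] by (auto simp: eventually_sequentially)
    show "\<exists>N. \<forall>i\<ge>N. \<forall>j\<ge>N. dist (y i) (y j) < \<epsilon>"
    proof (intro exI allI impI)
      fix i j assume "N \<le> i" "N \<le> j"
      then show "dist (y i) (y j) < \<epsilon>"
        using N[of i] N[of j] y_near[of i "\<rho> m"] y_near[of j "\<rho> m"] m(2) \<open>0 < \<epsilon>\<close>
        unfolding dist_real_def by linarith
    qed
  qed
  then obtain c where c: "y \<longlonglongrightarrow> c" using Cauchy_convergent by (auto simp: convergent_def)
  have "(\<lambda>n. \<integral>X. \<bar>?Y n X - c\<bar> \<partial>edge_space n) \<longlonglongrightarrow> 0"
  proof (rule LIMSEQ_I)
    fix \<epsilon> :: real assume \<epsilon>: "0 < \<epsilon>"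
    \<comment> \<open>The cost is within \<open>2 * (a / m)\<close> of \<open>\<rho> m\<close>, this
      within \<open>2 * (a / m)\<close> of \<open>y n\<close>, and that within
      \<open>\<epsilon> / 6\<close> of \<open>c\<close>: five sixths of \<open>\<epsilon>\<close> in
      total.\<close>
    then obtain m where m: "0 < m" "a / real m < \<epsilon> / 6" using small[of "\<epsilon> / 6"] by auto
    obtain N where N: "\<And>n. N \<le> n \<Longrightarrow> (\<integral>X. \<bar>?Y n X - \<rho> m\<bar> \<partial>edge_space n) \<le> 2 * (a / real m)"
      using near[OF m(1)] by (auto simp: eventually_sequentially)
    obtain N' where N': "\<And>n. N' \<le> n \<Longrightarrow> \<bar>y n - c\<bar> < \<epsilon> / 6"
      using LIMSEQ_D[OF c, of "\<epsilon> / 6"] \<epsilon> by auto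
    show "\<exists>no. \<forall>n\<ge>no. norm ((\<integral>X. \<bar>?Y n X - c\<bar> \<partial>edge_space n) - 0) < \<epsilon>"
    proof (intro exI allI impI)
      fix n assume n: "max N N' \<le> n"
      have "(\<integral>X. \<bar>?Y n X - c\<bar> \<partial>edge_space n) \<le> (\<integral>X. \<bar>?Y n X - \<rho> m\<bar> + \<bar>\<rho> m - c\<bar> \<partial>edge_space n)"
        by (intro integral_mono intO Bochner_Integration.integrable_add) auto
      also have "\<dots> = (\<integral>X. \<bar>?Y n X - \<rho> m\<bar> \<partial>edge_space n) + \<bar>\<rho> m - c\<bar>"
        using intO[of n "\<rho> m"] by (simp add: Bochner_Integration.integral_add edge_prob.prob_space)
      finally have "(\<integral>X. \<bar>?Y n X - c\<bar> \<partial>edge_space n) < \<epsilon>"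
        using N[of n] N'[of n] n y_near[of n "\<rho> m"] m(2) by linarith
      moreover have "0 \<le> (\<integral>X. \<bar>?Y n X - c\<bar> \<partial>edge_space n)"
        by (intro Bochner_Integration.integral_nonneg) simp
      ultimately show "norm ((\<integral>X. \<bar>?Y n X - c\<bar> \<partial>edge_space n) - 0) < \<epsilon>" by simp
    qed
  qed
  then show ?thesis by blast
qed

end

theorem theorem2:
  fixes d \<theta> :: real
  assumes "d \<ge> 1" and "\<theta> > 0"
  shows "\<exists>\<beta>::real. \<forall>\<epsilon>>0.
           (\<lambda>n. measure (edge_space n)
                   {X \<in> space (edge_space n). \<bar>M_len d \<theta> n X / real n - \<beta>\<bar> > \<epsilon>})
           \<longlonglongrightarrow> 0"
proof -
  define a where "a = \<theta> / 2"
  interpret diluted d a using assms by unfold_locales (auto simp: a_def)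
  let ?O = "\<lambda>n X. opt (edge_len d n X) a {..<n} / real n"
  let ?U = "\<lambda>n X. free_count (edge_len d n X) a {..<n} / real n"
  obtain c where c: "(\<lambda>n. \<integral>X. \<bar>?O n X - c\<bar> \<partial>edge_space n) \<longlonglongrightarrow> 0"
    using opt_L1_tendsto by blast
  obtain u where u: "(\<lambda>n. \<integral>X. \<bar>?U n X - u\<bar> \<partial>edge_space n) \<longlonglongrightarrow> 0"
    using free_count_L1_tendsto by blast
  \<comment> \<open>Off the null set of ties, where \<open>M_len\<close> is set to \<open>0\<close>,
    this dominates the deviation of \<open>M_len\<close> from \<open>c - a * u\<close> after
    division by \<open>n\<close>. Markov's inequality for \<open>W\<close> then gives convergence in
    probability.\<close>
  define W where "W = (\<lambda>n X. \<bar>?O n X - c\<bar> + a * \<bar>?U n X - u\<bar>)"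
  have intO: "integrable (edge_space n) (\<lambda>X. \<bar>?O n X - c\<bar>)" for n
    using integrable_opt[of a n] a_pos by auto
  have intU: "integrable (edge_space n) (\<lambda>X. \<bar>?U n X - u\<bar>)" for n by (rule integrable_free_count)
  have intW: "integrable (edge_space n) (W n)" for n
    unfolding W_def using intO intU by (intro Bochner_Integration.integrable_add integrable_mult_right)
  have "(\<integral>X. W n X \<partial>edge_space n) = (\<integral>X. \<bar>?O n X - c\<bar> \<partial>edge_space n) + a * (\<integral>X. \<bar>?U n X - u\<bar> \<partial>edge_space n)" for n
    unfolding W_def using intO[of n] intU[of n] by (simp add: Bochner_Integration.integral_add)
  then have W: "(\<lambda>n. \<integral>X. W n X \<partial>edge_space n) \<longlonglongrightarrow> 0"
    using tendsto_add[OF c tendsto_mult_left[OF u, of a]] by simp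
  have W0: "0 \<le> W n X" for n X using a_pos by (simp add: W_def)
  show ?thesis
  proof (intro exI[of _ "c - a * u"] allI impI)
    fix \<epsilon> :: real assume \<epsilon>: "0 < \<epsilon>"
    let ?A = "\<lambda>n. {X \<in> space (edge_space n). \<bar>M_len d \<theta> n X / real n - (c - a * u)\<bar> > \<epsilon>}"
    have le: "measure (edge_space n) (?A n) \<le> (\<integral>X. W n X \<partial>edge_space n) / \<epsilon>" for n
    proof -
      let ?B = "{X \<in> space (edge_space n). \<epsilon> \<le> W n X}"
      have B: "?B \<in> sets (edge_space n)" using intW[of n] by measurable
      have "AE X in edge_space n. X \<in> ?A n \<longrightarrow> X \<in> ?B"
        using AE_unique_opt[of n a]
      proof eventually_elim
        case (elim X)
        have "M_len d \<theta> n X / real n = ?O n X - a * ?U n X"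
          using M_len_eq[of d n X \<theta>] elim unfolding a_def by (simp add: diff_divide_distrib)
        then have "M_len d \<theta> n X / real n - (c - a * u) = (?O n X - c) - a * (?U n X - u)"
          by (simp add: algebra_simps)
        moreover have "\<bar>a * (?U n X - u)\<bar> = a * \<bar>?U n X - u\<bar>" using a_pos by (simp add: abs_mult)
        ultimately have "\<bar>M_len d \<theta> n X / real n - (c - a * u)\<bar> \<le> W n X"
          unfolding W_def by linarith
        then show ?case by auto
      qed
      then have "measure (edge_space n) (?A n) \<le> measure (edge_space n) ?B"
        by (rule edge_prob.finite_measure_mono_AE[OF _ B])
      also have "\<dots> \<le> (\<integral>X. W n X \<partial>edge_space n) / \<epsilon>"
        using intW W0 \<epsilon> by (intro integral_Markov_inequality_measure[where A = "space (edge_space n)"]) auto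
      finally show ?thesis .
    qed
    have lim: "(\<lambda>n. (\<integral>X. W n X \<partial>edge_space n) / \<epsilon>) \<longlonglongrightarrow> 0"
      using tendsto_divide[OF W tendsto_const[of \<epsilon>]] \<epsilon> by simp
    show "(\<lambda>n. measure (edge_space n) (?A n)) \<longlonglongrightarrow> 0"
      by (rule real_tendsto_sandwich[OF _ _ tendsto_const lim])
         (auto intro!: always_eventually le)
  qed
qed

end
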